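(* Let $A=\Bbbk[x_1,\dots,x_n]$, and let $\mathbf f=f_1,\dots,f_c$ be homogeneous forms of degrees $e_1\le\cdots\le e_c$ such that $f_1,\dots,f_c,x_{c+1},\dots,x_n$ is a regular sequence in $A$. Let $\overline{\mathbf f}=\overline f_1,\dots,\overline f_c$ be the images of $\mathbf f$ in $\Bbbk[x_1,\dots,x_c]=A/(x_{c+1},\dots,x_n)$. If $\overline{\mathbf f}$ satisfies both the Eisenbud–Green–Harris property and the lex-plus-powers property in $\Bbbk[x_1,\dots,x_c]$, then $\mathbf f$ satisfies both properties in $A$.
   Context: Let $P=\Bbbk[x_1,\dots,x_m]$ and let $\mathbf g=g_1,\dots,g_c$ be a homogeneous $P$-regular sequence with degrees $e_1\le\cdots\le e_c$. Put $\mathfrak a=(\mathbf g)$ and $\mathfrak b=(x_1^{e_1},\dots,x_c^{e_c})\subseteq P$. $\mathbf g$ satisfies the Eisenbud–Green–Harris (EGH) property if, for every homogeneous ideal $I\supseteq\mathfrak a$ of $P$, there is a homogeneous ideal $I'\supseteq\mathfrak b$ with $H_{P/I'}=H_{P/I}$. Equivalently, there is a lex-segment ideal $L$ of $P$ with $H_{P/(L+\mathfrak b)}=H_{P/I}$. Lex-segment ideals are taken for the lexicographic order $x_1>\cdots>x_m$: their degree-$d$ part is spanned by an initial lex segment of degree-$d$ monomials for each $d$. $\mathbf g$ satisfies the lex-plus-powers (LPP) property if it satisfies EGH and, for every homogeneous ideal $I\supseteq\mathfrak a$ of $P$ and the lex-segment ideal $L$ with $H_{P/(L+\mathfrak b)}=H_{P/I}$,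 one has $\beta^P_{i,j}(I)\le\beta^P_{i,j}(L+\mathfrak b)$ for all $i,j$. Here $\beta^P_{i,j}(M)=\dim_\Bbbk\operatorname{Tor}_i^P(M,\Bbbk)_j$ and $H$ denotes the Hilbert series. *)

theory Defs
  imports Complex_Main "HOL-Library.Poly_Mapping" "HOL-Library.Function_Algebras"
begin

(* Polynomials over a field 'k in the variables x_0, x_1, ... are represented as
  finitely supported maps from monomials (exponent vectors nat =>0 nat) to coefficients.
  Variable x_v is indexed from 0, so x_1,...,x_m of the paper are x_0,...,x_{m-1} here. *)

type_synonym 'k mpoly = "(nat \<Rightarrow>\<^sub>0 nat) \<Rightarrow>\<^sub>0 'k"

definition tdeg :: "(nat \<Rightarrow>\<^sub>0 nat) \<Rightarrow> nat" where
  "tdeg t = sum (Poly_Mapping.lookup t) (Poly_Mapping.keys t)"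

definition mons :: "nat \<Rightarrow> (nat \<Rightarrow>\<^sub>0 nat) set" where
  "mons m = {t. \<forall>v\<in>Poly_Mapping.keys t. v < m}"

definition polys :: "nat \<Rightarrow> 'k::field mpoly set" where
  "polys m = {p. Poly_Mapping.keys p \<subseteq> mons m}"

definition var :: "nat \<Rightarrow> 'k::field mpoly" where
  "var v = Poly_Mapping.single (Poly_Mapping.single v 1) 1"

definition const :: "'k::field \<Rightarrow> 'k mpoly" where
  "const c = Poly_Mapping.single 0 c"

definition pscale :: "'k::field \<Rightarrow> 'k mpoly \<Rightarrow> 'k mpoly" where
  "pscale c p = const c * p"

(* homogeneous of degree d (the zero polynomial is homogeneous of every degree) *)
definition homog :: "nat \<Rightarrow> 'k::field mpoly \<Rightarrow> bool" where
  "homog d p \<longleftrightarrow> (\<forall>t\<in>Poly_Mapping.keys p. tdeg t = d)"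

definition hcomp :: "nat \<Rightarrow> 'k::field mpoly \<Rightarrow> 'k mpoly" where
  "hcomp d p = (\<Sum>t\<in>{t\<in>Poly_Mapping.keys p. tdeg t = d}. Poly_Mapping.single t (Poly_Mapping.lookup p t))"

definition is_ideal :: "nat \<Rightarrow> 'k::field mpoly set \<Rightarrow> bool" where
  "is_ideal m I \<longleftrightarrow> I \<subseteq> polys m \<and> 0 \<in> I \<and> (\<forall>p\<in>I. \<forall>q\<in>I. p + q \<in> I)
     \<and> (\<forall>p\<in>I. \<forall>q\<in>polys m. q * p \<in> I)"

definition homog_ideal :: "nat \<Rightarrow> 'k::field mpoly set \<Rightarrow> bool" where
  "homog_ideal m I \<longleftrightarrow> is_ideal m I \<and> (\<forall>p\<in>I. \<forall>d. hcomp d p \<in> I)"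

definition ideal_gen :: "nat \<Rightarrow> 'k::field mpoly set \<Rightarrow> 'k mpoly set" where
  "ideal_gen m G = \<Inter>{I. is_ideal m I \<and> G \<subseteq> I}"

definition regular_seq :: "nat \<Rightarrow> 'k::field mpoly list \<Rightarrow> bool" where
  "regular_seq m gs \<longleftrightarrow> set gs \<subseteq> polys m \<and> 1 \<notin> ideal_gen m (set gs) \<and>
     (\<forall>i<length gs. \<forall>p\<in>polys m.
        gs ! i * p \<in> ideal_gen m (set (take i gs)) \<longrightarrow> p \<in> ideal_gen m (set (take i gs)))"

definition gpiece :: "nat \<Rightarrow> 'k::field mpoly set \<Rightarrow> 'k mpoly set" where
  "gpiece d I = {p\<in>I. homog d p}"

definition hilb :: "nat \<Rightarrow> 'k::field mpoly set \<Rightarrow> nat \<Rightarrow> nat" where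
  "hilb m I d = card {t\<in>mons m. tdeg t = d} - vector_space.dim pscale (gpiece d I)"

definition lex_gt :: "(nat \<Rightarrow>\<^sub>0 nat) \<Rightarrow> (nat \<Rightarrow>\<^sub>0 nat) \<Rightarrow> bool" where
  "lex_gt t u \<longleftrightarrow> (\<exists>v. Poly_Mapping.lookup t v > Poly_Mapping.lookup u v \<and> (\<forall>w<v. Poly_Mapping.lookup t w = Poly_Mapping.lookup u w))"

definition lex_ideal :: "nat \<Rightarrow> 'k::field mpoly set \<Rightarrow> bool" where
  "lex_ideal m L \<longleftrightarrow> is_ideal m L
     \<and> (\<forall>p\<in>polys m. p \<in> L \<longleftrightarrow> (\<forall>t\<in>Poly_Mapping.keys p. Poly_Mapping.single t 1 \<in> L))
     \<and> (\<forall>t\<in>mons m. \<forall>u\<in>mons m. tdeg t = tdeg u \<and> lex_gt t u \<and> Poly_Mapping.single u 1 \<in> L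
          \<longrightarrow> Poly_Mapping.single t 1 \<in> L)"

definition pow_ideal :: "nat \<Rightarrow> nat list \<Rightarrow> 'k::field mpoly set" where
  "pow_ideal m es = ideal_gen m {var i ^ (es ! i) | i. i < length es}"

(* Graded Betti numbers beta_{i,j}(I) = dim_k Tor_i^P(I,k)_j, computed as the homology of
  I tensored with the Koszul complex K(x_0..x_{m-1}) (the standard graded free resolution of k).
  A chain of (K_i \<otimes> I)_j is a map f sending each i-subset S of {0..m-1} (basis element e_S
  of degree i) to an element of I_{j-i}. *)
definition kchains :: "nat \<Rightarrow> 'k::field mpoly set \<Rightarrow> nat \<Rightarrow> nat \<Rightarrow> (nat set \<Rightarrow> 'k mpoly) set" where
  "kchains m I i j = {f. (\<forall>S. f S \<noteq> 0 \<longrightarrow> S \<subseteq> {..<m} \<and> card S = i \<and> i \<le> j)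
                       \<and> (\<forall>S. f S \<in> gpiece (j - i) I)}"

(* Koszul differential d(e_S) = sum_{s in S} (-1)^{#{t in S. t < s}} x_s e_{S - {s}} *)
definition kdiff :: "nat \<Rightarrow> nat \<Rightarrow> (nat set \<Rightarrow> 'k::field mpoly) \<Rightarrow> (nat set \<Rightarrow> 'k mpoly)" where
  "kdiff m i f T = (if 0 < i \<and> T \<subseteq> {..<m} \<and> card T = i - 1 then
      (\<Sum>s\<in>{..<m} - T. (- 1) ^ card {t\<in>T. t < s} * var s * f (insert s T)) else 0)"

definition cscale :: "'k::field \<Rightarrow> (nat set \<Rightarrow> 'k mpoly) \<Rightarrow> (nat set \<Rightarrow> 'k mpoly)" where
  "cscale c f = (\<lambda>S. pscale c (f S))"

definition betti :: "nat \<Rightarrow> 'k::field mpoly set \<Rightarrow> nat \<Rightarrow> nat \<Rightarrow> nat" where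
  "betti m I i j =
     vector_space.dim cscale {f\<in>kchains m I i j. kdiff m i f = (\<lambda>_. 0)}
     - vector_space.dim cscale (kdiff m (Suc i) ` kchains m I (Suc i) j)"

definition EGH :: "nat \<Rightarrow> 'k::field mpoly list \<Rightarrow> nat list \<Rightarrow> bool" where
  "EGH m (gs :: 'k mpoly list) es \<longleftrightarrow> (\<forall>I. homog_ideal m I \<and> ideal_gen m (set gs) \<subseteq> I \<longrightarrow>
      (\<exists>I' :: 'k mpoly set. homog_ideal m I' \<and> pow_ideal m es \<subseteq> I' \<and> hilb m I' = hilb m I))"

definition LPP :: "nat \<Rightarrow> 'k::field mpoly list \<Rightarrow> nat list \<Rightarrow> bool" where
  "LPP m (gs :: 'k mpoly list) es \<longleftrightarrow> EGH m gs es \<and>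
     (\<forall>(I :: 'k mpoly set) (L :: 'k mpoly set). homog_ideal m I \<and> ideal_gen m (set gs) \<subseteq> I \<and> lex_ideal m L
        \<and> hilb m (ideal_gen m (L \<union> pow_ideal m es)) = hilb m I \<longrightarrow>
        (\<forall>i j. betti m I i j \<le> betti m (ideal_gen m (L \<union> pow_ideal m es)) i j))"

(* image of a polynomial in k[x_0..x_{c-1}] = k[x_0..x_{n-1}]/(x_c..x_{n-1}) *)
definition trunc :: "nat \<Rightarrow> 'k::field mpoly \<Rightarrow> 'k mpoly" where
  "trunc c p = (\<Sum>t\<in>{t\<in>Poly_Mapping.keys p. t \<in> mons c}. Poly_Mapping.single t (Poly_Mapping.lookup p t))"

end

theory Submission
  imports Defs
begin

text \<open>
  By induction on the number of variables it suffices to pass from \<open>m\<close>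
  to \<open>m + 1\<close> variables. Let \<open>z = x\<^sub>m\<close> be the new variable. If \<open>I\<close> contains the given sequence, then its
  image \<open>I\<^sub>0\<close> modulo \<open>z\<close> contains the truncated one, and since \<open>z\<close> is a nonzerodivisor, the Koszul
  complex gives, with \<open>d = j - i\<close>,
  \<open>\<beta>\<^sub>i\<^sub>,\<^sub>j(I) \<le> \<beta>\<^sub>i\<^sub>,\<^sub>j(I\<^sub>0) + (m choose i) (dim I\<^sub>d - dim I\<^sub>d\<^sub>-\<^sub>1 - dim (I\<^sub>0)\<^sub>d)\<close>.
  Equality holds for a lex-plus-powers ideal \<open>L\<close>, because there \<open>z u \<in> L\<close> implies \<open>x\<^sub>s u \<in> L\<close> for
  all monomials \<open>u\<close> and \<open>s < m\<close>. The hypothesis bounds \<open>\<beta>(I\<^sub>0)\<close> by \<open>\<beta>(J\<^sub>0)\<close> for the lex-plus-powers ideal \<open>J\<^sub>0\<close>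
  of \<open>I\<^sub>0\<close>, and if \<open>L\<^sub>0 \<subseteq> J\<^sub>0\<close>, then \<open>\<beta>\<^sub>i\<^sub>,\<^sub>j(J\<^sub>0)\<close> exceeds \<open>\<beta>\<^sub>i\<^sub>,\<^sub>j(L\<^sub>0)\<close> by at most
  \<open>(m choose i) dim (J\<^sub>0/L\<^sub>0)\<^sub>d\<close>; summing up, \<open>\<beta>\<^sub>i\<^sub>,\<^sub>j(I) \<le> \<beta>\<^sub>i\<^sub>,\<^sub>j(L)\<close>.

  The inclusion \<open>L\<^sub>0 \<subseteq> J\<^sub>0\<close> needs \<open>I\<^sub>0\<close> to be large, which fails for instance for \<open>I = (z)\<close>. So \<open>I\<close> is first
  replaced by an ideal with the same Hilbert function, no smaller Betti number and the largest
  possible \<open>I\<^sub>0\<close>. Initial components with respect to \<open>z\<close> and distractions, which replace \<open>z\<^sup>k\<close> by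
  \<open>(z - x\<^bsub>a 0\<^esub>) \<dots> (z - x\<^bsub>a (k - 1)\<^esub>)\<close>, preserve these properties and enlarge \<open>I\<^sub>0\<close> over any field, even a finite
  one. In the extremal case multiplication by a monomial of degree \<open>k\<close> carries \<open>(I : z\<^sup>k)\<^sub>0\<close> into \<open>I\<^sub>0\<close>, and
  the inclusion becomes a comparison of lex segments. The same sections \<open>(I : z\<^sup>k)\<^sub>0\<close>, replaced by their
  lex-plus-powers ideals, give the Eisenbud-Green-Harris property. That the latter exist is the
  Clements-Lindstroem theorem, proved by compression.
\<close>

text \<open>The usual way to make \<open>I\<^sub>0\<close> large is a general change of coordinates.
  That would also change the truncated sequence, the only sequence about which anything is assumed.
  A distraction fixes all polynomials in the first \<open>m\<close> variables, so applied to an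
  ideal graded in \<open>z\<close> it can only enlarge the section and keeps the truncated sequence
  inside it. A maximality argument then replaces genericity. What is maximised is a sum of
  dimensions over degrees up to \<open>j\<close>, a bounded natural number, so the extremal ideal
  may depend on the pair \<open>(i, j)\<close> under consideration.

  Since Betti numbers are read off the Koszul complex, no resolution and no long exact sequence is
  needed: each comparison bounds the dimension of the cycles and that of the boundaries separately,
  and the subtraction comes last. Likewise, the Eisenbud-Green-Harris hypothesis enters only through
  the growth of Hilbert functions. It is applied not only to \<open>I\<^sub>0\<close> but to all
  sections and to ideals interpolating between two sections.\<close>

abbreviation "lookup \<equiv> Poly_Mapping.lookup"
abbreviation "keys \<equiv> Poly_Mapping.keys"
abbreviation "single \<equiv> Poly_Mapping.single"

section \<open>Dimensions of filtered vector spaces\<close>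

text \<open>The graded pieces of the filtration of \<open>W\<close> by the vanishing of its lower
  components, so that dimensions can be compared piece by piece. \<open>P\<close> will be the
  splitting by powers of the last variable, first of polynomials, then of Koszul chains.\<close>

definition initial :: "(nat \<Rightarrow> 'b \<Rightarrow> 'b) \<Rightarrow> nat \<Rightarrow> 'b set \<Rightarrow> ('b::zero) set" where
  "initial P k W = P k ` {w\<in>W. \<forall>j<k. P j w = 0}"

text \<open>\<open>dim\<close> is a cardinality and hence 0 for a space with an infinite basis, so
  dimension counts inside the infinite-dimensional space of polynomials have to carry this
  condition.\<close>

definition (in vector_space) fin_dim :: "'b set \<Rightarrow> bool" where
  "fin_dim V \<longleftrightarrow> (\<exists>B. finite B \<and> V \<subseteq> span B)"

context vector_space begin

lemma fin_dim_subset: "fin_dim W \<Longrightarrow> V \<subseteq> W \<Longrightarrow> fin_dim V"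
  unfolding fin_dim_def by blast

lemma fin_dim_basis:
  assumes "fin_dim V"
  obtains B where "B \<subseteq> V" "independent B" "V \<subseteq> span B" "finite B" "card B = dim V"
proof -
  obtain B where B: "B \<subseteq> V" "independent B" "V \<subseteq> span B" "card B = dim V"
    using basis_exists by blast
  obtain C where C: "finite C" "V \<subseteq> span C" using assms by (auto simp: fin_dim_def)
  have "finite B" using independent_span_bound[OF C(1) B(2)] B(1) C(2) by auto
  with B show thesis using that by blast
qed

lemma dim_le_of_subset:
  assumes "V \<subseteq> W" "fin_dim W"
  shows "dim V \<le> dim W"
proof -
  obtain B where "W \<subseteq> span B" "finite B" "card B = dim W"
    using fin_dim_basis[OF assms(2)] by metis
  then show ?thesis using dim_le_card[of V B] assms(1) by auto
qed

lemma subspace_eq_of_dim_eq: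
  assumes "V \<subseteq> W" "fin_dim W" "subspace V" "subspace W" "dim W \<le> dim V"
  shows "V = W"
proof (rule ccontr)
  assume "V \<noteq> W"
  then obtain w where w: "w \<in> W" "w \<notin> V" using assms(1) by blast
  obtain B where B: "B \<subseteq> V" "independent B" "V \<subseteq> span B" "finite B" "card B = dim V"
    using fin_dim_basis fin_dim_subset[OF assms(2,1)] by metis
  have sp: "span B = V" using B(1,3) assms(3) span_minimal by blast
  have ind: "independent (insert w B)"
    using w(2) sp B(2) by (simp add: independent_insertI)
  have "insert w B \<subseteq> W" using w B(1) assms(1) by blast
  moreover obtain C where C: "W \<subseteq> span C" "finite C" "card C = dim W"
    using fin_dim_basis[OF assms(2)] by metis
  ultimately have "card (insert w B) \<le> card C"
    using independent_span_bound[OF C(2) ind] by auto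
  moreover have "w \<notin> B" using w(2) B(1) by blast
  ultimately show False using assms(5) B(4,5) C(3) by simp
qed

end

context vector_space_pair begin

lemma fin_dim_image:
  assumes "Vector_Spaces.linear s1 s2 f" "vs1.fin_dim V"
  shows "vs2.fin_dim (f ` V)"
proof -
  obtain B where B: "finite B" "V \<subseteq> vs1.span B" using assms(2) by (auto simp: vs1.fin_dim_def)
  have "f ` V \<subseteq> vs2.span (f ` B)"
    using B(2) linear_span_image[OF assms(1)] by blast
  then show ?thesis using B(1) vs2.fin_dim_def by blast
qed

text \<open>A basis \<open>B0\<close> of the kernel is extended to a basis \<open>B\<close> of
  \<open>V\<close>. On the span of \<open>B - B0\<close> the map is injective, because a vector in
  both spans would have coordinates supported on two disjoint parts of \<open>B\<close>. So
  \<open>B - B0\<close> maps to a basis of the image.\<close>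

lemma rank_nullity:
  assumes lin: "Vector_Spaces.linear s1 s2 f" and V: "vs1.subspace V" "vs1.fin_dim V"
  shows "vs1.dim V = vs1.dim {v\<in>V. f v = 0} + vs2.dim (f ` V)"
proof -
  let ?N = "{v\<in>V. f v = 0}"
  have fN: "vs1.fin_dim ?N" by (rule vs1.fin_dim_subset[OF V(2)]) auto
  obtain B0 where B0: "B0 \<subseteq> ?N" "vs1.independent B0" "?N \<subseteq> vs1.span B0" "finite B0" "card B0 = vs1.dim ?N"
    by (rule vs1.fin_dim_basis[OF fN])
  obtain B where B: "B0 \<subseteq> B" "B \<subseteq> V" "vs1.independent B" "V \<subseteq> vs1.span B"
    using vs1.maximal_independent_subset_extend[of B0 V] B0(1,2) by blast
  obtain C where C: "finite C" "V \<subseteq> vs1.span C" using V(2) by (auto simp: vs1.fin_dim_def)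
  have finB: "finite B" using vs1.independent_span_bound[OF C(1) B(3)] B(2) C(2) by auto
  have cardB: "card B = vs1.dim V" using vs1.basis_card_eq_dim[OF B(2,4,3)] .
  have subB: "vs1.span (B - B0) \<subseteq> V" using B(2) V(1) vs1.span_minimal by blast
  have disj: "x = 0" if x: "x \<in> vs1.span B0" "x \<in> vs1.span (B - B0)" for x
  proof -
    have e1: "vs1.representation B x = vs1.representation B0 x"
      using vs1.representation_extend[OF B(3) x(1) B(1)] .
    have e2: "vs1.representation B x = vs1.representation (B - B0) x"
      using vs1.representation_extend[OF B(3) x(2)] by blast
    have zero: "vs1.representation B x b = 0" for b
    proof (rule ccontr)
      assume ne: "vs1.representation B x b \<noteq> 0"
      have "b \<in> B0" by (rule vs1.representation_ne_zero[of _ x]) (use ne e1 in simp)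
      moreover have "b \<in> B - B0" by (rule vs1.representation_ne_zero[of _ x]) (use ne e2 in simp)
      ultimately show False by simp
    qed
    have "x \<in> vs1.span B" using x(1) B(1) vs1.span_mono by blast
    then have "(\<Sum>b | vs1.representation B x b \<noteq> 0. s1 (vs1.representation B x b) b) = x"
      using vs1.sum_nonzero_representation_eq[OF B(3)] by blast
    moreover have "{b. vs1.representation B x b \<noteq> 0} = {}" using zero by blast
    ultimately show "x = 0" by (metis sum.empty)
  qed
  have inj: "inj_on f (vs1.span (B - B0))"
  proof (rule inj_onI)
    fix x y assume x: "x \<in> vs1.span (B - B0)" and y: "y \<in> vs1.span (B - B0)" and e: "f x = f y"
    have d: "x - y \<in> vs1.span (B - B0)" using x y vs1.span_diff by blast
    have "f (x - y) = 0" unfolding linear_diff[OF lin] using e by (rule right_minus_eq[THEN iffD2])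
    then have "x - y \<in> ?N" using d subB by blast
    then have "x - y = 0" using B0(3) d disj by blast
    then show "x = y" by simp
  qed
  have ind: "vs2.independent (f ` (B - B0))"
    using linear_independent_injective_image[OF lin _ inj] vs1.independent_mono[OF B(3)] by blast
  have "f ` V \<subseteq> vs2.span (f ` (B - B0))"
  proof
    fix y assume "y \<in> f ` V"
    then obtain v where v: "v \<in> V" "y = f v" by blast
    have "y \<in> vs2.span (f ` B)" using v B(4) linear_span_image[OF lin] by blast
    moreover have "f ` B \<subseteq> insert 0 (f ` (B - B0))" using B0(1) by auto
    ultimately have "y \<in> vs2.span (insert 0 (f ` (B - B0)))" using vs2.span_mono by blast
    then show "y \<in> vs2.span (f ` (B - B0))" by simp
  qed
  moreover have "f ` (B - B0) \<subseteq> f ` V" using B(2) by blast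
  ultimately have "card (f ` (B - B0)) = vs2.dim (f ` V)"
    using vs2.basis_card_eq_dim ind by blast
  moreover have "card (f ` (B - B0)) = card (B - B0)"
    using card_image inj_on_subset[OF inj vs1.span_superset] by blast
  moreover have "card (B - B0) + card B0 = card B"
    using finB B(1) B0(4) by (simp add: card_Diff_subset card_mono)
  ultimately show ?thesis using cardB B0(5) by simp
qed

lemma dim_image_inj:
  assumes lin: "Vector_Spaces.linear s1 s2 f" and V: "vs1.subspace V" "vs1.fin_dim V"
    and inj: "\<And>v. v \<in> V \<Longrightarrow> f v = 0 \<Longrightarrow> v = 0"
  shows "vs2.dim (f ` V) = vs1.dim V"
proof -
  have e: "{v \<in> V. f v = 0} = {0}" using inj V(1) vs1.subspace_0 linear_0[OF lin] by auto
  have "vs1.dim {0} = 0" using vs1.dim_le_card[of "{0}" "{}"] by simp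
  then show ?thesis using rank_nullity[OF lin V] e by simp
qed

lemma dim_image_le:
  assumes lin: "Vector_Spaces.linear s1 s2 f" and V: "vs1.subspace V" "vs1.fin_dim V"
  shows "vs2.dim (f ` V) \<le> vs1.dim V"
  using rank_nullity[OF assms] by simp

end

context vector_space begin

lemma subspace_vanish:
  assumes "\<And>j. Vector_Spaces.linear scale scale (P j)" "subspace W"
  shows "subspace {w\<in>W. \<forall>j<k. P j w = 0}"
proof -
  note poly_pair = vector_space_pair.intro[OF vector_space_axioms vector_space_axioms]
  have add: "P j (x + y) = P j x + P j y" for j x y
    by (rule vector_space_pair.linear_add[OF poly_pair assms(1)])
  have sc: "P j (scale c x) = scale c (P j x)" for j x c
    by (rule vector_space_pair.linear_scale[OF poly_pair assms(1)])
  have z: "P j 0 = 0" for j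
    by (rule vector_space_pair.linear_0[OF poly_pair assms(1)])
  show ?thesis
  proof (rule subspaceI)
    show "0 \<in> {w\<in>W. \<forall>j<k. P j w = 0}" using subspace_0[OF assms(2)] z by simp
  next
    fix x y assume "x \<in> {w\<in>W. \<forall>j<k. P j w = 0}" "y \<in> {w\<in>W. \<forall>j<k. P j w = 0}"
    then show "x + y \<in> {w\<in>W. \<forall>j<k. P j w = 0}" using subspace_add[OF assms(2)] add by simp
  next
    fix c x assume "x \<in> {w\<in>W. \<forall>j<k. P j w = 0}"
    then show "scale c x \<in> {w\<in>W. \<forall>j<k. P j w = 0}" using subspace_scale[OF assms(2)] sc by simp
  qed
qed

text \<open>Rank-nullity for \<open>P k\<close> on the vectors whose first \<open>k\<close>
  components vanish splits off one graded piece. The sum telescopes, and after \<open>N\<close>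
  pieces only the zero vector is left.\<close>

lemma dim_eq_sum_initial:
  assumes lin: "\<And>j. Vector_Spaces.linear scale scale (P j)" and W: "subspace W" "fin_dim W"
    and faithful: "\<And>w. w \<in> W \<Longrightarrow> (\<And>j. j < N \<Longrightarrow> P j w = 0) \<Longrightarrow> w = 0"
  shows "dim W = (\<Sum>k<N. dim (initial P k W))"
proof -
  note poly_pair = vector_space_pair.intro[OF vector_space_axioms vector_space_axioms]
  have step: "dim {w\<in>W. \<forall>j<k. P j w = 0}
      = dim {w\<in>W. \<forall>j<Suc k. P j w = 0} + dim (initial P k W)" for k
  proof -
    let ?V = "{w\<in>W. \<forall>j<k. P j w = 0}"
    have e: "{v \<in> ?V. P k v = 0} = {w\<in>W. \<forall>j<Suc k. P j w = 0}"
      by (auto simp: less_Suc_eq)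
    have "subspace ?V" by (rule subspace_vanish[OF lin W(1)])
    moreover have "fin_dim ?V" by (rule fin_dim_subset[OF W(2)]) auto
    ultimately show ?thesis
      using vector_space_pair.rank_nullity[OF poly_pair lin[of k]] unfolding initial_def e[symmetric] by blast
  qed
  have "dim W = dim {w\<in>W. \<forall>j<n. P j w = 0} + (\<Sum>k<n. dim (initial P k W))" for n
  proof (induction n)
    case (Suc n)
    then show ?case using step[of n] by simp
  qed simp
  from this[of N] have "dim W = dim {w\<in>W. \<forall>j<N. P j w = 0} + (\<Sum>k<N. dim (initial P k W))" .
  moreover have "{w\<in>W. \<forall>j<N. P j w = 0} \<subseteq> {0}" using faithful by blast
  then have "dim {w\<in>W. \<forall>j<N. P j w = 0} = 0"
    using dim_le_card[of "{w\<in>W. \<forall>j<N. P j w = 0}" "{}"] by simp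
  ultimately show ?thesis by simp
qed

lemma fin_dim_initial:
  assumes lin: "\<And>j. Vector_Spaces.linear scale scale (P j)" and W: "fin_dim W"
  shows "fin_dim (initial P k W)"
proof -
  note poly_pair = vector_space_pair.intro[OF vector_space_axioms vector_space_axioms]
  show ?thesis unfolding initial_def
    by (rule vector_space_pair.fin_dim_image[OF poly_pair lin]) (rule fin_dim_subset[OF W], auto)
qed

lemma dim_le_of_initial_le:
  assumes lin: "\<And>j. Vector_Spaces.linear scale scale (P j)"
    and W: "subspace W" "fin_dim W" and W': "subspace W'" "fin_dim W'"
    and faithful: "\<And>w. w \<in> W \<Longrightarrow> (\<And>j. j < N \<Longrightarrow> P j w = 0) \<Longrightarrow> w = 0"
    and faithful': "\<And>w. w \<in> W' \<Longrightarrow> (\<And>j. j < N \<Longrightarrow> P j w = 0) \<Longrightarrow> w = 0"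
    and le: "\<And>k. initial P k W \<subseteq> initial P k W'"
  shows "dim W \<le> dim W'"
proof -
  have "(\<Sum>k<N. dim (initial P k W)) \<le> (\<Sum>k<N. dim (initial P k W'))"
    by (intro sum_mono dim_le_of_subset le fin_dim_initial lin W'(2))
  then show ?thesis
    using dim_eq_sum_initial[of P W N, OF lin W faithful]
      dim_eq_sum_initial[of P W' N, OF lin W' faithful'] by simp
qed

text \<open>The rank on \<open>Y\<close> is at most the rank on \<open>X\<close>, so the nullity
  drops by no more than the dimension does. Applied to chains with coefficients in nested ideals,
  this bounds the number of cycles lost.\<close>

lemma dim_kernel_le:
  assumes lin: "Vector_Spaces.linear scale scale f" and X: "subspace X" "fin_dim X" and Y: "subspace Y" "Y \<subseteq> X"
  shows "dim {v\<in>X. f v = 0} + dim Y \<le> dim {v\<in>Y. f v = 0} + dim X"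
proof -
  note poly_pair = vector_space_pair.intro[OF vector_space_axioms vector_space_axioms]
  have fY: "fin_dim Y" using X(2) Y(2) fin_dim_subset by blast
  have "dim (f ` Y) \<le> dim (f ` X)"
    by (rule dim_le_of_subset) (use Y(2) vector_space_pair.fin_dim_image[OF poly_pair lin X(2)] in auto)
  then show ?thesis using vector_space_pair.rank_nullity[OF poly_pair lin X] vector_space_pair.rank_nullity[OF poly_pair lin Y(1) fY] by simp
qed

end

section \<open>Lex segments of monomials and the Clements-Lindstroem theorem\<close>

abbreviation xv :: "nat \<Rightarrow> (nat \<Rightarrow>\<^sub>0 nat)" where "xv i \<equiv> single i 1"

text \<open>The order of the type decides at the first index where the exponents differ, so it is
  the lexicographic order with \<open>x_0\<close> largest. Segments and leading monomials can
  therefore use the built-in order and \<open>Max\<close>.\<close>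

lemma less_monomial_iff:
  "(t::nat \<Rightarrow>\<^sub>0 nat) < u \<longleftrightarrow>
    (\<exists>v. lookup t v < lookup u v \<and>
      (\<forall>w<v. lookup t w = lookup u w))"
  by (auto simp: less_poly_mapping.rep_eq less_fun_def)

lemma lex_gt_iff: "lex_gt t u \<longleftrightarrow> u < t"
  unfolding lex_gt_def less_monomial_iff by (metis (no_types, lifting))

lemma tdeg_eq_sum: "finite V \<Longrightarrow> keys t \<subseteq> V \<Longrightarrow> tdeg t = sum (lookup t) V"
  unfolding tdeg_def by (rule sum.mono_neutral_left) (auto simp: in_keys_iff)

lemma tdeg_add [simp]: "tdeg (s + t) = tdeg s + tdeg t"
proof -
  let ?V = "keys s \<union> keys t"
  have "tdeg (s + t) = sum (lookup (s + t)) ?V"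
    by (rule tdeg_eq_sum) (use Poly_Mapping.keys_add[of s t] in auto)
  then show ?thesis
    using tdeg_eq_sum[of ?V s] tdeg_eq_sum[of ?V t] by (simp add: lookup_add sum.distrib)
qed

lemma tdeg_single [simp]: "tdeg (single i a) = a"
  by (simp add: tdeg_def)

lemma tdeg_zero [simp]: "tdeg 0 = 0"
  by (simp add: tdeg_def)

lemma tdeg_eq_0_iff [simp]: "tdeg t = 0 \<longleftrightarrow> t = 0"
  by (auto simp: tdeg_def in_keys_iff intro!: poly_mapping_eqI)

lemma lookup_le_tdeg: "lookup t i \<le> tdeg t"
proof (cases "i \<in> keys t")
  case True then show ?thesis unfolding tdeg_def by (simp add: member_le_sum)
qed (simp add: in_keys_iff)

lemma monomial_eq_add:
  assumes "\<And>i. lookup s i \<le> lookup (t::nat \<Rightarrow>\<^sub>0 nat) i"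
  shows "t = s + (t - s)"
  by (rule poly_mapping_eqI) (use assms in \<open>simp add: lookup_add lookup_minus\<close>)

lemma monomial_eq_of_le:
  assumes "\<And>i. lookup s i \<le> lookup t i" "tdeg t \<le> tdeg s"
  shows "s = t"
proof -
  have e: "t = s + (t - s)" using monomial_eq_add assms(1) .
  then have "tdeg t = tdeg s + tdeg (t - s)" using tdeg_add by metis
  then have "t - s = 0" using assms(2) tdeg_eq_0_iff by simp
  then show ?thesis using e by simp
qed

lemma finite_monomials_le:
  assumes "finite V" shows "finite {t. keys t \<subseteq> V \<and> tdeg t \<le> d}"
proof -
  let ?F = "{f::nat \<Rightarrow> nat. \<forall>x. (x \<in> V \<longrightarrow> f x \<in> {..d}) \<and> (x \<notin> V \<longrightarrow> f x = 0)}"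
  have "finite ?F" by (rule finite_set_of_finite_funs) (use assms in auto)
  moreover have "lookup ` {t. keys t \<subseteq> V \<and> tdeg t \<le> d} \<subseteq> ?F"
  proof (rule image_subsetI)
    fix t assume "t \<in> {t. keys t \<subseteq> V \<and> tdeg t \<le> d}"
    then have "keys t \<subseteq> V" "\<And>x. lookup t x \<le> d"
      using lookup_le_tdeg le_trans by blast+
    then show "lookup t \<in> ?F" by (auto simp: in_keys_iff subset_iff)
  qed
  ultimately have "finite (lookup ` {t. keys t \<subseteq> V \<and> tdeg t \<le> d})"
    by (rule rev_finite_subset)
  then show ?thesis by (rule finite_imageD) (simp add: inj_on_def lookup_inject)
qed

section \<open>Monomials below given caps, segments and shadows\<close>

definition capped :: "nat set \<Rightarrow> (nat \<Rightarrow> nat) \<Rightarrow> (nat \<Rightarrow>\<^sub>0 nat) set" where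
  "capped V e = {t. keys t \<subseteq> V \<and> (\<forall>i\<in>V. lookup t i < e i)}"

definition cdeg :: "nat set \<Rightarrow> (nat \<Rightarrow> nat) \<Rightarrow> nat \<Rightarrow> (nat \<Rightarrow>\<^sub>0 nat) set" where
  "cdeg V e d = {t\<in>capped V e. tdeg t = d}"

definition segment :: "'a::linorder set \<Rightarrow> 'a set \<Rightarrow> bool" where
  "segment C T \<longleftrightarrow> T \<subseteq> C \<and> (\<forall>t\<in>T. \<forall>u\<in>C. t < u \<longrightarrow> u \<in> T)"

text \<open>The monomials in \<open>capped V e\<close> form a basis of the quotient by the powers
  \<open>x_i ^ e i\<close>. The shadow collects the nonzero products with a variable in that
  quotient: the monomials of the next degree that an ideal containing \<open>S\<close> is forced to
  contain.\<close>

definition shadow :: "nat set \<Rightarrow> (nat \<Rightarrow> nat) \<Rightarrow> (nat \<Rightarrow>\<^sub>0 nat) set \<Rightarrow> (nat \<Rightarrow>\<^sub>0 nat) set" where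
  "shadow V e S = {t\<in>capped V e. \<exists>s\<in>S. \<exists>i\<in>V. t = s + xv i}"

lemma finite_cdeg: "finite V \<Longrightarrow> finite (cdeg V e d)"
  by (rule finite_subset[OF _ finite_monomials_le[of V d]]) (auto simp: cdeg_def capped_def)

lemma shadow_mono: "S \<subseteq> S' \<Longrightarrow> shadow V e S \<subseteq> shadow V e S'"
  unfolding shadow_def by blast

lemma shadow_cdeg: "S \<subseteq> cdeg V e d \<Longrightarrow> shadow V e S \<subseteq> cdeg V e (Suc d)"
  unfolding shadow_def cdeg_def by auto

lemma finite_shadow: "finite V \<Longrightarrow> S \<subseteq> cdeg V e d \<Longrightarrow> finite (shadow V e S)"
  using shadow_cdeg finite_cdeg finite_subset by metis

lemma segment_cases:
  assumes "segment C T" "segment C T'" shows "T \<subseteq> T' \<or> T' \<subseteq> T"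
proof (rule ccontr)
  assume "\<not> ?thesis"
  then obtain t t' where t: "t \<in> T" "t \<notin> T'" "t' \<in> T'" "t' \<notin> T" by blast
  then have "t \<in> C" "t' \<in> C" "t \<noteq> t'" using assms by (auto simp: segment_def)
  then consider "t < t'" | "t' < t" by fastforce
  then show False using t \<open>t \<in> C\<close> \<open>t' \<in> C\<close> assms unfolding segment_def by cases blast+
qed

lemma segment_subset:
  assumes "segment C T" "segment C T'" "finite C" "card T \<le> card T'" shows "T \<subseteq> T'"
proof -
  have "finite T" "finite T'" using assms(1-3) finite_subset unfolding segment_def by blast+
  then show ?thesis using segment_cases[OF assms(1,2)] assms(4) card_seteq by blast
qed

lemma segment_exists:
  assumes "finite C" "N \<le> card C" shows "\<exists>T. segment C T \<and> card T = N"
  using assms(2)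
proof (induction N)
  case 0 then show ?case by (intro exI[of _ "{}"]) (simp add: segment_def)
next
  case (Suc N)
  then obtain T where T: "segment C T" "card T = N" by auto
  have fT: "finite T" and TC: "T \<subseteq> C" using T(1) assms(1) finite_subset unfolding segment_def by blast+
  have ne: "C - T \<noteq> {}" using Suc.prems T(2) fT card_mono[OF fT, of C] by auto
  let ?m = "Max (C - T)"
  have m: "?m \<in> C - T" using Max_in[of "C - T"] ne assms(1) by blast
  have "segment C (insert ?m T)"
    unfolding segment_def
  proof (intro conjI ballI impI)
    show "insert ?m T \<subseteq> C" using m TC by blast
    fix t u assume t: "t \<in> insert ?m T" and u: "u \<in> C" "t < u"
    show "u \<in> insert ?m T"
    proof (cases "t = ?m")
      case True
      have "u \<notin> C - T" using Max_ge[of "C - T" u] assms(1) u(2) True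
        by (meson finite_Diff leD)
      then show ?thesis using u(1) by blast
    next
      case False then show ?thesis using t u T(1) unfolding segment_def by blast
    qed
  qed
  moreover have "card (insert ?m T) = Suc N" using m fT T(2) by simp
  ultimately show ?case by blast
qed

text \<open>Every element of \<open>T - X\<close> lies above every element of \<open>X - T\<close>,
  and both differences have the same size; comparing all weights with the largest weight
  \<open>M\<close> on \<open>T - X\<close> gives the strict inequality. The sum serves as the
  measure that compression decreases.\<close>

lemma segment_sum_less:
  fixes f :: "'a::linorder \<Rightarrow> nat"
  assumes "finite C" "segment C T" "X \<subseteq> C" "card X = card T" "X \<noteq> T"
    and anti: "\<And>t u. t \<in> C \<Longrightarrow> u \<in> C \<Longrightarrow> t < u \<Longrightarrow> f u < f t"
  shows "sum f T < sum f X"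
proof -
  let ?A = "T - X" and ?B = "X - T"
  have TC: "T \<subseteq> C" using assms(2) by (simp add: segment_def)
  have fin: "finite T" "finite X" using TC assms(1,3) finite_subset by blast+
  have "card ?A = card T - card (T \<inter> X)" "card ?B = card X - card (T \<inter> X)"
    using fin by (simp_all add: card_Diff_subset_Int Int_commute)
  then have cc: "card ?A = card ?B" using assms(4) by simp
  have Ane: "?A \<noteq> {}"
  proof
    assume "?A = {}"
    then have "T \<subseteq> X" by blast
    then show False using card_subset_eq[of X T] fin assms(4,5) by simp
  qed
  have lt: "f a < f b" if "a \<in> ?A" "b \<in> ?B" for a b
  proof -
    have "\<not> a < b" using that assms(2,3) unfolding segment_def by blast
    moreover have "a \<noteq> b" using that by blast
    ultimately have "b < a" by simp
    then show ?thesis using anti that TC assms(3) by blast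
  qed
  define M where "M = Max (f ` ?A)"
  have "M \<in> f ` ?A" unfolding M_def by (rule Max_in) (use Ane fin in auto)
  then have MB: "M < f b" if "b \<in> ?B" for b using lt that by blast
  have "sum f ?A \<le> card ?A * M"
    using sum_bounded_above[of ?A f M] fin by (simp add: M_def)
  also have "\<dots> < card ?A * Suc M"
  proof -
    have "card ?A > 0" using Ane fin by (subst card_gt_0_iff) simp
    then show ?thesis by simp
  qed
  also have "card ?A * Suc M = card ?B * Suc M" using cc by simp
  also have "\<dots> \<le> sum f ?B" using sum_bounded_below[of ?B "Suc M" f] MB by (simp add: Suc_le_eq)
  finally have "sum f ?A < sum f ?B" .
  moreover have "sum f T = sum f (T \<inter> X) + sum f ?A" "sum f X = sum f (T \<inter> X) + sum f ?B"
    using sum.Int_Diff[OF fin(1), of f X] sum.Int_Diff[OF fin(2), of f T] by (simp_all add: Int_commute)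
  ultimately show ?thesis by simp
qed

lemma capped_divisor:
  assumes "s + u \<in> capped V e" shows "s \<in> capped V e"
proof -
  have "keys s \<subseteq> keys (s + u)"
    by (auto simp: in_keys_iff lookup_add)
  moreover have "lookup s i \<le> lookup (s + u) i" for i
    by (simp add: lookup_add)
  ultimately show ?thesis using assms unfolding capped_def
    using le_less_trans by blast
qed

lemma split_off_variable:
  assumes "j \<in> keys t" shows "t = (t - xv j) + xv j"
  by (rule poly_mapping_eqI)
    (use assms in \<open>auto simp: lookup_add lookup_minus lookup_single in_keys_iff when_def\<close>)

lemma xv_antimono: "i \<le> j \<Longrightarrow> xv j \<le> xv i"
proof (cases "i = j")
  case False
  assume "i \<le> j"
  then have "xv j < xv i" unfolding less_monomial_iff using False
    by (intro exI[of _ i]) (auto simp: lookup_single)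
  then show ?thesis by simp
qed simp

text \<open>The first index \<open>v\<close> at which the products differ is at most
  \<open>j\<close>, since beyond \<open>j\<close> the right-hand side has no exponents. If
  \<open>i < v\<close>, equality at \<open>i\<close> already makes \<open>u\<close> smaller there.
  Otherwise the exponents before \<open>v\<close> agree, and a tie at \<open>v\<close> means
  \<open>v = j\<close>, in which case \<open>u'\<close> divides \<open>u\<close> and the degrees
  force equality.\<close>

lemma remove_last_le:
  fixes u u' :: "nat \<Rightarrow>\<^sub>0 nat"
  assumes le: "u + xv i \<le> u' + xv j" and deg: "tdeg u = tdeg u'"
    and last: "\<And>k. k \<in> keys (u' + xv j) \<Longrightarrow> k \<le> j"
  shows "u \<le> u'"
proof (cases "u + xv i = u' + xv j")
  case True
  have "i \<in> keys (u' + xv j)" unfolding True[symmetric] by (simp add: in_keys_iff lookup_add)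
  then have "i \<le> j" using last by blast
  then have "u' + xv j \<le> u' + xv i" using xv_antimono add_left_mono by blast
  then have "u + xv i \<le> u' + xv i" using True by simp
  then show ?thesis by simp
next
  case False
  then have "u + xv i < u' + xv j" using le by simp
  then obtain v where v: "lookup (u + xv i) v < lookup (u' + xv j) v"
    and eq: "\<And>w. w < v \<Longrightarrow> lookup (u + xv i) w = lookup (u' + xv j) w"
    unfolding less_monomial_iff by blast
  have vj: "v \<le> j" using v last by (auto simp: in_keys_iff)
  show ?thesis
  proof (cases "i < v")
    case True
    have "u < u'" unfolding less_monomial_iff
    proof (intro exI[of _ i] conjI allI impI)
      show "lookup u i < lookup u' i"
        using eq[OF True] True vj by (simp add: lookup_add lookup_single)
      fix w assume "w < i"
      then show "lookup u w = lookup u' w"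
        using eq[of w] True vj by (simp add: lookup_add lookup_single)
    qed
    then show ?thesis by simp
  next
    case iv: False
    have before: "lookup u w = lookup u' w" if "w < v" for w
      using eq[OF that] that iv vj by (simp add: lookup_add lookup_single)
    have lev: "lookup u v \<le> lookup u' v"
      using v by (auto simp: lookup_add lookup_single when_def split: if_splits)
    show ?thesis
    proof (cases "lookup u v < lookup u' v")
      case True
      then have "u < u'" unfolding less_monomial_iff using before by blast
      then show ?thesis by simp
    next
      case False
      then have ev: "lookup u v = lookup u' v" using lev by simp
      then have "v = j" using v vj by (auto simp: lookup_add lookup_single when_def split: if_splits)
      then have after: "lookup u' k = 0" if "k > v" for k
        using last[of k] that by (auto simp: in_keys_iff lookup_add lookup_single)
      have "lookup u' k \<le> lookup u k" for k
        using before[of k] ev after[of k] by (cases k v rule: linorder_cases) auto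
      then have "u' = u" by (rule monomial_eq_of_le) (simp add: deg)
      then show ?thesis by simp
    qed
  qed
qed

lemma split_off_last:
  assumes "t \<in> capped V e" "tdeg t = Suc d"
  obtains u j where "t = u + xv j" "u \<in> cdeg V e d" "j \<in> V" "\<forall>k\<in>keys t. k \<le> j"
proof -
  have ne: "keys t \<noteq> {}" using assms(2) by (auto simp: tdeg_def)
  let ?j = "Max (keys t)"
  have j: "?j \<in> keys t" using ne by simp
  have e: "t = (t - xv ?j) + xv ?j" using split_off_variable[OF j] .
  have "tdeg t = tdeg (t - xv ?j) + 1" using arg_cong[OF e, of tdeg] by simp
  then have "t - xv ?j \<in> cdeg V e d" using capped_divisor[of "t - xv ?j" "xv ?j"] e assms
    by (simp add: cdeg_def)
  moreover have "?j \<in> V" using j assms(1) by (auto simp: capped_def)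
  moreover have "\<forall>k\<in>keys t. k \<le> ?j" by simp
  ultimately show thesis using e that by blast
qed

text \<open>A monomial \<open>w'\<close> above \<open>w\<close> is divided by its own last variable;
  by \<open>remove_last_le\<close> the quotient is not below \<open>u\<close>, hence it lies in the
  segment \<open>T\<close>.\<close>

lemma segment_shadow:
  assumes "segment (cdeg V e d) T"
  shows "segment (cdeg V e (Suc d)) (shadow V e T)"
  unfolding segment_def
proof (intro conjI ballI impI)
  have TC: "T \<subseteq> cdeg V e d" using assms by (simp add: segment_def)
  show "shadow V e T \<subseteq> cdeg V e (Suc d)" using shadow_cdeg TC .
  fix w w' assume "w \<in> shadow V e T" and w': "w' \<in> cdeg V e (Suc d)" "w < w'"
  then obtain u i where u: "u \<in> T" "w = u + xv i" by (auto simp: shadow_def)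
  have "w' \<in> capped V e" "tdeg w' = Suc d" using w'(1) by (simp_all add: cdeg_def)
  then obtain u' j where u': "w' = u' + xv j" "u' \<in> cdeg V e d" "j \<in> V"
    "\<forall>k\<in>keys w'. k \<le> j"
    by (rule split_off_last)
  have "u \<le> u'" by (rule remove_last_le[of u i u' j])
      (use u u' w'(2) TC in \<open>auto simp: cdeg_def\<close>)
  then have "u' \<in> T" using assms u(1) u'(2) unfolding segment_def by (cases "u = u'") auto
  then show "w' \<in> shadow V e T" using u' w'(1) by (auto simp: shadow_def cdeg_def)
qed

text \<open>Let \<open>v\<close> be the first index where \<open>s\<close> and \<open>t\<close>
  differ. A variable behind \<open>v\<close> with room below its cap can be raised without affecting
  the comparison. If all of those are full, \<open>s\<close> has at least the exponents of
  \<open>t\<close> behind \<open>v\<close>, and raising \<open>v\<close> itself does not pass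
  \<open>t\<close>.\<close>

lemma fill_step:
  assumes "finite V" "s \<in> capped V e" "t \<in> capped V e" "s < t" "tdeg s < tdeg t"
  shows "\<exists>i\<in>V. s + xv i \<in> capped V e \<and> s + xv i \<le> t"
proof -
  obtain v where v: "lookup s v < lookup t v"
    and eq: "\<And>w. w < v \<Longrightarrow> lookup s w = lookup t w"
    using assms(4) unfolding less_monomial_iff by blast
  have vV: "v \<in> V" using v assms(3) by (auto simp: capped_def in_keys_iff subset_iff)
  have cap: "s + xv i \<in> capped V e" if "i \<in> V" "lookup s i + 1 < e i" for i
    using that assms(2) Poly_Mapping.keys_add[of s "xv i"]
    by (auto simp: capped_def lookup_add lookup_single when_def)
  show ?thesis
  proof (cases "\<exists>i\<in>V. i > v \<and> lookup s i + 1 < e i")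
    case True
    then obtain i where i: "i \<in> V" "i > v" "lookup s i + 1 < e i" by blast
    have "s + xv i < t" unfolding less_monomial_iff
      by (intro exI[of _ v]) (use v eq i in \<open>auto simp: lookup_add lookup_single\<close>)
    then show ?thesis using cap[OF i(1,3)] i(1) by (meson less_imp_le)
  next
    case False
    have full: "lookup t i \<le> lookup s i" if "i > v" for i
    proof (cases "i \<in> V")
      case True
      then have "\<not> lookup s i + 1 < e i" using False that by blast
      moreover have "lookup t i < e i" using True assms(3) by (simp add: capped_def)
      ultimately show ?thesis by simp
    next
      case False
      then have "i \<notin> keys t" using assms(3) by (auto simp: capped_def)
      then show ?thesis by (simp add: in_keys_iff)
    qed
    have "lookup t v < e v" using vV assms(3) by (simp add: capped_def)
    then have c: "s + xv v \<in> capped V e" using cap[OF vV] v by simp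
    have "s + xv v \<le> t"
    proof (cases "lookup s v + 1 < lookup t v")
      case True
      have "s + xv v < t" unfolding less_monomial_iff
        by (intro exI[of _ v]) (use True eq in \<open>auto simp: lookup_add lookup_single\<close>)
      then show ?thesis by simp
    next
      case F: False
      have "lookup t k \<le> lookup (s + xv v) k" for k
        using F v eq[of k] full[of k] by (cases k v rule: linorder_cases) (auto simp: lookup_add lookup_single)
      then have "t = s + xv v" by (rule monomial_eq_of_le) (use assms(5) in simp)
      then show ?thesis by simp
    qed
    then show ?thesis using c vV by blast
  qed
qed

lemma fill:
  assumes "finite V" "s \<in> capped V e" "t \<in> capped V e" "s \<le> t" "tdeg s \<le> tdeg t"
  shows "\<exists>w. s + w \<in> capped V e \<and> tdeg (s + w) = tdeg t \<and> s + w \<le> t"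
  using assms
proof (induction "tdeg t - tdeg s" arbitrary: s)
  case 0 then show ?case by (intro exI[of _ 0]) simp
next
  case (Suc k)
  then have d: "tdeg s < tdeg t" by simp
  then have "s < t" using Suc.prems(4) by (metis less_le less_irrefl)
  then obtain i where i: "i \<in> V" "s + xv i \<in> capped V e" "s + xv i \<le> t"
    using fill_step Suc.prems d by blast
  have "\<exists>w. s + xv i + w \<in> capped V e \<and> tdeg (s + xv i + w) = tdeg t \<and> s + xv i + w \<le> t"
    by (rule Suc.hyps(1)) (use i Suc.prems Suc.hyps(2) d in auto)
  then obtain w where "s + xv i + w \<in> capped V e \<and> tdeg (s + xv i + w) = tdeg t \<and> s + xv i + w \<le> t"
    by blast
  then show ?case by (intro exI[of _ "xv i + w"]) (simp add: add.assoc)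
qed

section \<open>Slices by the exponent of one variable\<close>

definition slice :: "nat \<Rightarrow> nat \<Rightarrow> (nat \<Rightarrow>\<^sub>0 nat) set \<Rightarrow> (nat \<Rightarrow>\<^sub>0 nat) set" where
  "slice y a S = {u. lookup u y = 0 \<and> u + single y a \<in> S}"

lemma capped_glue:
  assumes "y \<in> V" "lookup u y = 0"
  shows "u + single y a \<in> capped V e \<longleftrightarrow> u \<in> capped (V - {y}) e \<and> a < e y"
proof
  assume h: "u + single y a \<in> capped V e"
  then have "a < e y" using assms by (fastforce simp: capped_def lookup_add)
  moreover have "u \<in> capped V e" using h capped_divisor by blast
  ultimately show "u \<in> capped (V - {y}) e \<and> a < e y"
    using assms by (auto simp: capped_def in_keys_iff)
next
  assume h: "u \<in> capped (V - {y}) e \<and> a < e y"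
  then show "u + single y a \<in> capped V e"
    using assms Poly_Mapping.keys_add[of u "single y a"]
    by (auto simp: capped_def lookup_add lookup_single when_def split: if_splits)
qed

lemma capped_lookup_outside: "u \<in> capped V e \<Longrightarrow> y \<notin> V \<Longrightarrow> lookup u y = 0"
  by (auto simp: capped_def in_keys_iff)

lemma slice_cdeg:
  assumes "y \<in> V" "S \<subseteq> cdeg V e d" "u \<in> slice y a S"
  shows "u \<in> cdeg (V - {y}) e (d - a)" "a \<le> d" "a < e y"
proof -
  have u0: "lookup u y = 0" and m: "u + single y a \<in> cdeg V e d"
    using assms(2,3) by (auto simp: slice_def)
  then have "tdeg u + a = d" "u \<in> capped (V - {y}) e" "a < e y"
    using capped_glue[OF assms(1) u0] by (auto simp: cdeg_def)
  then show "u \<in> cdeg (V - {y}) e (d - a)" "a \<le> d" "a < e y" by (auto simp: cdeg_def)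
qed

lemma glue_cdeg:
  assumes "y \<in> V" "u \<in> cdeg (V - {y}) e b" "a < e y"
  shows "u + single y a \<in> cdeg V e (b + a)" "lookup u y = 0"
proof -
  show u0: "lookup u y = 0"
    using assms(2) by (intro capped_lookup_outside[of u "V - {y}" e]) (auto simp: cdeg_def)
  show "u + single y a \<in> cdeg V e (b + a)"
    using assms(2,3) capped_glue[OF assms(1) u0] by (auto simp: cdeg_def)
qed

lemma split_off_power:
  "(t::nat \<Rightarrow>\<^sub>0 nat) = (t - single y (lookup t y)) + single y (lookup t y)"
  "lookup (t - single y (lookup t y)) y = 0"
   by (rule poly_mapping_eqI) (auto simp: lookup_add lookup_minus lookup_single when_def)

lemma slice_obtain:
  assumes "t \<in> S"
  obtains u where "t = u + single y (lookup t y)" "u \<in> slice y (lookup t y) S"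
proof -
  have "t - single y (lookup t y) \<in> slice y (lookup t y) S"
    using assms split_off_power[of t y] by (simp add: slice_def)
  then show thesis using that split_off_power(1)[of t y] by blast
qed

lemma sum_slices:
  fixes f :: "(nat \<Rightarrow>\<^sub>0 nat) \<Rightarrow> nat"
  assumes "finite S" "\<And>t. t \<in> S \<Longrightarrow> lookup t y < N"
  shows "sum f S = (\<Sum>a<N. \<Sum>u\<in>slice y a S. f (u + single y a))"
proof -
  have "sum f {t\<in>S. lookup t y = a} = (\<Sum>u\<in>slice y a S. f (u + single y a))" for a
  proof -
    have e: "(\<lambda>u. u + single y a) ` slice y a S = {t\<in>S. lookup t y = a}"
    proof (intro equalityI subsetI)
      fix t assume "t \<in> {t\<in>S. lookup t y = a}"
      then have t: "t \<in> S" "lookup t y = a" by auto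
      obtain u where "t = u + single y (lookup t y)" "u \<in> slice y (lookup t y) S"
        by (rule slice_obtain[OF t(1)])
      then show "t \<in> (\<lambda>u. u + single y a) ` slice y a S" using t(2) by blast
    qed (auto simp: slice_def lookup_add)
    have "inj_on (\<lambda>u. u + single y a) (slice y a S)" by (rule inj_onI) simp
    then show ?thesis unfolding e[symmetric] by (simp add: sum.reindex)
  qed
  moreover have "sum f S = (\<Sum>a<N. sum f {t\<in>S. lookup t y = a})"
  proof -
    have "S = (\<Union>a<N. {t\<in>S. lookup t y = a})" using assms(2) by auto
    then have "sum f S = sum f (\<Union>a\<in>{..<N}. {t\<in>S. lookup t y = a})" by simp
    also have "\<dots> = (\<Sum>a<N. sum f {t\<in>S. lookup t y = a})"
      by (rule sum.UNION_disjoint) (use assms(1) in auto)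
    finally show ?thesis .
  qed
  ultimately show ?thesis by simp
qed

lemma card_slices:
  assumes "finite S" "\<And>t. t \<in> S \<Longrightarrow> lookup t y < N"
  shows "card S = (\<Sum>a<N. card (slice y a S))"
  using sum_slices[OF assms, of "\<lambda>_. 1"] by simp

text \<open>A factor other than \<open>y\<close> stays within the slice of exponent
  \<open>a\<close>; the factor \<open>y\<close> lifts the slice \<open>a - 1\<close> into it,
  provided the cap of \<open>y\<close> allows exponent \<open>a\<close>.\<close>

lemma slice_shadow:
  assumes y: "y \<in> V" and S: "S \<subseteq> cdeg V e d"
  shows "slice y a (shadow V e S)
    = shadow (V - {y}) e (slice y a S) \<union> (if 0 < a \<and> a < e y then slice y (a - 1) S else {})"
proof (intro equalityI subsetI)
  fix u assume u: "u \<in> slice y a (shadow V e S)"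
  then have u0: "lookup u y = 0" and cap: "u + single y a \<in> capped V e"
    by (auto simp: slice_def shadow_def)
  from u obtain s i where s: "s \<in> S" "i \<in> V" "u + single y a = s + xv i"
    by (auto simp: slice_def shadow_def)
  have ay: "a < e y" "u \<in> capped (V - {y}) e" using cap capped_glue[OF y u0] by auto
  show "u \<in> shadow (V - {y}) e (slice y a S) \<union> (if 0 < a \<and> a < e y then slice y (a - 1) S else {})"
  proof (cases "i = y")
    case True
    have "a = lookup s y + 1"
      using arg_cong[OF s(3), of "\<lambda>t. lookup t y"] True u0 by (simp add: lookup_add)
    then have a0: "a > 0" by simp
    then have "single y a = single y (a - 1) + xv y"
      by (simp add: single_add[symmetric])
    then have "u + single y (a - 1) + xv y = s + xv y"
      using s(3) True by (simp add: add.assoc)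
    then have "u + single y (a - 1) = s" by simp
    then show ?thesis using a0 ay(1) s(1) u0 by (simp add: slice_def)
  next
    case False
    have "lookup u i > 0"
      using arg_cong[OF s(3), of "\<lambda>t. lookup t i"] False by (simp add: lookup_add lookup_single)
    then have e: "u = (u - xv i) + xv i" using split_off_variable[of i u] by (simp add: in_keys_iff)
    have "u - xv i + single y a + xv i = s + xv i" using s(3) e by (metis add.assoc add.commute)
    then have "u - xv i + single y a = s" by simp
    then have "u - xv i \<in> slice y a S" using s(1) u0 by (simp add: slice_def lookup_minus)
    then show ?thesis using e ay(2) s(2) False by (auto simp: shadow_def)
  qed
next
  fix u assume u: "u \<in> shadow (V - {y}) e (slice y a S) \<union> (if 0 < a \<and> a < e y then slice y (a - 1) S else {})"
  show "u \<in> slice y a (shadow V e S)"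
  proof (cases "u \<in> shadow (V - {y}) e (slice y a S)")
    case True
    then obtain s i where s: "s \<in> slice y a S" "i \<in> V - {y}" "u = s + xv i" "u \<in> capped (V - {y}) e"
      by (auto simp: shadow_def)
    have "a < e y" using slice_cdeg[OF y S s(1)] by simp
    moreover have u0: "lookup u y = 0"
      using s(1,2,3) by (auto simp: slice_def lookup_add lookup_single)
    ultimately have "u + single y a \<in> capped V e" using capped_glue[OF y u0] s(4) by blast
    moreover have "u + single y a = (s + single y a) + xv i"
      using s(3) by (metis add.assoc add.commute)
    moreover have "s + single y a \<in> S" using s(1) by (simp add: slice_def)
    ultimately show ?thesis using u0 s(2) by (auto simp: slice_def shadow_def)
  next
    case False
    then have a: "0 < a" "a < e y" "u \<in> slice y (a - 1) S" using u by (auto split: if_splits)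
    have u0: "lookup u y = 0" and m: "u + single y (a - 1) \<in> S"
      using a(3) by (auto simp: slice_def)
    have "u \<in> capped (V - {y}) e" using slice_cdeg(1)[OF y S a(3)] by (simp add: cdeg_def)
    then have "u + single y a \<in> capped V e" using capped_glue[OF y u0] a(2) by blast
    moreover have "single y a = single y (a - 1) + xv y"
      using a(1) by (simp add: single_add[symmetric])
    then have "u + single y a = (u + single y (a - 1)) + xv y"
      by (simp add: add.assoc)
    ultimately show ?thesis using m u0 y by (auto simp: slice_def shadow_def)
  qed
qed

section \<open>Compression in one variable\<close>

definition minimal_shadows :: "nat set \<Rightarrow> (nat \<Rightarrow> nat) \<Rightarrow> bool" where
  "minimal_shadows V e \<longleftrightarrow> (\<forall>d S T. S \<subseteq> cdeg V e d \<longrightarrow> segment (cdeg V e d) T \<longrightarrow> card T = card S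
    \<longrightarrow> card (shadow V e T) \<le> card (shadow V e S))"

lemma compress_exists:
  assumes V: "finite V" and y: "y \<in> V" and S: "S \<subseteq> cdeg V e d"
  shows "\<exists>S'\<subseteq>cdeg V e d. \<forall>a. segment (cdeg (V - {y}) e (d - a)) (slice y a S')
    \<and> card (slice y a S') = card (slice y a S)"
proof -
  have sub: "slice y a S \<subseteq> cdeg (V - {y}) e (d - a)" for a using slice_cdeg(1)[OF y S] by blast
  have fin: "finite (cdeg (V - {y}) e b)" for b using finite_cdeg V by simp
  have "\<forall>a. \<exists>T. segment (cdeg (V - {y}) e (d - a)) T \<and> card T = card (slice y a S)"
    using segment_exists[OF fin card_mono[OF fin sub]] by blast
  then obtain F where F: "\<And>a. segment (cdeg (V - {y}) e (d - a)) (F a)" "\<And>a. card (F a) = card (slice y a S)"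
    by metis
  have Fsub: "F a \<subseteq> cdeg (V - {y}) e (d - a)" for a using F(1) by (simp add: segment_def)
  \<comment> \<open>For an exponent out of range the slice is empty, and by its cardinality so is
    \<open>F a\<close>. This matters for \<open>a > d\<close>, where the truncated difference
    \<open>d - a\<close> is 0 and the segment by itself need not be empty.\<close>
  have nonempty: "a \<le> d \<and> a < e y" if "u \<in> F a" for u a
  proof -
    have "finite (F a)" using Fsub fin finite_subset by metis
    then have "card (slice y a S) \<noteq> 0" using that F(2)[of a] by (metis card_0_eq empty_iff)
    then have "slice y a S \<noteq> {}" by auto
    then show ?thesis using slice_cdeg(2,3)[OF y S] by blast
  qed
  define S' where "S' = {u + single y a | u a. u \<in> F a}"
  have F0: "lookup u y = 0" if "u \<in> F a" for u a
    using that Fsub[of a] by (intro capped_lookup_outside[of u "V - {y}" e]) (auto simp: cdeg_def)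
  have "S' \<subseteq> cdeg V e d"
  proof
    fix t assume "t \<in> S'"
    then obtain u a where u: "t = u + single y a" "u \<in> F a" by (auto simp: S'_def)
    have "t \<in> cdeg V e (d - a + a)" using glue_cdeg(1)[OF y] u nonempty Fsub by blast
    then show "t \<in> cdeg V e d" using nonempty[OF u(2)] by simp
  qed
  moreover have "slice y a S' = F a" for a
  proof (intro equalityI subsetI)
    fix u assume "u \<in> slice y a S'"
    then have u: "lookup u y = 0" "u + single y a \<in> S'" by (auto simp: slice_def)
    then obtain v b where v: "u + single y a = v + single y b" "v \<in> F b"
      by (auto simp: S'_def)
    have "a = b" using arg_cong[OF v(1), of "\<lambda>t. lookup t y"] u(1) F0[OF v(2)]
      by (simp add: lookup_add)
    then show "u \<in> F a" using v by simp
  qed (auto simp: slice_def S'_def F0)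
  ultimately show ?thesis using F by metis
qed

lemma segment_Un_card:
  assumes "segment C A" "segment C B" shows "card (A \<union> B) = max (card A) (card B) \<or> infinite C"
proof (cases "finite C")
  case True
  have f: "finite A" "finite B" using assms True finite_subset unfolding segment_def by metis+
  from segment_cases[OF assms] show ?thesis
  proof
    assume "A \<subseteq> B"
    then show ?thesis using card_mono[OF f(2)] by (simp add: Un_absorb1 max_absorb2)
  next
    assume "B \<subseteq> A"
    then show ?thesis using card_mono[OF f(1)] by (simp add: Un_absorb2 max_absorb1)
  qed
qed simp

text \<open>A slice of the shadow is the union of the shadow of one slice and of the slice below.
  After compression both are segments of the same set, so one contains the other and the union is
  only as large as the larger. Each of them is at most as large as the corresponding slice of the
  original shadow, the first by the minimality hypothesis in fewer variables.\<close>

lemma card_shadow_compress: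
  assumes V: "finite V" and y: "y \<in> V" and IH: "minimal_shadows (V - {y}) e"
    and S: "S \<subseteq> cdeg V e d" and S': "S' \<subseteq> cdeg V e d"
    and seg: "\<And>a. segment (cdeg (V - {y}) e (d - a)) (slice y a S')"
    and card: "\<And>a. card (slice y a S') = card (slice y a S)"
  shows "card (shadow V e S') \<le> card (shadow V e S)"
proof -
  let ?V = "V - {y}"
  have fV: "finite ?V" using V by simp
  have bound: "lookup t y < e y" if "t \<in> shadow V e X" for t X
    using that y by (simp add: shadow_def capped_def)
  have fs: "finite (shadow V e S)" "finite (shadow V e S')" using finite_shadow[OF V] S S' by auto
  have sl: "slice y a S \<subseteq> cdeg ?V e (d - a)" for a using slice_cdeg(1)[OF y S] by blast
  have le: "card (slice y a (shadow V e S')) \<le> card (slice y a (shadow V e S))" for a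
  proof -
    have f: "finite (slice y a (shadow V e S))"
      by (rule finite_subset[OF _ finite_cdeg[OF fV]]) (use slice_cdeg(1)[OF y shadow_cdeg[OF S]] in blast)
    have 1: "card (shadow ?V e (slice y a S')) \<le> card (slice y a (shadow V e S))"
    proof -
      have "card (shadow ?V e (slice y a S')) \<le> card (shadow ?V e (slice y a S))"
        using IH sl seg card unfolding minimal_shadows_def by blast
      also have "\<dots> \<le> card (slice y a (shadow V e S))"
        by (rule card_mono[OF f]) (use slice_shadow[OF y S] in blast)
      finally show ?thesis .
    qed
    show ?thesis
    proof (cases "0 < a \<and> a < e y")
      case False
      have "slice y a (shadow V e S') = shadow ?V e (slice y a S')"
        unfolding slice_shadow[OF y S'] by (simp only: False if_False Un_empty_right)
      then show ?thesis using 1 by simp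
    next
      case True
      have "card (slice y (a - 1) S') \<le> card (slice y a (shadow V e S))"
        unfolding card by (rule card_mono[OF f]) (use slice_shadow[OF y S, of a] True in auto)
      moreover have eq: "slice y a (shadow V e S') = shadow ?V e (slice y a S') \<union> slice y (a - 1) S'"
        using slice_shadow[OF y S', of a] True by simp
      show ?thesis
      proof (cases "a \<le> d")
        case True
        \<comment> \<open>Both segments lie in the same degree; with truncated subtraction this
          needs \<open>0 < a\<close> and \<open>a \<le> d\<close>.\<close>
        then have "Suc (d - a) = d - (a - 1)" using \<open>0 < a \<and> a < e y\<close> by simp
        then have "segment (cdeg ?V e (d - (a - 1))) (shadow ?V e (slice y a S'))"
          using segment_shadow[OF seg[of a]] by simp
        then have "card (slice y a (shadow V e S')) = max (card (shadow ?V e (slice y a S'))) (card (slice y (a - 1) S'))"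
          using segment_Un_card[OF _ seg[of "a - 1"]] eq finite_cdeg[OF fV] by metis
        then show ?thesis using 1 calculation by simp
      next
        case False
        then have "slice y a S' = {}" using slice_cdeg(2)[OF y S'] by blast
        then have "shadow ?V e (slice y a S') = {}" by (simp add: shadow_def)
        then show ?thesis using eq calculation by simp
      qed
    qed
  qed
  have "card (shadow V e S') = (\<Sum>a<e y. card (slice y a (shadow V e S')))"
    by (rule card_slices[OF fs(2) bound])
  also have "\<dots> \<le> (\<Sum>a<e y. card (slice y a (shadow V e S)))" by (rule sum_mono) (rule le)
  also have "\<dots> = card (shadow V e S)" by (rule card_slices[OF fs(1) bound, symmetric])
  finally show ?thesis .
qed

section \<open>Stable sets and the comparison with segments\<close>

definition stable :: "nat set \<Rightarrow> (nat \<Rightarrow> nat) \<Rightarrow> (nat \<Rightarrow>\<^sub>0 nat) set \<Rightarrow> bool" where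
  "stable V e S \<longleftrightarrow> (\<forall>i\<in>V. \<forall>j\<in>V. \<forall>u. i < j \<longrightarrow> u + xv j \<in> S \<longrightarrow> u + xv i \<in> capped V e \<longrightarrow> u + xv i \<in> S)"

lemma xv_strict_antimono: "i < j \<Longrightarrow> xv j < xv i"
  unfolding less_monomial_iff by (intro exI[of _ i]) (auto simp: lookup_single)

lemma stableD:
  "stable V e S \<Longrightarrow> i \<in> V \<Longrightarrow> j \<in> V \<Longrightarrow> i < j \<Longrightarrow> u + xv j \<in> S \<Longrightarrow> u + xv i \<in> capped V e \<Longrightarrow> u + xv i \<in> S"
  unfolding stable_def by blast

lemma segmentD: "segment C T \<Longrightarrow> t \<in> T \<Longrightarrow> u \<in> C \<Longrightarrow> t \<le> u \<Longrightarrow> u \<in> T"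
  unfolding segment_def using le_imp_less_or_eq by blast

lemma segment_stable:
  assumes "segment (cdeg V e d) T" shows "stable V e T"
  unfolding stable_def
proof (intro ballI allI impI)
  fix i j u assume h: "i < j" "u + xv j \<in> T" "u + xv i \<in> capped V e"
  have "tdeg (u + xv j) = d" using h(2) assms by (auto simp: segment_def cdeg_def)
  then have "u + xv i \<in> cdeg V e d" using h(3) by (simp add: cdeg_def)
  moreover have "u + xv j \<le> u + xv i" using xv_antimono h(1) by (intro add_left_mono) simp
  ultimately show "u + xv i \<in> T" using segmentD[OF assms h(2)] by blast
qed

lemma slice_iff: "u \<in> slice y a S \<longleftrightarrow> lookup u y = 0 \<and> u + single y a \<in> S"
  by (simp add: slice_def)

text \<open>One factor of \<open>w\<close> at a time is taken in exchange for a factor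
  \<open>z\<close>. As \<open>z\<close> is the last variable, stability keeps the product in
  \<open>S\<close>; the caps hold because the exponent of \<open>z\<close> only falls and every
  intermediate monomial divides \<open>u + w\<close>.\<close>

lemma stable_slice_move:
  assumes z: "z \<in> V" "\<And>i. i \<in> V \<Longrightarrow> i \<le> z" and S: "S \<subseteq> cdeg V e d" and st: "stable V e S"
    and u: "u \<in> slice z a S" and w: "u + w \<in> capped (V - {z}) e" "tdeg w \<le> a"
  shows "u + w \<in> slice z (a - tdeg w) S"
  using w
proof (induction "tdeg w" arbitrary: w)
  case 0 then show ?case using u by simp
next
  case (Suc k)
  then have "w \<noteq> 0" by auto
  then obtain i where i: "i \<in> keys w" by (metis keys_eq_empty ex_in_conv)
  define w' where "w' = w - xv i"
  have w: "w = w' + xv i" unfolding w'_def by (rule split_off_variable[OF i])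
  have tw: "tdeg w = Suc (tdeg w')" using w by simp
  have cap: "u + w' + xv i \<in> capped (V - {z}) e" using Suc.prems(1) w by (simp add: add.assoc)
  have "u + w' \<in> slice z (a - tdeg w') S"
    by (rule Suc.hyps(1)) (use Suc.hyps(2) Suc.prems tw capped_divisor[OF cap] in auto)
  then have s: "lookup (u + w') z = 0" "u + w' + single z (a - tdeg w') \<in> S"
    by (auto simp: slice_iff)
  have "a - tdeg w' < e z" using s(2) S capped_glue[OF z(1) s(1)] by (auto simp: cdeg_def)
  then have lt: "a - tdeg w < e z" using tw by simp
  have iV: "i \<in> V - {z}"
  proof -
    have "i \<in> keys (u + w' + xv i)" by (simp add: in_keys_iff lookup_add)
    then show ?thesis using cap unfolding capped_def by blast
  qed
  then have iz: "i < z" "i \<in> V" using z(2)[of i] by auto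
  have l0: "lookup (u + w' + xv i) z = 0" using s(1) iz by (simp add: lookup_add lookup_single)
  have "single z (a - tdeg w') = single z (a - tdeg w) + xv z"
  proof -
    have "a - tdeg w' = (a - tdeg w) + 1" using tw Suc.prems(2) by simp
    then show ?thesis by (simp only: single_add)
  qed
  then have "(u + w' + single z (a - tdeg w)) + xv z \<in> S"
    using s(2) by (simp add: add.assoc)
  moreover have re: "(u + w' + single z (a - tdeg w)) + xv i = (u + w' + xv i) + single z (a - tdeg w)"
    by (simp add: ac_simps)
  moreover have "(u + w' + xv i) + single z (a - tdeg w) \<in> capped V e"
    using capped_glue[OF z(1) l0] cap lt by blast
  ultimately have "(u + w' + xv i) + single z (a - tdeg w) \<in> S"
    using stableD[OF st iz(2) z(1) iz(1), of "u + w' + single z (a - tdeg w)"] by simp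
  then show ?case using l0 w by (simp add: slice_iff add.assoc)
qed

text \<open>By \<open>fill\<close>, \<open>s\<close> can be multiplied up to the degree of
  \<open>t\<close> without passing \<open>t\<close>. The new factors are paid for with factors
  \<open>z\<close>, and the resulting monomial puts \<open>t\<close> into the slice
  \<open>b\<close>, which is a segment.\<close>

lemma stable_compressed_lex:
  assumes V: "finite V" and z: "z \<in> V" "\<And>i. i \<in> V \<Longrightarrow> i \<le> z"
    and S: "S \<subseteq> cdeg V e d" and st: "stable V e S"
    and seg: "\<And>a. segment (cdeg (V - {z}) e (d - a)) (slice z a S)"
    and s: "s \<in> slice z a S" and t: "t \<in> cdeg (V - {z}) e (d - b)" "b \<le> a" "s \<le> t"
  shows "t \<in> slice z b S"
proof -
  have sc: "s \<in> cdeg (V - {z}) e (d - a)" "a \<le> d" using slice_cdeg[OF z(1) S s] by auto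
  have "\<exists>w. s + w \<in> capped (V - {z}) e \<and> tdeg (s + w) = tdeg t \<and> s + w \<le> t"
    by (rule fill) (use V sc t in \<open>auto simp: cdeg_def\<close>)
  then obtain w where w: "s + w \<in> capped (V - {z}) e" "tdeg (s + w) = tdeg t" "s + w \<le> t" by blast
  have dw: "tdeg w = a - b" using w(2) sc t(1,2) by (auto simp: cdeg_def)
  then have "s + w \<in> slice z (a - tdeg w) S" using stable_slice_move[OF z S st s w(1)] by simp
  moreover have "a - tdeg w = b" using dw t(2) by simp
  ultimately have "s + w \<in> slice z b S" by simp
  then show ?thesis using segmentD[OF seg _ t(1) w(3)] by blast
qed

lemma le_add_monomial: "(s::nat \<Rightarrow>\<^sub>0 nat) \<le> s + w"
proof -
  have "0 \<le> w"
  proof (cases "w = 0")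
    case False
    then have ne: "keys w \<noteq> {}" by simp
    let ?v = "Min (keys w)"
    have v: "?v \<in> keys w" using ne by simp
    have "0 < w" unfolding less_monomial_iff
    proof (intro exI[of _ ?v] conjI allI impI)
      show "lookup 0 ?v < lookup w ?v" using v by (simp add: in_keys_iff)
      fix u assume "u < ?v"
      then have "u \<notin> keys w" using Min_le[of "keys w" u] by (meson finite_keys leD)
      then show "lookup 0 u = lookup w u" by (simp add: in_keys_iff)
    qed
    then show ?thesis by simp
  qed simp
  then have "s + 0 \<le> s + w" by (rule add_left_mono)
  then show ?thesis by simp
qed

lemma le_of_glue_le:
  assumes "s \<in> capped V' e" "t \<in> capped V' e" "\<And>i. i \<in> V' \<Longrightarrow> i < z"
    and le: "s + single z a \<le> t + single z b"
  shows "s \<le> t"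
proof (rule ccontr)
  assume "\<not> s \<le> t"
  then have "t < s" by simp
  then obtain v where v: "lookup t v < lookup s v"
      "\<And>w. w < v \<Longrightarrow> lookup t w = lookup s w"
    unfolding less_monomial_iff by blast
  have "v \<in> keys s" using v(1) by (simp add: in_keys_iff)
  then have "v < z" using assms(1,3) unfolding capped_def by blast
  then have "t + single z b < s + single z a" unfolding less_monomial_iff
    by (intro exI[of _ v]) (use v in \<open>auto simp: lookup_add lookup_single\<close>)
  then show False using le by simp
qed

text \<open>If \<open>t\<close> is missing from \<open>S\<close>, then by \<open>move\<close> no
  element of \<open>S\<close> lies at or below \<open>t\<close>, so the segment \<open>T\<close>
  contains \<open>S\<close>, and equal size gives \<open>S = T\<close>. The exchange property is
  isolated as the hypothesis \<open>move\<close> because the lemma is used again for a set glued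
  from the sections of an ideal, where it has a different source than stability.\<close>

lemma slice_0_le:
  assumes V: "finite V" and z: "z \<in> V" "\<And>i. i \<in> V \<Longrightarrow> i \<le> z"
    and S: "S \<subseteq> cdeg V e d" and T: "segment (cdeg V e d) T" and card: "card T = card S"
    and seg: "segment (cdeg (V - {z}) e d) (slice z 0 S)"
    and move: "\<And>a s t. s \<in> slice z a S \<Longrightarrow> t \<in> cdeg (V - {z}) e d \<Longrightarrow> s \<le> t \<Longrightarrow> t \<in> slice z 0 S"
  shows "slice z 0 T \<subseteq> slice z 0 S"
proof
  fix t assume t: "t \<in> slice z 0 T"
  have TC: "T \<subseteq> cdeg V e d" using T by (simp add: segment_def)
  have tT: "t \<in> T" using t by (simp add: slice_iff)
  have tc: "t \<in> cdeg (V - {z}) e d" using slice_cdeg(1)[OF z(1) TC t] by simp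
  show "t \<in> slice z 0 S"
  proof (rule ccontr)
    assume nt: "t \<notin> slice z 0 S"
    have "S \<subseteq> T"
    proof
      fix x assume x: "x \<in> S"
      obtain s where s: "x = s + single z (lookup x z)" "s \<in> slice z (lookup x z) S"
        by (rule slice_obtain[OF x])
      have "\<not> x \<le> t"
      proof
        assume "x \<le> t"
        then have "s \<le> t" using s(1) le_add_monomial[of s] by (metis order_trans)
        then show False using move[OF s(2) tc] nt by blast
      qed
      then show "x \<in> T" using segmentD[OF T tT, of x] x S by auto
    qed
    then have "S = T" using card_subset_eq[of T S] finite_subset[OF TC finite_cdeg[OF V]] card by simp
    then show False using t nt by simp
  qed
qed

text \<open>Dual to \<open>slice_0_le\<close>: a missing element of the top slice forces
  \<open>T\<close> into \<open>S\<close>. The top slice is singled out because the exponents of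
  \<open>z\<close> in \<open>T\<close> cannot exceed \<open>e z - 1\<close>, so there are always
  enough factors \<open>z\<close> to trade.\<close>

lemma slice_top_le:
  assumes V: "finite V" and z: "z \<in> V" "\<And>i. i \<in> V \<Longrightarrow> i \<le> z"
    and S: "S \<subseteq> cdeg V e d" and T: "segment (cdeg V e d) T" and card: "card T = card S"
    and st: "stable V e S"
    and seg: "\<And>a. segment (cdeg (V - {z}) e (d - a)) (slice z a S)"
  shows "slice z (e z - 1) S \<subseteq> slice z (e z - 1) T"
proof
  let ?a = "e z - 1"
  fix s assume s: "s \<in> slice z ?a S"
  have TC: "T \<subseteq> cdeg V e d" using T by (simp add: segment_def)
  have s0: "lookup s z = 0" and sS: "s + single z ?a \<in> S" using s by (auto simp: slice_iff)
  have sc: "s \<in> cdeg (V - {z}) e (d - ?a)" using slice_cdeg(1)[OF z(1) S s] .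
  show "s \<in> slice z ?a T"
  proof (rule ccontr)
    assume ns: "s \<notin> slice z ?a T"
    then have nT: "s + single z ?a \<notin> T" using s0 by (simp add: slice_iff)
    have "T \<subseteq> S"
    proof
      fix x assume x: "x \<in> T"
      obtain t where t: "x = t + single z (lookup x z)" "t \<in> slice z (lookup x z) T"
        by (rule slice_obtain[OF x])
      let ?b = "lookup x z"
      have tc: "t \<in> cdeg (V - {z}) e (d - ?b)" "?b < e z" using slice_cdeg[OF z(1) TC t(2)] by auto
      have "\<not> x \<le> s + single z ?a" using segmentD[OF T x] sS S nT by blast
      then have "s + single z ?a \<le> t + single z ?b" using t(1) by auto
      then have "s \<le> t"
        by (rule le_of_glue_le[rotated 3, where V'="V - {z}" and e=e])
          (use sc tc(1) z(2) in \<open>auto simp: cdeg_def le_less\<close>)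
      then have "t \<in> slice z ?b S"
        by (intro stable_compressed_lex[OF V z S st seg s tc(1)]) (use tc(2) in auto)
      then show "x \<in> S" using t(1) by (simp add: slice_iff)
    qed
    then have "T = S" using card_subset_eq[of S T] finite_subset[OF S finite_cdeg[OF V]] card by simp
    then show False using s ns by simp
  qed
qed

text \<open>In a stable set a factor \<open>z\<close> may be exchanged for any other variable, so
  for \<open>a > 0\<close> the slice \<open>a\<close> of the shadow is nothing but the slice
  \<open>a - 1\<close> of \<open>S\<close>. All slices of \<open>S\<close> but the top one reappear
  in this way, and the slice 0 contributes its own shadow.\<close>

lemma card_shadow_stable:
  assumes V: "finite V" and z: "z \<in> V" "\<And>i. i \<in> V \<Longrightarrow> i \<le> z"
    and S: "S \<subseteq> cdeg V e d" and st: "stable V e S" and ez: "0 < e z"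
  shows "card (shadow V e S) + card (slice z (e z - 1) S) = card (shadow (V - {z}) e (slice z 0 S)) + card S"
proof -
  have bound: "lookup t z < e z" if "t \<in> capped V e" for t
    using that z(1) by (simp add: capped_def)
  have slices: "slice z a (shadow V e S) = slice z (a - 1) S" if a: "0 < a" "a < e z" for a
  proof -
    have "shadow (V - {z}) e (slice z a S) \<subseteq> slice z (a - 1) S"
    proof
      fix u assume "u \<in> shadow (V - {z}) e (slice z a S)"
      then obtain s i where s: "s \<in> slice z a S" "u = s + xv i" "u \<in> capped (V - {z}) e"
        by (auto simp: shadow_def)
      have "s + xv i \<in> slice z (a - tdeg (xv i)) S"
        by (rule stable_slice_move[OF z S st s(1)]) (use s a in auto)
      then show "u \<in> slice z (a - 1) S" using s(2) by simp
    qed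
    then show ?thesis using slice_shadow[OF z(1) S, of a] a by auto
  qed
  have 0: "slice z 0 (shadow V e S) = shadow (V - {z}) e (slice z 0 S)"
    using slice_shadow[OF z(1) S, of 0] by simp
  obtain n where n: "e z = Suc n" using ez gr0_implies_Suc by blast
  have "card (shadow V e S) = (\<Sum>a<Suc n. card (slice z a (shadow V e S)))"
    unfolding n[symmetric] by (rule card_slices[OF finite_shadow[OF V S]]) (auto simp: shadow_def intro: bound)
  also have "\<dots> = card (slice z 0 (shadow V e S)) + (\<Sum>a<n. card (slice z (Suc a) (shadow V e S)))"
    by (rule sum.lessThan_Suc_shift)
  also have "(\<Sum>a<n. card (slice z (Suc a) (shadow V e S))) = (\<Sum>a<n. card (slice z a S))"
    by (rule sum.cong) (use slices n in auto)
  finally have 1: "card (shadow V e S) = card (shadow (V - {z}) e (slice z 0 S)) + (\<Sum>a<n. card (slice z a S))"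
    using 0 by simp
  have "card S = (\<Sum>a<Suc n. card (slice z a S))"
    unfolding n[symmetric]
    by (rule card_slices[OF finite_subset[OF S finite_cdeg[OF V]]]) (use S in \<open>auto simp: cdeg_def intro: bound\<close>)
  then show ?thesis using 1 n by simp
qed

text \<open>By \<open>card_shadow_stable\<close>, for fixed size the shadow is small if the slice 0
  is small and the top slice is large. The segment is extremal in both respects.\<close>

lemma card_shadow_le_of_stable:
  assumes V: "finite V" and z: "z \<in> V" "\<And>i. i \<in> V \<Longrightarrow> i \<le> z"
    and S: "S \<subseteq> cdeg V e d" and T: "segment (cdeg V e d) T" and card: "card T = card S"
    and st: "stable V e S"
    and seg: "\<And>a. segment (cdeg (V - {z}) e (d - a)) (slice z a S)"
  shows "card (shadow V e T) \<le> card (shadow V e S)"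
proof (cases "e z = 0")
  case True
  have "t \<notin> cdeg V e d" for t
  proof
    assume "t \<in> cdeg V e d"
    then have "lookup t z < e z" using z(1) by (simp add: cdeg_def capped_def)
    then show False using True by simp
  qed
  then have "cdeg V e d = {}" by blast
  then have "T = {}" using T by (simp add: segment_def)
  then show ?thesis by (simp add: shadow_def)
next
  case False
  have TC: "T \<subseteq> cdeg V e d" using T by (simp add: segment_def)
  have fV: "finite (V - {z})" using V by simp
  have sub: "slice z a X \<subseteq> cdeg (V - {z}) e (d - a)" if "X \<subseteq> cdeg V e d" for a X
    using slice_cdeg(1)[OF z(1) that] by blast
  have "slice z 0 T \<subseteq> slice z 0 S"
  proof (rule slice_0_le[OF V z S T card])
    show "segment (cdeg (V - {z}) e d) (slice z 0 S)" using seg[of 0] by simp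
    fix a s t assume h: "s \<in> slice z a S" "t \<in> cdeg (V - {z}) e d" "s \<le> t"
    show "t \<in> slice z 0 S"
      by (rule stable_compressed_lex[OF V z S st seg h(1) _ _ h(3)]) (use h(2) in auto)
  qed
  then have "card (shadow (V - {z}) e (slice z 0 T)) \<le> card (shadow (V - {z}) e (slice z 0 S))"
    by (intro card_mono shadow_mono finite_shadow[OF fV sub[OF S]])
  moreover have "card (slice z (e z - 1) S) \<le> card (slice z (e z - 1) T)"
    by (intro card_mono slice_top_le[OF V z S T card st seg] finite_subset[OF sub[OF TC] finite_cdeg[OF fV]])
  ultimately show ?thesis
    using card_shadow_stable[OF V z S st] card_shadow_stable[OF V z TC segment_stable[OF T]] False card by simp
qed

text \<open>An exchange between two variables other than \<open>y\<close> does not leave the slice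
  with respect to \<open>y\<close>, and that slice is a segment.\<close>

lemma compressed_stable:
  assumes y: "y \<in> V" and S: "S \<subseteq> cdeg V e d"
    and seg: "\<And>a. segment (cdeg (V - {y}) e (d - a)) (slice y a S)"
    and ij: "i \<noteq> y" "j \<noteq> y" "i < j" and u: "u + xv j \<in> S" "u + xv i \<in> capped V e"
  shows "u + xv i \<in> S"
proof -
  let ?a = "lookup u y"
  define u' where "u' = u - single y ?a"
  have e: "u = u' + single y ?a" and u'0: "lookup u' y = 0"
    unfolding u'_def by (rule split_off_power)+
  have ej: "u + xv j = (u' + xv j) + single y ?a" and
    ei: "u + xv i = (u' + xv i) + single y ?a" using e by (metis add.assoc add.commute)+
  have 0: "lookup (u' + xv j) y = 0" "lookup (u' + xv i) y = 0"
    using u'0 ij by (auto simp: lookup_add lookup_single)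
  have s: "u' + xv j \<in> slice y ?a S" using u(1) ej 0 by (simp add: slice_iff)
  have "tdeg (u + xv j) = d" using u(1) S by (auto simp: cdeg_def)
  then have "u + xv i \<in> cdeg V e d" using u(2) by (simp add: cdeg_def)
  then have "(u' + xv i) + single y ?a \<in> cdeg V e d" using ei by simp
  then have "u' + xv i \<in> slice y ?a (cdeg V e d)" using 0 by (simp add: slice_iff)
  then have c: "u' + xv i \<in> cdeg (V - {y}) e (d - ?a)" by (rule slice_cdeg(1)[OF y subset_refl])
  have "u' + xv j \<le> u' + xv i" using xv_antimono ij(3) by (intro add_left_mono) simp
  then have "u' + xv i \<in> slice y ?a S" using segmentD[OF seg s c] by blast
  then show ?thesis using ei by (simp add: slice_iff)
qed

section \<open>Two variables, and the induction on the number of variables\<close>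

lemma two_variable_less:
  assumes vw: "v < w" and "s \<in> cdeg {v, w} e d" "t \<in> cdeg {v, w} e d"
  shows "s < t \<longleftrightarrow> lookup s v < lookup t v"
proof -
  have d: "lookup s v + lookup s w = d" "lookup t v + lookup t w = d"
    using assms tdeg_eq_sum[of "{v, w}" s] tdeg_eq_sum[of "{v, w}" t] by (auto simp: cdeg_def capped_def)
  have z: "lookup s i = 0" "lookup t i = 0" if "i \<noteq> v" "i \<noteq> w" for i
    using assms(2,3) that by (auto simp: cdeg_def intro!: capped_lookup_outside[of _ "{v, w}" e])
  show ?thesis
  proof
    assume "s < t"
    then obtain i where i: "lookup s i < lookup t i"
      "\<forall>j<i. lookup s j = lookup t j" unfolding less_monomial_iff by blast
    have "i = v \<or> i = w" using z[of i] i(1) by auto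
    then show "lookup s v < lookup t v"
      using i d vw by auto
  next
    assume "lookup s v < lookup t v"
    then show "s < t" unfolding less_monomial_iff
      by (intro exI[of _ v]) (use z vw in auto)
  qed
qed

text \<open>There is no third variable to compress in, so this case is counted directly. The
  monomials of one degree form a chain. While \<open>Suc d < e v\<close>, no cap is reached, that of
  \<open>w\<close> being no smaller; then a nonempty \<open>S\<close> gains at least one element and
  a segment at most one. From then on a segment, which starts at the \<open>v\<close> end of the
  chain, gains nothing, and it remains to see that \<open>S\<close> loses nothing.\<close>

lemma minimal_shadows_two:
  assumes vw: "v < w" and le: "e v \<le> e w"
  shows "minimal_shadows {v, w} e"
  unfolding minimal_shadows_def
proof (intro allI impI)
  fix d S T assume S: "S \<subseteq> cdeg {v, w} e d" and T: "segment (cdeg {v, w} e d) T" and card: "card T = card S"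
  let ?V = "{v, w}"
  have fin: "finite (cdeg ?V e d)" for d by (rule finite_cdeg) simp
  have TC: "T \<subseteq> cdeg ?V e d" using T by (simp add: segment_def)
  have fT: "finite T" and fS: "finite S" using TC S fin finite_subset by metis+
  have fsS: "finite (shadow ?V e S)" by (rule finite_shadow[OF _ S]) simp
  have sum: "lookup t v + lookup t w = d" if "t \<in> cdeg ?V e d" for t d
    using that tdeg_eq_sum[of ?V t] vw by (auto simp: cdeg_def capped_def)
  have cap: "t + xv i \<in> capped ?V e" if "t \<in> cdeg ?V e d" "i \<in> ?V" "lookup t i + 1 < e i" for t i
    using that Poly_Mapping.keys_add[of t "xv i"]
    by (auto simp: cdeg_def capped_def lookup_add lookup_single when_def)
  have sh: "t + xv i \<in> shadow ?V e X" if "t \<in> X" "X \<subseteq> cdeg ?V e d" "i \<in> ?V" "lookup t i + 1 < e i" for t i X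
    using cap[of t i] that by (auto simp: shadow_def)
  have up: "shadow ?V e T \<subseteq> (\<lambda>t. t + xv w) ` T \<union> ({single v (Suc d)} \<inter> capped ?V e)"
  proof
    fix u assume u: "u \<in> shadow ?V e T"
    then obtain t i where t: "t \<in> T" "i \<in> ?V" "u = t + xv i" by (auto simp: shadow_def)
    have uc: "u \<in> cdeg ?V e (Suc d)" using shadow_cdeg[OF TC] u by blast
    show "u \<in> (\<lambda>t. t + xv w) ` T \<union> ({single v (Suc d)} \<inter> capped ?V e)"
    proof (cases "lookup u w = 0")
      case True
      have "lookup u v = Suc d" using sum[OF uc] True by simp
      moreover have "lookup u i = 0" if "i \<noteq> v" for i
        using True uc that by (cases "i = w") (auto simp: cdeg_def intro!: capped_lookup_outside[of _ ?V e])
      ultimately have "u = single v (Suc d)"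
        by (intro poly_mapping_eqI) (auto simp: lookup_single when_def)
      then show ?thesis using uc by (auto simp: cdeg_def)
    next
      case False
      define t' where "t' = u - xv w"
      have ut: "u = t' + xv w" unfolding t'_def by (rule split_off_variable) (use False in \<open>simp add: in_keys_iff\<close>)
      have t'c: "t' \<in> cdeg ?V e d" using uc ut capped_divisor[of t' "xv w"] by (auto simp: cdeg_def)
      have "t + xv w \<le> t' + xv w"
      proof -
        have "t + xv w \<le> t + xv i" using t(2) vw xv_antimono[of i w] by (intro add_left_mono) auto
        then show ?thesis using t(3) ut by simp
      qed
      then have "t' \<in> T" using segmentD[OF T t(1) t'c] by simp
      then show ?thesis using ut by blast
    qed
  qed
  have im: "card ((\<lambda>t. t + xv i) ` X) = card X" for i and X :: "(nat \<Rightarrow>\<^sub>0 nat) set"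
    by (rule card_image) (rule inj_onI, simp)
  show "card (shadow ?V e T) \<le> card (shadow ?V e S)"
  proof (cases "S = {} \<or> S = cdeg ?V e d")
    case True
    then have "T = S" using card fT card_subset_eq[OF fin TC] by auto
    then show ?thesis by simp
  next
    case False
    show ?thesis
    proof (cases "Suc d < e v")
      case True
      have lt: "lookup t i + 1 < e i" if "t \<in> S" "i \<in> ?V" for t i
      proof -
        have "t \<in> cdeg ?V e d" using that S by blast
        then have "lookup t i \<le> d" using lookup_le_tdeg[of t i] by (simp add: cdeg_def)
        then show ?thesis using True that(2) le by auto
      qed
      let ?M = "Max S"
      have M: "?M \<in> S" by (rule Max_in) (use fS False in auto)
      have "?M + xv v \<notin> (\<lambda>t. t + xv w) ` S"
      proof
        assume "?M + xv v \<in> (\<lambda>t. t + xv w) ` S"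
        then obtain t where t: "t \<in> S" "?M + xv v = t + xv w" by blast
        have "?M + xv w < ?M + xv v" using xv_strict_antimono[OF vw] by (rule add_strict_left_mono)
        then have "?M + xv w < t + xv w" using t(2) by (simp only:)
        then have "?M < t" by (rule add_less_imp_less_right)
        then show False using Max_ge[OF fS t(1)] by simp
      qed
      then have "card (insert (?M + xv v) ((\<lambda>t. t + xv w) ` S)) = card S + 1" using fS im by simp
      moreover have "insert (?M + xv v) ((\<lambda>t. t + xv w) ` S) \<subseteq> shadow ?V e S"
        using sh[OF _ S] lt M by auto
      ultimately have "card S + 1 \<le> card (shadow ?V e S)" using card_mono[OF fsS] by metis
      moreover have "card (shadow ?V e T) \<le> card T + 1"
      proof -
        have "shadow ?V e T \<subseteq> insert (single v (Suc d)) ((\<lambda>t. t + xv w) ` T)" using up by blast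
        then have "card (shadow ?V e T) \<le> card (insert (single v (Suc d)) ((\<lambda>t. t + xv w) ` T))"
          by (rule card_mono[rotated]) (use fT in simp)
        also have "\<dots> \<le> card T + 1" using card_insert_le_m1 im card_insert_if fT
          by (metis Suc_eq_plus1 finite_imageI le_SucI order_refl)
        finally show ?thesis .
      qed
      ultimately show ?thesis using card by simp
    next
      case ns: False
      have "single v (Suc d) \<notin> capped ?V e" using ns by (auto simp: capped_def)
      then have "shadow ?V e T \<subseteq> (\<lambda>t. t + xv w) ` T" using up by blast
      then have 1: "card (shadow ?V e T) \<le> card T" using card_mono[of "(\<lambda>t. t + xv w) ` T"] fT im by simp
      obtain g where g: "g \<in> cdeg ?V e d" "g \<notin> S" using False S by blast
      have gl: "lookup g v < e v" "lookup g w < e w" using g(1) by (auto simp: cdeg_def capped_def)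
      \<comment> \<open>\<open>g\<close> is a gap in \<open>S\<close>. Monomials on either side of
        it are moved towards it, so the raised exponent does not exceed that of \<open>g\<close> and
        respects the cap. Images from the two sides cannot meet, since \<open>g\<close> lies
        strictly between them.\<close>
      define f where "f = (\<lambda>t. if t < g then t + xv v else t + xv w)"
      have "f ` S \<subseteq> shadow ?V e S"
      proof (rule image_subsetI)
        fix t assume t: "t \<in> S"
        then have tc: "t \<in> cdeg ?V e d" using S by blast
        show "f t \<in> shadow ?V e S"
        proof (cases "t < g")
          case True
          then have "lookup t v < lookup g v" using two_variable_less[OF vw tc g(1)] by simp
          then show ?thesis using sh[OF t S, of v] gl True by (simp add: f_def)
        next
          case False
          then have "g < t" using t g(2) by (metis linorder_neqE)
          then have "lookup g v < lookup t v" using two_variable_less[OF vw g(1) tc] by simp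
          then have "lookup t w < lookup g w" using sum[OF tc] sum[OF g(1)] by simp
          then show ?thesis using sh[OF t S, of w] gl False by (simp add: f_def)
        qed
      qed
      moreover have "inj_on f S"
      proof (rule inj_onI)
        fix s t assume st: "s \<in> S" "t \<in> S" "f s = f t"
        have no: False if h: "a \<in> S" "b \<in> S" "a < g" "\<not> b < g" "a + xv v = b + xv w" for a b
        proof -
          have ac: "a \<in> cdeg ?V e d" and bc: "b \<in> cdeg ?V e d" using h S by auto
          have "lookup a v < lookup g v" using two_variable_less[OF vw ac g(1)] h(3) by simp
          moreover have "g < b" using h(2,4) g(2) by (metis linorder_neqE)
          then have "lookup g v < lookup b v" using two_variable_less[OF vw g(1) bc] by simp
          moreover have "lookup a v + 1 = lookup b v"
            using arg_cong[OF h(5), of "\<lambda>t. lookup t v"] vw by (simp add: lookup_add lookup_single)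
          ultimately show False by simp
        qed
        show "s = t" using st no[of s t] no[of t s] by (auto simp: f_def split: if_splits)
      qed
      ultimately have "card S \<le> card (shadow ?V e S)" using card_inj_on_le[OF _ _ fsS] by blast
      then show ?thesis using 1 card by simp
    qed
  qed
qed

lemma minimal_shadows_one:
  assumes "finite V" "card V \<le> 1" shows "minimal_shadows V e"
  unfolding minimal_shadows_def
proof (intro allI impI)
  fix d S T assume S: "S \<subseteq> cdeg V e d" and T: "segment (cdeg V e d) T" and card: "card T = card S"
  have TC: "T \<subseteq> cdeg V e d" using T by (simp add: segment_def)
  have "V = {} \<or> (\<exists>v. V = {v})" using assms by (metis One_nat_def card_0_eq card_1_singletonE le_SucE le_zero_eq)
  then obtain v where v: "V \<subseteq> {v}" by blast
  have one: "t = single v d" if "t \<in> cdeg V e d" for t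
  proof (rule poly_mapping_eqI)
    have k: "keys t \<subseteq> {v}" "tdeg t = d" using that v by (auto simp: cdeg_def capped_def)
    then have "lookup t v = d" using tdeg_eq_sum[of "{v}" t] by simp
    moreover have "lookup t i = 0" if "i \<noteq> v" for i using k that by (auto simp: in_keys_iff subset_iff)
    ultimately show "lookup t i = lookup (single v d) i" for i
      by (cases "i = v") (simp_all add: lookup_single)
  qed
  have "S \<subseteq> {single v d}" "T \<subseteq> {single v d}" using one S TC by blast+
  then have "S = T" using card by (auto simp: subset_singleton_iff)
  then show "card (shadow V e T) \<le> card (shadow V e S)" by simp
qed

text \<open>Among the sets of the given size whose shadow is no larger, one with the least sum of
  ranks is taken. Compression keeps it in this class and lowers the sum unless nothing changes, so
  this set is compressed in every variable. With at least three variables, any exchange of two of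
  them avoids a third, and \<open>compressed_stable\<close> makes the set stable.\<close>

lemma minimal_shadows_compress:
  assumes V: "finite V" and three: "3 \<le> card V" and IH: "\<And>y. y \<in> V \<Longrightarrow> minimal_shadows (V - {y}) e"
  shows "minimal_shadows V e"
  unfolding minimal_shadows_def
proof (intro allI impI)
  fix d S0 T assume S0: "S0 \<subseteq> cdeg V e d" and T: "segment (cdeg V e d) T" and cardT: "card T = card S0"
  let ?C = "cdeg V e d"
  have fC: "finite ?C" using finite_cdeg[OF V] .
  \<comment> \<open>The number of larger monomials is strictly decreasing in the order, as
    \<open>segment_sum_less\<close> requires of a weight.\<close>
  define rk where "rk = (\<lambda>t. card {u\<in>?C. t < u})"
  have rk: "rk u < rk t" if "t \<in> ?C" "u \<in> ?C" "t < u" for t u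
    unfolding rk_def
  proof (rule psubset_card_mono)
    have "u \<in> {u\<in>?C. t < u}" "u \<notin> {x\<in>?C. u < x}" using that by auto
    moreover have "{x\<in>?C. u < x} \<subseteq> {u\<in>?C. t < u}" using that(3) by auto
    ultimately show "{x\<in>?C. u < x} \<subset> {u\<in>?C. t < u}" by blast
  qed (use fC in auto)
  define P where "P = (\<lambda>S. S \<subseteq> ?C \<and> card S = card S0 \<and> card (shadow V e S) \<le> card (shadow V e S0))"
  have "\<exists>S. P S" using S0 by (auto simp: P_def)
  then obtain S where PS: "P S" and least: "\<And>S'. P S' \<Longrightarrow> sum rk S \<le> sum rk S'"
    using ex_has_least_nat[of P _ "sum rk"] by blast
  have S: "S \<subseteq> ?C" using PS by (simp add: P_def)
  have bound: "lookup t y < e y" if "y \<in> V" "X \<subseteq> ?C" "t \<in> X" for t y X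
    using that by (auto simp: cdeg_def capped_def)
  have comp: "segment (cdeg (V - {y}) e (d - a)) (slice y a S)" if y: "y \<in> V" for y a
  proof -
    obtain S' where S': "S' \<subseteq> ?C" and seg: "\<And>a. segment (cdeg (V - {y}) e (d - a)) (slice y a S')"
      and card: "\<And>a. card (slice y a S') = card (slice y a S)"
      using compress_exists[OF V y S] by blast
    have fX: "finite X" if "X \<subseteq> ?C" for X using finite_subset[OF that fC] .
    have fsl: "finite (cdeg (V - {y}) e b)" for b using finite_cdeg V by simp
    have sub: "slice y b X \<subseteq> cdeg (V - {y}) e (d - b)" if "X \<subseteq> ?C" for b X
      using slice_cdeg(1)[OF y that] by blast
    have "card S' = card S"
      using card_slices[OF fX[OF S'] bound[OF y S']] card_slices[OF fX[OF S] bound[OF y S]] card by simp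
    then have PS': "P S'" unfolding P_def
      using S' PS card_shadow_compress[OF V y IH[OF y] S S' seg card] by (auto simp: P_def)
    let ?f = "\<lambda>b u. rk (u + single y b)"
    have lt: "sum (?f b) (slice y b S') < sum (?f b) (slice y b S)" if ne: "slice y b S \<noteq> slice y b S'" for b
    proof (rule segment_sum_less[OF fsl seg sub[OF S]])
      show "card (slice y b S) = card (slice y b S')" using card by simp
      show "slice y b S \<noteq> slice y b S'" by fact
      have "slice y b S \<noteq> {}"
      proof
        assume e: "slice y b S = {}"
        then have "card (slice y b S') = 0" using card[of b] by simp
        then have "slice y b S' = {}" using finite_subset[OF sub[OF S'] fsl] by simp
        then show False using e ne by simp
      qed
      then have b: "b \<le> d" "b < e y" using slice_cdeg(2,3)[OF y S] by blast+
      fix t u assume t: "t \<in> cdeg (V - {y}) e (d - b)" and u: "u \<in> cdeg (V - {y}) e (d - b)" and tu: "t < u"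
      show "?f b u < ?f b t"
      proof (rule rk)
        show "t + single y b \<in> ?C" "u + single y b \<in> ?C"
          using glue_cdeg(1)[OF y t b(2)] glue_cdeg(1)[OF y u b(2)] b(1) by simp_all
        show "t + single y b < u + single y b" using tu by (rule add_strict_right_mono)
      qed
    qed
    have le: "sum (?f b) (slice y b S') \<le> sum (?f b) (slice y b S)" for b
      using lt[of b] by (cases "slice y b S = slice y b S'") auto
    have "slice y a S = slice y a S'"
    proof (rule ccontr)
      assume ne: "slice y a S \<noteq> slice y a S'"
      have "a < e y"
      proof (rule ccontr)
        assume "\<not> a < e y"
        then have "slice y a S = {}" "slice y a S' = {}" using slice_cdeg(3)[OF y S] slice_cdeg(3)[OF y S'] by blast+
        then show False using ne by simp
      qed
      then have "(\<Sum>b<e y. sum (?f b) (slice y b S')) < (\<Sum>b<e y. sum (?f b) (slice y b S))"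
        by (intro sum_strict_mono_ex1) (use le lt[OF ne] in auto)
      then have "sum rk S' < sum rk S"
        using sum_slices[OF fX[OF S'] bound[OF y S'], of rk] sum_slices[OF fX[OF S] bound[OF y S], of rk] by simp
      then show False using least[OF PS'] by simp
    qed
    then show ?thesis using seg by simp
  qed
  have st: "stable V e S"
    unfolding stable_def
  proof (intro ballI allI impI)
    fix i j u assume ij: "i \<in> V" "j \<in> V" "i < j" and u: "u + xv j \<in> S" "u + xv i \<in> capped V e"
    have "\<not> V \<subseteq> {i, j}"
    proof
      assume "V \<subseteq> {i, j}"
      then have "card V \<le> card {i, j}" by (rule card_mono[rotated]) simp
      also have "card {i, j} \<le> 2" by (simp add: card_insert_if)
      finally show False using three by simp
    qed
    then obtain y where y: "y \<in> V" "i \<noteq> y" "j \<noteq> y" by blast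
    show "u + xv i \<in> S" by (rule compressed_stable[OF y(1) S comp[OF y(1)] y(2,3) ij(3) u])
  qed
  have "V \<noteq> {}" using three by auto
  then have z: "Max V \<in> V" "\<And>i. i \<in> V \<Longrightarrow> i \<le> Max V" using V by auto
  have "card (shadow V e T) \<le> card (shadow V e S)"
    by (rule card_shadow_le_of_stable[OF V z S T _ st comp[OF z(1)]]) (use cardT PS in \<open>simp_all add: P_def\<close>)
  then show "card (shadow V e T) \<le> card (shadow V e S0)" using PS by (simp add: P_def)
qed

text \<open>Compression reduces to one variable less, but sets compressed in both of two variables
  need not be stable, hence the separate base case. Only there is the order of the caps used; it
  passes to subsets of \<open>V\<close>.\<close>

theorem clements_lindstroem:
  assumes "finite V" "\<And>i j. i \<in> V \<Longrightarrow> j \<in> V \<Longrightarrow> i < j \<Longrightarrow> e i \<le> e j"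
  shows "minimal_shadows V e"
  using assms
proof (induction "card V" arbitrary: V rule: less_induct)
  case less
  consider "card V \<le> 1" | "card V = 2" | "3 \<le> card V" by linarith
  then show ?case
  proof cases
    case 1 then show ?thesis using minimal_shadows_one less.prems(1) by blast
  next
    case 2
    then obtain a b where ab: "V = {a, b}" "a \<noteq> b" by (auto simp: card_2_iff)
    define v w where "v = min a b" and "w = max a b"
    have "v < w" "V = {v, w}" using ab by (auto simp: v_def w_def min_def max_def)
    then show ?thesis using minimal_shadows_two[of v w e] less.prems(2)[of v w] by simp
  next
    case 3
    show ?thesis
    proof (rule minimal_shadows_compress[OF less.prems(1) 3])
      fix y assume y: "y \<in> V"
      have "card (V - {y}) < card V" using y less.prems(1) by (rule card_Diff1_less[rotated])
      then show "minimal_shadows (V - {y}) e" by (rule less.hyps) (use less.prems in auto)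
    qed
  qed
qed

section \<open>Polynomials, monomial ideals and lex-plus-powers ideals\<close>

text \<open>\<open>hcomp\<close> and \<open>trunc\<close>, and later \<open>zcomp\<close> and
  \<open>part\<close>, all keep the terms whose monomial satisfies a predicate; linearity and the
  behaviour under monomial multiplication are proved once for all of them.\<close>

definition restr :: "((nat \<Rightarrow>\<^sub>0 nat) \<Rightarrow> bool) \<Rightarrow> 'k::field mpoly \<Rightarrow> 'k mpoly" where
  "restr Q p = (\<Sum>t\<in>{t\<in>keys p. Q t}. single t (lookup p t))"

lemma hcomp_restr: "hcomp d = restr (\<lambda>t. tdeg t = d)"
  by (rule ext) (simp add: hcomp_def restr_def)

lemma trunc_restr: "trunc c = restr (\<lambda>t. t \<in> mons c)"
  by (rule ext) (simp add: trunc_def restr_def)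

lemma lookup_restr [simp]: "lookup (restr Q p) t = (if Q t then lookup p t else 0)"
proof -
  have "lookup (restr Q p) t
    = (\<Sum>s\<in>{s\<in>keys p. Q s}. if s = t then lookup p s else 0)"
    by (simp add: restr_def lookup_sum lookup_single when_def)
  also have "\<dots> = (if Q t then lookup p t else 0)"
    by (subst sum.delta) (auto simp: in_keys_iff)
  finally show ?thesis .
qed

lemma keys_restr: "keys (restr Q p) = {t\<in>keys p. Q t}"
  by (auto simp: in_keys_iff split: if_splits)

lemma restr_add: "restr Q (p + q) = restr Q p + restr Q q"
  by (rule poly_mapping_eqI) (simp add: lookup_add)

lemma restr_diff: "restr Q (p - q) = restr Q p - restr Q q"
  by (rule poly_mapping_eqI) (simp add: lookup_minus)

lemma restr_uminus: "restr Q (- p) = - restr Q p"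
  by (rule poly_mapping_eqI) simp

lemma restr_0 [simp]: "restr Q 0 = 0"
  by (rule poly_mapping_eqI) simp

lemma restr_sum: "restr Q (sum f A) = (\<Sum>x\<in>A. restr Q (f x))"
  by (rule poly_mapping_eqI) (simp add: lookup_sum)

lemma restr_id: "(\<And>t. t \<in> keys p \<Longrightarrow> Q t) \<Longrightarrow> restr Q p = p"
  by (rule poly_mapping_eqI) (auto simp: in_keys_iff)

lemma restr_eq_0_iff: "restr Q p = 0 \<longleftrightarrow> (\<forall>t\<in>keys p. \<not> Q t)"
  unfolding keys_eq_empty[symmetric] keys_restr by blast

lemma poly_eq_sum: "(p::'k::field mpoly) = (\<Sum>t\<in>keys p. single t (lookup p t))"
proof -
  have "p = restr (\<lambda>_. True) p" by (rule restr_id[symmetric]) simp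
  then show ?thesis by (simp add: restr_def)
qed

lemma poly_induct [case_names zero add_single]:
  assumes "P (0::'k::field mpoly)"
    and "\<And>t c q. P q \<Longrightarrow> P (single t c + q)"
  shows "P p"
proof -
  have "finite A \<Longrightarrow> P (\<Sum>t\<in>A. single t (lookup p t))" for A
    by (induction A rule: finite_induct) (use assms in auto)
  then show ?thesis using poly_eq_sum[of p] by (metis finite_keys)
qed

lemma lookup_single_mult_add:
  "lookup (single s c * (p::'k::field mpoly)) (s + u) = c * lookup p u"
proof (induction p rule: poly_induct)
  case (add_single t a q)
  then show ?case
    by (simp add: distrib_left lookup_add mult_single lookup_single when_def)
qed simp

lemma lookup_single_mult_outside:
  assumes "\<And>u. t \<noteq> s + u"
  shows "lookup (single s c * (p::'k::field mpoly)) t = 0"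
proof (induction p rule: poly_induct)
  case (add_single v a q)
  then show ?case using assms[of v]
    by (simp add: distrib_left lookup_add mult_single lookup_single when_def)
qed simp

lemma poly_single_mult_eqI:
  assumes "\<And>u. lookup p (s + u) = lookup q (s + u)"
    and "\<And>t. (\<And>u. t \<noteq> s + u) \<Longrightarrow> lookup p t = lookup q t"
  shows "p = q"
  by (rule poly_mapping_eqI) (metis assms)

lemma restr_single_mult:
  "restr Q (single s c * p) = single s c * restr (\<lambda>u. Q (s + u)) p"
  by (rule poly_single_mult_eqI[of _ s])
    (simp_all add: lookup_single_mult_add lookup_single_mult_outside)

lemma keys_single_mult:
  assumes "t \<in> keys (single s c * (p::'k::field mpoly))"
  obtains u where "t = s + u" "u \<in> keys p"
proof -
  obtain u where u: "t = s + u" using assms lookup_single_mult_outside[of t s c p] by (auto simp: in_keys_iff)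
  then have "u \<in> keys p" using assms lookup_single_mult_add[of s c p u] by (auto simp: in_keys_iff)
  then show thesis using u that by blast
qed

lemma lookup_const_mult [simp]: "lookup (const c * p) t = c * lookup p t"
  using lookup_single_mult_add[of 0 c p t] by (simp add: const_def)

lemma lookup_pscale [simp]: "lookup (pscale c p) t = c * lookup p t"
  by (simp add: pscale_def)

interpretation pv: vector_space pscale
  by unfold_locales (rule poly_mapping_eqI, simp add: lookup_add algebra_simps)+

lemma lookup_cscale: "cscale c f S = pscale c (f S)"
  by (simp add: cscale_def)

interpretation cv: vector_space cscale
  by unfold_locales
    (simp_all add: fun_eq_iff lookup_cscale pv.scale_right_distrib pv.scale_left_distrib)

lemma linear_pscaleI:
  assumes "\<And>p q. f (p + q) = f p + f q" "\<And>c p. f (pscale c p) = pscale c (f p)"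
  shows "Vector_Spaces.linear pscale pscale f"
  unfolding Vector_Spaces.linear_iff using assms pv.vector_space_axioms by blast

lemma linear_cscaleI:
  assumes "\<And>p q. f (p + q) = f p + f q" "\<And>c p. f (cscale c p) = cscale c (f p)"
  shows "Vector_Spaces.linear cscale cscale f"
  unfolding Vector_Spaces.linear_iff using assms cv.vector_space_axioms by blast

lemma mult_pscale: "q * pscale c p = pscale c (q * p)"
  by (simp add: pscale_def mult.left_commute)

lemma restr_pscale: "restr Q (pscale c p) = pscale c (restr Q p)"
  by (rule poly_mapping_eqI) simp

lemma linear_restr: "Vector_Spaces.linear pscale pscale (restr Q)"
  by (rule linear_pscaleI) (rule restr_add, rule restr_pscale)

lemma linear_mult: "Vector_Spaces.linear pscale pscale ((*) q)"
  by (rule linear_pscaleI) (rule distrib_left, rule mult_pscale)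

lemma mons_iff: "t \<in> mons m \<longleftrightarrow> keys t \<subseteq> {..<m}"
  by (auto simp: mons_def)

lemma mons_lookup: "t \<in> mons m \<longleftrightarrow> (\<forall>i\<ge>m. lookup t i = 0)"
  by (auto simp: mons_def in_keys_iff not_less[symmetric])

lemma mons_add_iff [simp]: "s + t \<in> mons m \<longleftrightarrow> s \<in> mons m \<and> t \<in> mons m"
  by (auto simp: mons_lookup lookup_add)

lemma mons_single_iff: "single i a \<in> mons m \<longleftrightarrow> a = 0 \<or> i < m"
  by (auto simp: mons_def)

lemma zero_mons [simp]: "0 \<in> mons m"
  by (simp add: mons_def)

lemma finite_mons_deg: "finite {t\<in>mons m. tdeg t = d}"
  by (rule finite_subset[OF _ finite_monomials_le[of "{..<m}" d]]) (auto simp: mons_iff)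

lemma polys_iff: "p \<in> polys m \<longleftrightarrow> (\<forall>t\<in>keys p. t \<in> mons m)"
  by (auto simp: polys_def)

lemma polys_lookup: "p \<in> polys m \<longleftrightarrow> (\<forall>t. t \<notin> mons m \<longrightarrow> lookup p t = 0)"
  by (auto simp: polys_iff in_keys_iff)

lemma polys_0 [simp]: "0 \<in> polys m" and polys_add: "p \<in> polys m \<Longrightarrow> q \<in> polys m \<Longrightarrow> p + q \<in> polys m"
  and polys_diff: "p \<in> polys m \<Longrightarrow> q \<in> polys m \<Longrightarrow> p - q \<in> polys m"
  and polys_pscale: "p \<in> polys m \<Longrightarrow> pscale c p \<in> polys m"
  and polys_restr: "p \<in> polys m \<Longrightarrow> restr Q p \<in> polys m"
  by (auto simp: polys_lookup lookup_add lookup_minus)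

lemma polys_single [simp]: "single t c \<in> polys m \<longleftrightarrow> c = 0 \<or> t \<in> mons m"
  by (auto simp: polys_lookup lookup_single when_def)

lemma polys_mult: "p \<in> polys m \<Longrightarrow> q \<in> polys m \<Longrightarrow> p * q \<in> polys m"
  unfolding polys_iff using Poly_Mapping.keys_mult[of p q] by fastforce

lemma polys_var: "i < m \<Longrightarrow> var i \<in> polys m"
  by (simp add: var_def mons_single_iff)

lemma homog_iff: "homog d p \<longleftrightarrow> (\<forall>t. tdeg t \<noteq> d \<longrightarrow> lookup p t = 0)"
  by (auto simp: homog_def in_keys_iff)

lemma homog_0 [simp]: "homog d 0" and homog_add: "homog d p \<Longrightarrow> homog d q \<Longrightarrow> homog d (p + q)"
  and homog_pscale: "homog d p \<Longrightarrow> homog d (pscale c p)"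
  and homog_restr: "homog d p \<Longrightarrow> homog d (restr Q p)"
  by (auto simp: homog_iff lookup_add)

lemma homog_hcomp: "homog d (hcomp d p)"
  by (simp add: homog_iff hcomp_restr)

lemma homog_hcomp_eq: "homog d p \<Longrightarrow> hcomp e p = (if e = d then p else 0)"
  by (rule poly_mapping_eqI) (auto simp: homog_iff hcomp_restr)

lemma homog_mult:
  assumes "homog d p" "homog e q" shows "homog (d + e) (p * q)"
  unfolding homog_def
proof
  fix t assume "t \<in> keys (p * q)"
  then obtain a b where "t = a + b" "a \<in> keys p" "b \<in> keys q"
    using Poly_Mapping.keys_mult[of p q] by blast
  then show "tdeg t = d + e" using assms by (simp add: homog_def)
qed

lemma homog_single [simp]: "homog d (single t c) \<longleftrightarrow> c = 0 \<or> tdeg t = d"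
  by (auto simp: homog_iff lookup_single when_def)

lemma homog_var: "homog 1 (var i)"
  by (simp add: var_def)

section \<open>Graded pieces, leading monomials and Hilbert functions\<close>

definition hdim :: "nat \<Rightarrow> 'k::field mpoly set \<Rightarrow> nat" where
  "hdim d I = pv.dim (gpiece d I)"

lemma gpiece_iff: "p \<in> gpiece d I \<longleftrightarrow> p \<in> I \<and> homog d p"
  by (auto simp: gpiece_def)

lemma subspace_gpiece: "pv.subspace I \<Longrightarrow> pv.subspace (gpiece d I)"
  by (rule pv.subspaceI)
    (auto simp: gpiece_iff pv.subspace_0 intro: homog_add homog_pscale pv.subspace_add pv.subspace_scale)

lemma gpiece_mono: "I \<subseteq> J \<Longrightarrow> gpiece d I \<subseteq> gpiece d J"
  by (auto simp: gpiece_def)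

lemma fin_dim_supported:
  assumes "finite U" shows "pv.fin_dim {p. keys p \<subseteq> U}"
  unfolding pv.fin_dim_def
proof (intro exI[of _ "(\<lambda>t. single t 1) ` U"] conjI subsetI)
  fix p :: "'a mpoly" assume p: "p \<in> {p. keys p \<subseteq> U}"
  have "p = (\<Sum>t\<in>keys p. pscale (lookup p t) (single t 1))"
    by (subst poly_eq_sum) (simp add: pscale_def const_def mult_single)
  also have "\<dots> \<in> pv.span ((\<lambda>t. single t 1) ` U)"
    by (intro pv.span_sum pv.span_scale pv.span_base) (use p in auto)
  finally show "p \<in> pv.span ((\<lambda>t. single t 1) ` U)" .
qed (use assms in simp)

lemma gpiece_polys: "gpiece d (polys m) = {p. keys p \<subseteq> {t\<in>mons m. tdeg t = d}}"
  by (auto simp: gpiece_def polys_iff homog_def)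

lemma fin_dim_gpiece: "I \<subseteq> polys m \<Longrightarrow> pv.fin_dim (gpiece d I)"
  by (rule pv.fin_dim_subset[OF fin_dim_supported[OF finite_mons_deg[of m d]]])
    (use gpiece_mono gpiece_polys in blast)

lemma subspace_supported: "pv.subspace {p. keys p \<subseteq> U}"
proof (rule pv.subspaceI)
  fix x y :: "'a mpoly"
  assume "x \<in> {p. keys p \<subseteq> U}" "y \<in> {p. keys p \<subseteq> U}"
  then show "x + y \<in> {p. keys p \<subseteq> U}" using Poly_Mapping.keys_add[of x y] by auto
next
  fix c and x :: "'a mpoly"
  assume "x \<in> {p. keys p \<subseteq> U}"
  then show "pscale c x \<in> {p. keys p \<subseteq> U}" by (auto simp: in_keys_iff subset_iff)
qed simp

definition lead :: "'k::field mpoly set \<Rightarrow> (nat \<Rightarrow>\<^sub>0 nat) set" where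
  "lead V = {Max (keys p) | p. p \<in> V \<and> p \<noteq> 0}"

text \<open>Induction on the largest monomial \<open>b\<close> allowed in the support. Taking the
  coefficient of \<open>b\<close> has rank 1 on \<open>V\<close> if \<open>b\<close> is a leading
  monomial and rank 0 otherwise, and the kernel consists of the polynomials of \<open>V\<close>
  supported on \<open>A\<close>.\<close>

lemma dim_eq_card_lead:
  fixes V :: "'k::field mpoly set"
  assumes "finite F" "pv.subspace V" "\<And>p. p \<in> V \<Longrightarrow> keys p \<subseteq> F"
  shows "pv.dim V = card (lead V) \<and> lead V \<subseteq> F"
  using assms
proof (induction F arbitrary: V rule: finite_linorder_max_induct)
  case empty
  then have V: "V \<subseteq> {0}" by force
  then have "lead V = {}" by (auto simp: lead_def)
  moreover have "pv.dim V = 0" using pv.dim_le_card[of V "{}"] V by simp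
  ultimately show ?case by simp
next
  case (insert b A)
  let ?P = "restr (\<lambda>t. t = b) :: 'k mpoly \<Rightarrow> 'k mpoly"
  let ?V = "{v\<in>V. ?P v = 0}"
  have fV: "pv.fin_dim V"
    by (rule pv.fin_dim_subset[OF fin_dim_supported[of "insert b A"]])
      (use insert.hyps(1) insert.prems(2) in blast)+
  have sV: "pv.subspace ?V"
    using insert.prems(1) unfolding pv.subspace_def by (auto simp: restr_add restr_pscale)
  have "keys p \<subseteq> A" if "p \<in> ?V" for p
    using that insert.prems(2)[of p] by (auto simp: restr_eq_0_iff)
  then have IH: "pv.dim ?V = card (lead ?V)" "lead ?V \<subseteq> A" using insert.IH[OF sV] by auto
  have rn: "pv.dim V = pv.dim ?V + pv.dim (?P ` V)"
    by (rule vector_space_pair.rank_nullity[OF vector_space_pair.intro[OF pv.vector_space_axioms pv.vector_space_axioms]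
      linear_restr insert.prems(1) fV])
  have bA: "b \<notin> A" using insert.hyps by auto
  show ?case
  proof (cases "\<exists>v\<in>V. b \<in> keys v")
    case False
    then have "?V = V" by (auto simp: restr_eq_0_iff)
    moreover have "?P ` V \<subseteq> {0}" using False by (auto simp: restr_eq_0_iff)
    then have "pv.dim (?P ` V) = 0" using pv.dim_le_card[of "?P ` V" "{}"] by simp
    ultimately show ?thesis using rn IH by auto
  next
    case True
    then obtain v where v: "v \<in> V" "b \<in> keys v" by blast
    have P: "?P p = pscale (lookup p b) (single b 1)" for p
      by (rule poly_mapping_eqI) (simp add: lookup_single when_def)
    have "pv.dim (?P ` V) = 1"
    proof (rule pv.dim_unique[of "{single b 1}"])
      have "single b 1 = ?P (pscale (inverse (lookup v b)) v)"
        using v(2) by (intro poly_mapping_eqI) (auto simp: lookup_single when_def in_keys_iff)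
      moreover have "pscale (inverse (lookup v b)) v \<in> V"
        using pv.subspace_scale insert.prems(1) v(1) by blast
      ultimately show "{single b 1} \<subseteq> ?P ` V" by blast
      show "?P ` V \<subseteq> pv.span {single b 1}"
        unfolding P by (auto intro: pv.span_scale pv.span_base)
      show "pv.independent {single b (1::'k)}"
        by (simp only: pv.dependent_single) (metis lookup_single_eq lookup_zero zero_neq_one)
    qed simp
    moreover have "lead V = insert b (lead ?V)"
    proof (intro equalityI subsetI)
      fix t assume "t \<in> lead V"
      then obtain p where p: "p \<in> V" "p \<noteq> 0" "t = Max (keys p)" by (auto simp: lead_def)
      show "t \<in> insert b (lead ?V)"
      proof (cases "b \<in> keys p")
        case True
        have "t = b" unfolding p(3)
          by (rule Max_eqI) (use True insert.prems(2)[OF p(1)] insert.hyps in force)+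
        then show ?thesis by simp
      next
        case False
        then have "p \<in> ?V" using p(1) by (auto simp: restr_eq_0_iff)
        then show ?thesis using p by (auto simp: lead_def)
      qed
    next
      fix t assume t: "t \<in> insert b (lead ?V)"
      have "b = Max (keys v)"
        by (rule Max_eqI[symmetric]) (use v insert.prems(2)[OF v(1)] insert.hyps in force)+
      moreover have "v \<noteq> 0" using v(2) by auto
      ultimately have "b \<in> lead V" using v(1) unfolding lead_def by blast
      moreover have "lead ?V \<subseteq> lead V" by (auto simp: lead_def)
      ultimately show "t \<in> lead V" using t by blast
    qed
    moreover have "finite (lead ?V)" "b \<notin> lead ?V" using IH(2) bA insert.hyps finite_subset by blast+
    ultimately show ?thesis using rn IH by auto
  qed
qed

lemma dim_supported:
  assumes "finite U" shows "pv.dim {p :: 'k::field mpoly. keys p \<subseteq> U} = card U"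
proof -
  let ?V = "{p :: 'k mpoly. keys p \<subseteq> U}"
  have "U \<subseteq> lead ?V"
  proof
    fix t assume t: "t \<in> U"
    have "t = Max (keys (single t (1::'k)))" by simp
    moreover have "single t (1::'k) \<in> ?V" "single t (1::'k) \<noteq> 0"
      using t by (auto, metis lookup_single_eq lookup_zero zero_neq_one)
    ultimately show "t \<in> lead ?V" unfolding lead_def by blast
  qed
  moreover have "pv.dim ?V = card (lead ?V) \<and> lead ?V \<subseteq> U"
    by (rule dim_eq_card_lead[OF assms subspace_supported]) auto
  ultimately show ?thesis by auto
qed

lemma hdim_polys: "hdim d (polys m :: 'k::field mpoly set) = card {t\<in>mons m. tdeg t = d}"
  unfolding hdim_def gpiece_polys by (rule dim_supported[OF finite_mons_deg])

lemma hdim_mono: "I \<subseteq> J \<Longrightarrow> J \<subseteq> polys m \<Longrightarrow> hdim d I \<le> hdim d J"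
  unfolding hdim_def by (rule pv.dim_le_of_subset[OF gpiece_mono fin_dim_gpiece])

text \<open>\<open>hilb\<close> subtracts natural numbers, but \<open>hdim\<close> never exceeds the
  number of monomials of the degree, so no information is lost.\<close>

lemma hilb_eq_iff:
  assumes "(I::'k::field mpoly set) \<subseteq> polys m" "J \<subseteq> polys m"
  shows "hilb m I = hilb m J \<longleftrightarrow> (\<forall>d. hdim d I = hdim d J)"
proof -
  have le: "hdim d I \<le> card {t\<in>mons m. tdeg t = d}" "hdim d J \<le> card {t\<in>mons m. tdeg t = d}" for d
    using hdim_mono[OF assms(1) subset_refl] hdim_mono[OF assms(2) subset_refl] by (simp_all add: hdim_polys)
  have "hilb m I d = hilb m J d \<longleftrightarrow> hdim d I = hdim d J" for d
    unfolding hilb_def hdim_def[symmetric] using le[of d] by arith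
  then show ?thesis by (simp add: fun_eq_iff)
qed

lemma is_ideal_polys: "is_ideal m I \<Longrightarrow> p \<in> I \<Longrightarrow> p \<in> polys m"
  and is_ideal_0: "is_ideal m I \<Longrightarrow> 0 \<in> I"
  and is_ideal_add: "is_ideal m I \<Longrightarrow> p \<in> I \<Longrightarrow> q \<in> I \<Longrightarrow> p + q \<in> I"
  and is_ideal_mult: "is_ideal m I \<Longrightarrow> p \<in> I \<Longrightarrow> r \<in> polys m \<Longrightarrow> r * p \<in> I"
  by (auto simp: is_ideal_def)

lemma is_ideal_pscale: "is_ideal m I \<Longrightarrow> p \<in> I \<Longrightarrow> pscale c p \<in> I"
  unfolding pscale_def const_def by (rule is_ideal_mult) simp_all

lemma is_ideal_uminus: "is_ideal m I \<Longrightarrow> p \<in> I \<Longrightarrow> - p \<in> I"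
  using is_ideal_pscale[of m I p "- 1"] by (simp add: pv.scale_minus_left)

lemma is_ideal_diff: "is_ideal m I \<Longrightarrow> p \<in> I \<Longrightarrow> q \<in> I \<Longrightarrow> p - q \<in> I"
  using is_ideal_add[of m I p "- q"] is_ideal_uminus[of m I q] by simp

lemma is_ideal_sum: "is_ideal m I \<Longrightarrow> (\<And>x. x \<in> A \<Longrightarrow> f x \<in> I) \<Longrightarrow> sum f A \<in> I"
  by (induction A rule: infinite_finite_induct) (auto intro: is_ideal_0 is_ideal_add)

lemma is_ideal_subspace: "is_ideal m I \<Longrightarrow> pv.subspace I"
  by (rule pv.subspaceI) (auto intro: is_ideal_0 is_ideal_add is_ideal_pscale)

lemma is_ideal_subset: "is_ideal m I \<Longrightarrow> I \<subseteq> polys m"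
  by (simp add: is_ideal_def)

lemma homog_ideal_ideal: "homog_ideal m I \<Longrightarrow> is_ideal m I"
  and homog_ideal_hcomp: "homog_ideal m I \<Longrightarrow> p \<in> I \<Longrightarrow> hcomp d p \<in> I"
  by (auto simp: homog_ideal_def)

lemma is_idealI:
  assumes "I \<subseteq> polys m" "0 \<in> I" "\<And>p q. p \<in> I \<Longrightarrow> q \<in> I \<Longrightarrow> p + q \<in> I"
    and "\<And>t c p. t \<in> mons m \<Longrightarrow> p \<in> I \<Longrightarrow> single t c * p \<in> I"
  shows "is_ideal m (I :: 'k::field mpoly set)"
  unfolding is_ideal_def
proof (intro conjI ballI)
  fix p q :: "'k mpoly" assume p: "p \<in> I" and q: "q \<in> polys m"
  have "finite A \<Longrightarrow> A \<subseteq> mons m \<Longrightarrow> (\<Sum>t\<in>A. single t (lookup q t)) * p \<in> I" for A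
    by (induction A rule: finite_induct) (use assms(2,3,4) p in \<open>auto simp: distrib_right\<close>)
  then show "q * p \<in> I" using poly_eq_sum[of q] q unfolding polys_def by (metis finite_keys mem_Collect_eq)
qed (use assms in auto)

lemma ideal_gen_subset: "G \<subseteq> ideal_gen m G"
  by (auto simp: ideal_gen_def)

lemma ideal_gen_minimal: "is_ideal m I \<Longrightarrow> G \<subseteq> I \<Longrightarrow> ideal_gen m G \<subseteq> I"
  by (auto simp: ideal_gen_def)

section \<open>Monomial ideals, pure powers and lex-plus-powers ideals\<close>

definition up_closed :: "nat \<Rightarrow> (nat \<Rightarrow>\<^sub>0 nat) set \<Rightarrow> bool" where
  "up_closed m U \<longleftrightarrow> (\<forall>t\<in>U. \<forall>i<m. t + xv i \<in> U)"

lemma up_closed_add: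
  assumes "up_closed m U" "t \<in> U" "s \<in> mons m" shows "s + t \<in> U"
  using assms(3)
proof (induction "tdeg s" arbitrary: s)
  case 0 then show ?case using assms(2) by simp
next
  case (Suc k)
  then have "s \<noteq> 0" by auto
  then obtain i where i: "i \<in> keys s" by (metis keys_eq_empty ex_in_conv)
  have s: "s = (s - xv i) + xv i" by (rule split_off_variable[OF i])
  have im: "i < m" using i Suc.prems by (simp add: mons_def)
  have "tdeg s = tdeg (s - xv i) + 1" using arg_cong[OF s, of tdeg] by simp
  moreover have "s - xv i \<in> mons m" using Suc.prems s mons_add_iff by metis
  ultimately have "(s - xv i) + t \<in> U" using Suc.hyps by simp
  then have "(s - xv i) + t + xv i \<in> U" using assms(1) im by (simp add: up_closed_def)
  then show ?case using s by (metis add.assoc add.commute)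
qed

definition monomial_ideal :: "nat \<Rightarrow> (nat \<Rightarrow>\<^sub>0 nat) set \<Rightarrow> 'k::field mpoly set" where
  "monomial_ideal m U = {p\<in>polys m. keys p \<subseteq> U}"

lemma homog_monomial_ideal:
  assumes "up_closed m U" shows "homog_ideal m (monomial_ideal m U)"
  unfolding homog_ideal_def
proof (intro conjI ballI allI)
  show "is_ideal m (monomial_ideal m U :: 'a mpoly set)"
  proof (rule is_idealI)
    fix p q :: "'a mpoly" assume "p \<in> monomial_ideal m U" "q \<in> monomial_ideal m U"
    then show "p + q \<in> monomial_ideal m U"
      using Poly_Mapping.keys_add[of p q] by (auto simp: monomial_ideal_def intro: polys_add)
  next
    fix t c and p :: "'a mpoly" assume t: "t \<in> mons m" and p: "p \<in> monomial_ideal m U"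
    have "u \<in> U" if u: "u \<in> keys (single t c * p)" for u
    proof -
      obtain v where "u = t + v" "v \<in> keys p" by (rule keys_single_mult[OF u])
      then show ?thesis using up_closed_add[OF assms _ t] p by (auto simp: monomial_ideal_def)
    qed
    then show "single t c * p \<in> monomial_ideal m U"
      using p t by (auto simp: monomial_ideal_def intro!: polys_mult)
  qed (auto simp: monomial_ideal_def)
  fix p :: "'a mpoly" and d assume "p \<in> monomial_ideal m U"
  then show "hcomp d p \<in> monomial_ideal m U"
    by (auto simp: monomial_ideal_def hcomp_restr keys_restr intro: polys_restr)
qed

lemma gpiece_monomial_ideal:
  "gpiece d (monomial_ideal m U) = {p. keys p \<subseteq> {t\<in>U. t \<in> mons m \<and> tdeg t = d}}"
  by (auto simp: gpiece_def monomial_ideal_def polys_iff homog_def)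

lemma hdim_monomial_ideal: "hdim d (monomial_ideal m U :: 'k::field mpoly set) = card {t\<in>U. t \<in> mons m \<and> tdeg t = d}"
  unfolding hdim_def gpiece_monomial_ideal
  by (rule dim_supported, rule finite_subset[OF _ finite_mons_deg[of m d]]) auto

lemma single_monomial_ideal:
  "single t (1::'k::field) \<in> monomial_ideal m U \<longleftrightarrow> t \<in> U \<and> t \<in> mons m"
  by (auto simp: monomial_ideal_def)

lemma monomial_ideal_subset:
  assumes "is_ideal m I" "\<And>t. t \<in> U \<Longrightarrow> t \<in> mons m \<Longrightarrow> single t (1::'k::field) \<in> I"
  shows "monomial_ideal m U \<subseteq> I"
proof
  fix p :: "'k mpoly" assume p: "p \<in> monomial_ideal m U"
  have "p = (\<Sum>t\<in>keys p. pscale (lookup p t) (single t 1))"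
    by (subst poly_eq_sum) (simp add: pscale_def const_def mult_single)
  also have "\<dots> \<in> I"
    by (intro is_ideal_sum[OF assms(1)] is_ideal_pscale[OF assms(1)] assms(2))
      (use p in \<open>auto simp: monomial_ideal_def polys_iff\<close>)
  finally show "p \<in> I" .
qed

definition pow_mons :: "nat \<Rightarrow> nat list \<Rightarrow> (nat \<Rightarrow>\<^sub>0 nat) set" where
  "pow_mons m es = {t\<in>mons m. \<exists>i<length es. es ! i \<le> lookup t i}"

definition cap_mons :: "nat \<Rightarrow> nat list \<Rightarrow> nat \<Rightarrow> (nat \<Rightarrow>\<^sub>0 nat) set" where
  "cap_mons m es d = {t\<in>mons m. t \<notin> pow_mons m es \<and> tdeg t = d}"

lemma up_closed_pow_mons: "up_closed m (pow_mons m es)"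
  unfolding up_closed_def pow_mons_def
  by (auto simp: mons_single_iff lookup_add intro: trans_le_add1)

lemma var_power: "var i ^ k = single (single i k) (1::'k::field)"
  by (induction k) (simp_all add: var_def mult_single single_add[symmetric])

lemma pow_ideal_eq:
  assumes "length es \<le> m"
  shows "(pow_ideal m es :: 'k::field mpoly set) = monomial_ideal m (pow_mons m es)"
proof
  let ?G = "{var i ^ (es ! i) | i. i < length es} :: 'k mpoly set"
  have "?G \<subseteq> monomial_ideal m (pow_mons m es)"
    using assms by (auto simp: var_power single_monomial_ideal pow_mons_def mons_single_iff)
      (metis le_refl lookup_single_eq)
  then show "(pow_ideal m es :: 'k mpoly set) \<subseteq> monomial_ideal m (pow_mons m es)"
    unfolding pow_ideal_def
    by (rule ideal_gen_minimal[OF homog_ideal_ideal[OF homog_monomial_ideal[OF up_closed_pow_mons]]])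
  show "monomial_ideal m (pow_mons m es) \<subseteq> (pow_ideal m es :: 'k mpoly set)"
    unfolding pow_ideal_def ideal_gen_def
  proof (rule Inter_greatest)
    fix I :: "'k mpoly set" assume "I \<in> {I. is_ideal m I \<and> ?G \<subseteq> I}"
    then have I: "is_ideal m I" "?G \<subseteq> I" by auto
    show "monomial_ideal m (pow_mons m es) \<subseteq> I"
    proof (rule monomial_ideal_subset[OF I(1)])
      fix t assume t: "t \<in> pow_mons m es" "t \<in> mons m"
      then obtain i where i: "i < length es" "es ! i \<le> lookup t i" by (auto simp: pow_mons_def)
      have e: "t = single i (es ! i) + (t - single i (es ! i))"
        by (rule monomial_eq_add) (metis i(2) le0 lookup_single_eq lookup_single_not_eq)
      then have "t - single i (es ! i) \<in> mons m" using t(2) mons_add_iff by metis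
      moreover have "var i ^ (es ! i) \<in> I" using i(1) I(2) by blast
      ultimately have "single (t - single i (es ! i)) 1 * var i ^ (es ! i) \<in> I"
        by (intro is_ideal_mult[OF I(1)]) simp_all
      then show "single t 1 \<in> I" using e by (simp add: var_power mult_single add.commute)
    qed
  qed
qed

text \<open>A lex ideal is spanned by its monomials, and so is the ideal of pure powers; their sum
  is described by the union of the two monomial sets, and all later statements about it become
  combinatorial.\<close>

lemma lex_plus_powers_eq:
  fixes L :: "'k::field mpoly set"
  assumes "length es \<le> m" and L: "lex_ideal m L"
  shows "ideal_gen m (L \<union> pow_ideal m es) = monomial_ideal m ({t\<in>mons m. single t 1 \<in> L} \<union> pow_mons m es)"
    and "up_closed m ({t\<in>mons m. single t 1 \<in> L} \<union> pow_mons m es)"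
proof -
  have I: "is_ideal m L" using L by (simp add: lex_ideal_def)
  have "t + xv i \<in> mons m \<and> single (t + xv i) 1 \<in> L"
    if "t \<in> mons m" "single t 1 \<in> L" "i < m" for t i
  proof -
    have "single (xv i) 1 * single t 1 \<in> L"
      using that by (intro is_ideal_mult[OF I]) (simp_all add: mons_single_iff)
    then show ?thesis using that by (simp add: mult_single mons_single_iff add.commute)
  qed
  then show up: "up_closed m ({t\<in>mons m. single t 1 \<in> L} \<union> pow_mons m es)"
    using up_closed_pow_mons[of m es] unfolding up_closed_def by blast
  show "ideal_gen m (L \<union> pow_ideal m es) = monomial_ideal m ({t\<in>mons m. single t 1 \<in> L} \<union> pow_mons m es)"
  proof
    have "L \<subseteq> monomial_ideal m {t\<in>mons m. single t 1 \<in> L}"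
    proof
      fix p assume p: "p \<in> L"
      then have "p \<in> polys m" using is_ideal_polys[OF I] by blast
      moreover then have "\<forall>t\<in>keys p. single t 1 \<in> L"
        using p L unfolding lex_ideal_def by blast
      ultimately show "p \<in> monomial_ideal m {t\<in>mons m. single t 1 \<in> L}"
        by (auto simp: monomial_ideal_def polys_iff)
    qed
    then show "ideal_gen m (L \<union> pow_ideal m es) \<subseteq> monomial_ideal m ({t\<in>mons m. single t 1 \<in> L} \<union> pow_mons m es)"
      unfolding pow_ideal_eq[OF assms(1)]
      by (intro ideal_gen_minimal[OF homog_ideal_ideal[OF homog_monomial_ideal[OF up]]])
        (auto simp: monomial_ideal_def)
    show "monomial_ideal m ({t\<in>mons m. single t 1 \<in> L} \<union> pow_mons m es) \<subseteq> ideal_gen m (L \<union> pow_ideal m es)"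
      unfolding ideal_gen_def
    proof (rule Inter_greatest)
      fix J assume "J \<in> {I. is_ideal m I \<and> L \<union> pow_ideal m es \<subseteq> I}"
      then have J: "is_ideal m J" "L \<subseteq> J" "monomial_ideal m (pow_mons m es) \<subseteq> J"
        unfolding pow_ideal_eq[OF assms(1)] by auto
      show "monomial_ideal m ({t\<in>mons m. single t 1 \<in> L} \<union> pow_mons m es) \<subseteq> J"
      proof (rule monomial_ideal_subset[OF J(1)])
        fix t assume "t \<in> {t\<in>mons m. single t 1 \<in> L} \<union> pow_mons m es" "t \<in> mons m"
        then show "single t 1 \<in> J" using J(2,3) single_monomial_ideal[of t m "pow_mons m es"] by blast
      qed
    qed
  qed
qed

text \<open>Variables without a prescribed power get a finite cap as well. The summand
  \<open>d + 2\<close> keeps it out of reach of monomials of degree at most \<open>d + 1\<close>,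
  which is all that a shadow from degree \<open>d\<close> involves; the summand
  \<open>sum_list es\<close> makes it at least every prescribed exponent, so the caps remain
  increasing.\<close>

definition caps :: "nat list \<Rightarrow> nat \<Rightarrow> nat \<Rightarrow> nat" where
  "caps es d i = (if i < length es then es ! i else sum_list es + d + 2)"

lemma caps_mono: "sorted es \<Longrightarrow> i < j \<Longrightarrow> caps es d i \<le> caps es d j"
  unfolding caps_def using sorted_nth_mono[of es i j] elem_le_sum_list[of i es] by auto

lemma cdeg_caps:
  assumes "length es \<le> m" "n \<le> Suc d"
  shows "cdeg {..<m} (caps es d) n = cap_mons m es n"
proof -
  have "lookup t i < caps es d i" if "\<not> i < length es" "tdeg t = n" for t i
    using that assms(2) lookup_le_tdeg[of t i] by (simp add: caps_def)
  then show ?thesis using assms(1)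
    by (auto simp: cdeg_def capped_def cap_mons_def pow_mons_def mons_iff caps_def not_le)
qed

definition up :: "nat \<Rightarrow> nat list \<Rightarrow> (nat \<Rightarrow>\<^sub>0 nat) set \<Rightarrow> (nat \<Rightarrow>\<^sub>0 nat) set" where
  "up m es S = {t\<in>mons m. t \<notin> pow_mons m es \<and> (\<exists>s\<in>S. \<exists>i<m. t = s + xv i)}"

lemma finite_cap_mons: "finite (cap_mons m es d)"
  by (rule finite_subset[OF _ finite_mons_deg[of m d]]) (auto simp: cap_mons_def)

lemma up_cap_mons: "S \<subseteq> cap_mons m es d \<Longrightarrow> up m es S \<subseteq> cap_mons m es (Suc d)"
  by (auto simp: up_def cap_mons_def)

lemma shadow_caps:
  assumes "length es \<le> m" "S \<subseteq> cap_mons m es d"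
  shows "shadow {..<m} (caps es d) S = up m es S"
proof -
  have "shadow {..<m} (caps es d) S \<subseteq> cap_mons m es (Suc d)"
    using shadow_cdeg[of S "{..<m}" "caps es d" d] cdeg_caps[OF assms(1)] assms(2) by simp
  moreover have "cap_mons m es (Suc d) \<subseteq> capped {..<m} (caps es d)"
    using cdeg_caps[OF assms(1), of "Suc d" d] by (auto simp: cdeg_def)
  ultimately show ?thesis using up_cap_mons[OF assms(2)]
    unfolding shadow_def up_def cap_mons_def by (auto 4 3)
qed

lemma segment_up:
  assumes "length es \<le> m" "segment (cap_mons m es d) T"
  shows "segment (cap_mons m es (Suc d)) (up m es T)"
  using segment_shadow[of "{..<m}" "caps es d" d T] cdeg_caps[OF assms(1), of d d]
    cdeg_caps[OF assms(1), of "Suc d" d] shadow_caps[OF assms(1), of T d] assms(2)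
  by (simp add: segment_def)

lemma minimal_shadowsD:
  "minimal_shadows V e \<Longrightarrow> S \<subseteq> cdeg V e d \<Longrightarrow> segment (cdeg V e d) T \<Longrightarrow> card T = card S
    \<Longrightarrow> card (shadow V e T) \<le> card (shadow V e S)"
  by (simp add: minimal_shadows_def)

lemma card_up_le:
  assumes es: "length es \<le> m" "sorted es" and S: "S \<subseteq> cap_mons m es d" and T: "segment (cap_mons m es d) T"
    and card: "card T = card S"
  shows "card (up m es T) \<le> card (up m es S)"
proof -
  have "minimal_shadows {..<m} (caps es d)"
    by (rule clements_lindstroem) (use caps_mono[OF es(2)] in auto)
  then have "card (shadow {..<m} (caps es d) T) \<le> card (shadow {..<m} (caps es d) S)"
    by (rule minimal_shadowsD[where d=d]) (use S T card cdeg_caps[OF es(1), of d d] in simp_all)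
  then show ?thesis using shadow_caps[OF es(1)] S T by (simp add: segment_def)
qed

section \<open>Hilbert functions of lex-plus-powers ideals\<close>

lemma mons_split: "{t\<in>mons m. tdeg t = d} = {t\<in>pow_mons m es. tdeg t = d} \<union> cap_mons m es d"
  by (auto simp: cap_mons_def pow_mons_def)

lemma card_mons_split: "card {t\<in>mons m. tdeg t = d} = card {t\<in>pow_mons m es. tdeg t = d} + card (cap_mons m es d)"
proof -
  have "finite {t\<in>pow_mons m es. tdeg t = d}"
    by (rule finite_subset[OF _ finite_mons_deg[of m d]]) (auto simp: pow_mons_def)
  then show ?thesis unfolding mons_split[of m d es] using finite_cap_mons[of m es d]
    by (subst card_Un_disjoint) (auto simp: cap_mons_def)
qed

text \<open>\<open>lpp_growth m es h\<close> holds iff \<open>h d\<close> is the dimension of the degree \<open>d\<close> part of some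
  lex-plus-powers ideal; \<open>lex_part m es h d\<close> then consists of the monomials of that ideal
  that do not lie in the ideal of pure powers.\<close>

definition lex_part :: "nat \<Rightarrow> nat list \<Rightarrow> (nat \<Rightarrow> nat) \<Rightarrow> nat \<Rightarrow> (nat \<Rightarrow>\<^sub>0 nat) set" where
  "lex_part m es h d = (SOME T. segment (cap_mons m es d) T \<and> card T = h d - card {t\<in>pow_mons m es. tdeg t = d})"

definition lpp_growth :: "nat \<Rightarrow> nat list \<Rightarrow> (nat \<Rightarrow> nat) \<Rightarrow> bool" where
  "lpp_growth m es h \<longleftrightarrow> (\<forall>d. card {t\<in>pow_mons m es. tdeg t = d} \<le> h d \<and> h d \<le> card {t\<in>mons m. tdeg t = d}
     \<and> up m es (lex_part m es h d) \<subseteq> lex_part m es h (Suc d))"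

lemma lex_part:
  assumes "h d \<le> card {t\<in>mons m. tdeg t = d}"
  shows "segment (cap_mons m es d) (lex_part m es h d)"
    and "card (lex_part m es h d) = h d - card {t\<in>pow_mons m es. tdeg t = d}"
proof -
  have "\<exists>T. segment (cap_mons m es d) T \<and> card T = h d - card {t\<in>pow_mons m es. tdeg t = d}"
    by (rule segment_exists[OF finite_cap_mons]) (use assms card_mons_split[of m d es] in simp)
  then have "segment (cap_mons m es d) (lex_part m es h d) \<and>
     card (lex_part m es h d) = h d - card {t\<in>pow_mons m es. tdeg t = d}"
    unfolding lex_part_def by (rule someI_ex)
  then show "segment (cap_mons m es d) (lex_part m es h d)"
    "card (lex_part m es h d) = h d - card {t\<in>pow_mons m es. tdeg t = d}" by auto
qed

lemma Max_keys_var_mult: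
  fixes p :: "'k::field mpoly"
  assumes "p \<noteq> 0"
  shows "var i * p \<noteq> 0" "Max (keys (var i * p)) = Max (keys p) + xv i"
proof -
  have k: "keys (var i * p) = (\<lambda>t. t + xv i) ` keys p"
  proof (intro equalityI subsetI)
    fix t assume "t \<in> keys (var i * p)"
    then have t: "t \<in> keys (single (xv i) 1 * p)" by (simp add: var_def)
    obtain u where "t = xv i + u" "u \<in> keys p" by (rule keys_single_mult[OF t])
    then show "t \<in> (\<lambda>t. t + xv i) ` keys p" by (auto simp: add.commute)
  next
    fix t assume "t \<in> (\<lambda>t. t + xv i) ` keys p"
    then obtain u where "t = xv i + u" "u \<in> keys p" by (auto simp: add.commute)
    then show "t \<in> keys (var i * p)"
      using lookup_single_mult_add[of "xv i" 1 p u] by (simp add: in_keys_iff var_def)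
  qed
  have ne: "keys p \<noteq> {}" using assms by simp
  then show "var i * p \<noteq> 0" using k by (metis image_is_empty keys_zero)
  show "Max (keys (var i * p)) = Max (keys p) + xv i"
    unfolding k by (rule mono_Max_commute[symmetric]) (use ne in \<open>auto simp: mono_def\<close>)
qed

text \<open>The leading monomials outside the pure powers are closed under multiplication by
  variables. By Clements-Lindstroem the segment of the same size in degree \<open>d\<close> has a
  shadow no larger than theirs, so it fits by size into the segment of degree \<open>d + 1\<close>.
  Both are segments, which turns the comparison of sizes into an inclusion.\<close>

lemma homog_ideal_lpp_growth:
  fixes I :: "'k::field mpoly set"
  assumes es: "length es \<le> m" "sorted es" and I: "homog_ideal m I" "pow_ideal m es \<subseteq> I"
  shows "lpp_growth m es (\<lambda>d. hdim d I)"
  unfolding lpp_growth_def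
proof (intro allI conjI)
  have ideal: "is_ideal m I" using homog_ideal_ideal[OF I(1)] .
  fix d
  have ld: "hdim d I = card (lead (gpiece d I))" "lead (gpiece d I) \<subseteq> {t\<in>mons m. tdeg t = d}" for d
  proof -
    have "hdim d I = card (lead (gpiece d I)) \<and> lead (gpiece d I) \<subseteq> {t\<in>mons m. tdeg t = d}"
      unfolding hdim_def
    proof (rule dim_eq_card_lead[OF finite_mons_deg])
      show "pv.subspace (gpiece d I)" by (rule subspace_gpiece[OF is_ideal_subspace[OF ideal]])
      show "keys p \<subseteq> {t\<in>mons m. tdeg t = d}" if "p \<in> gpiece d I" for p
        using that is_ideal_subset[OF ideal] by (auto simp: gpiece_def polys_iff homog_def)
    qed
    then show "hdim d I = card (lead (gpiece d I))" "lead (gpiece d I) \<subseteq> {t\<in>mons m. tdeg t = d}" by auto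
  qed
  have fl: "finite (lead (gpiece d I))" for d using ld(2) finite_mons_deg finite_subset by metis
  have bl: "{t\<in>pow_mons m es. tdeg t = d} \<subseteq> lead (gpiece d I)" for d
  proof
    fix t assume t: "t \<in> {t\<in>pow_mons m es. tdeg t = d}"
    then have "single t (1::'k) \<in> I"
      using I(2) single_monomial_ideal[of t m "pow_mons m es"] unfolding pow_ideal_eq[OF es(1)] by (auto simp: pow_mons_def)
    then have "single t (1::'k) \<in> gpiece d I" using t by (simp add: gpiece_def)
    moreover have "single t (1::'k) \<noteq> 0" by (metis lookup_single_eq lookup_zero zero_neq_one)
    moreover have "t = Max (keys (single t (1::'k)))" by simp
    ultimately show "t \<in> lead (gpiece d I)" unfolding lead_def by blast
  qed
  show b: "card {t\<in>pow_mons m es. tdeg t = d} \<le> hdim d I" unfolding ld(1) by (rule card_mono[OF fl bl])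
  have a: "hdim d I \<le> card {t\<in>mons m. tdeg t = d}" for d
    unfolding ld(1) by (rule card_mono[OF finite_mons_deg ld(2)])
  then show "hdim d I \<le> card {t\<in>mons m. tdeg t = d}" .
  let ?S = "\<lambda>d. lead (gpiece d I) \<inter> cap_mons m es d"
  let ?T = "lex_part m es (\<lambda>d. hdim d I)"
  have cS: "card (?S d) = hdim d I - card {t\<in>pow_mons m es. tdeg t = d}" for d
  proof -
    have "?S d = lead (gpiece d I) - {t\<in>pow_mons m es. tdeg t = d}" using ld(2)[of d] by (auto simp: cap_mons_def)
    then show ?thesis using ld(1) bl[of d] by (simp add: card_Diff_subset finite_subset[OF bl fl])
  qed
  have seg: "segment (cap_mons m es d) (?T d)" "card (?T d) = card (?S d)" for d
    using lex_part[of "\<lambda>d. hdim d I" d m es, OF a] cS by auto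
  have "up m es (?S d) \<subseteq> ?S (Suc d)"
  proof
    fix t assume t: "t \<in> up m es (?S d)"
    then have tg: "t \<in> cap_mons m es (Suc d)" using up_cap_mons[of "?S d"] by blast
    from t obtain s i where s: "s \<in> lead (gpiece d I)" "i < m" "t = s + xv i" by (auto simp: up_def)
    then obtain p where p: "p \<in> gpiece d I" "p \<noteq> 0" "s = Max (keys p)" by (auto simp: lead_def)
    have "var i * p \<in> gpiece (Suc d) I"
      using is_ideal_mult[OF ideal _ polys_var[OF s(2)], of p] homog_mult[OF homog_var, of d p i] p(1)
      by (simp add: gpiece_def)
    then have "t \<in> lead (gpiece (Suc d) I)"
      unfolding lead_def using Max_keys_var_mult[OF p(2), of i] p(3) s(3) by (metis (mono_tags, lifting) mem_Collect_eq)
    then show "t \<in> ?S (Suc d)" using tg by blast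
  qed
  then have "card (up m es (?S d)) \<le> card (?S (Suc d))"
    by (rule card_mono[rotated]) (use finite_cap_mons in blast)
  moreover have "card (up m es (?T d)) \<le> card (up m es (?S d))"
    by (rule card_up_le[OF es _ seg]) blast
  ultimately have "card (up m es (?T d)) \<le> card (?T (Suc d))" using seg(2)[of "Suc d"] by simp
  then show "up m es (?T d) \<subseteq> ?T (Suc d)"
    by (rule segment_subset[OF segment_up[OF es(1) seg(1)] seg(1) finite_cap_mons])
qed

text \<open>\<open>EGH\<close> yields an ideal containing the pure powers with the same Hilbert
  function, and the growth condition sees only that function. In this numerical form the property is
  used from here on.\<close>

lemma EGH_lpp_growth:
  fixes I :: "'k::field mpoly set"
  assumes "length es \<le> m" "sorted es" "EGH m gs es" "homog_ideal m I" "ideal_gen m (set gs) \<subseteq> I"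
  shows "lpp_growth m es (\<lambda>d. hdim d I)"
proof -
  obtain I' :: "'k mpoly set" where I': "homog_ideal m I'" "pow_ideal m es \<subseteq> I'" "hilb m I' = hilb m I"
    using assms(3-5) unfolding EGH_def by blast
  have "hdim d I' = hdim d I" for d
    using I'(3) hilb_eq_iff[OF is_ideal_subset[OF homog_ideal_ideal[OF I'(1)]]
      is_ideal_subset[OF homog_ideal_ideal[OF assms(4)]]] by simp
  then show ?thesis using homog_ideal_lpp_growth[OF assms(1,2) I'(1,2)] by simp
qed

definition lpp_mons :: "nat \<Rightarrow> nat list \<Rightarrow> (nat \<Rightarrow> nat) \<Rightarrow> (nat \<Rightarrow>\<^sub>0 nat) set" where
  "lpp_mons m es h = pow_mons m es \<union> (\<Union>d. lex_part m es h d)"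

lemma lpp_mons_cap_mons:
  assumes "lpp_growth m es h" shows "lpp_mons m es h \<inter> cap_mons m es d = lex_part m es h d"
proof -
  have sub: "lex_part m es h b \<subseteq> cap_mons m es b" for b
    using lex_part(1)[of h b m es] assms by (simp add: lpp_growth_def segment_def)
  show ?thesis
  proof (intro equalityI subsetI)
    fix t assume t: "t \<in> lpp_mons m es h \<inter> cap_mons m es d"
    then obtain b where b: "t \<in> lex_part m es h b" by (auto simp: lpp_mons_def cap_mons_def)
    then have "t \<in> cap_mons m es b" using sub by blast
    then have "b = d" using t by (simp add: cap_mons_def)
    then show "t \<in> lex_part m es h d" using b by simp
  next
    fix t assume "t \<in> lex_part m es h d"
    then show "t \<in> lpp_mons m es h \<inter> cap_mons m es d" using sub unfolding lpp_mons_def by blast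
  qed
qed

lemma lpp_mons_mons:
  assumes "lpp_growth m es h" shows "lpp_mons m es h \<subseteq> mons m"
proof -
  have "lex_part m es h b \<subseteq> cap_mons m es b" for b
    using lex_part(1)[of h b m es] assms by (simp add: lpp_growth_def segment_def)
  moreover have "cap_mons m es b \<subseteq> mons m" for b by (auto simp: cap_mons_def)
  moreover have "pow_mons m es \<subseteq> mons m" by (auto simp: pow_mons_def)
  ultimately show ?thesis unfolding lpp_mons_def by blast
qed

lemma up_closed_lpp_mons:
  assumes "lpp_growth m es h" shows "up_closed m (lpp_mons m es h)"
  unfolding up_closed_def
proof (intro ballI allI impI)
  fix t i assume t: "t \<in> lpp_mons m es h" and i: "i < m"
  show "t + xv i \<in> lpp_mons m es h"
  proof (cases "t + xv i \<in> pow_mons m es")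
    case False
    then have "t \<notin> pow_mons m es" using up_closed_pow_mons[of m es] i unfolding up_closed_def by blast
    then obtain d where "t \<in> lex_part m es h d" using t by (auto simp: lpp_mons_def)
    moreover have "t + xv i \<in> mons m" using lpp_mons_mons[OF assms] t i by (auto simp: mons_single_iff)
    ultimately have "t + xv i \<in> up m es (lex_part m es h d)" using False i by (auto simp: up_def)
    then show ?thesis using assms unfolding lpp_growth_def lpp_mons_def by blast
  qed (simp add: lpp_mons_def)
qed

lemma card_lpp_mons:
  assumes "lpp_growth m es h" shows "card {t\<in>lpp_mons m es h. t \<in> mons m \<and> tdeg t = d} = h d"
proof -
  have g: "h d \<le> card {t\<in>mons m. tdeg t = d}" "card {t\<in>pow_mons m es. tdeg t = d} \<le> h d"
    using assms by (auto simp: lpp_growth_def)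
  have "{t\<in>lpp_mons m es h. t \<in> mons m \<and> tdeg t = d} = {t\<in>pow_mons m es. tdeg t = d} \<union> lex_part m es h d"
    unfolding lpp_mons_cap_mons[OF assms, symmetric] using lpp_mons_mons[OF assms]
    by (auto simp: cap_mons_def lpp_mons_def pow_mons_def)
  moreover have "finite {t\<in>pow_mons m es. tdeg t = d}"
    by (rule finite_subset[OF _ finite_mons_deg[of m d]]) (auto simp: pow_mons_def)
  moreover have "finite (lex_part m es h d)" "{t\<in>pow_mons m es. tdeg t = d} \<inter> lex_part m es h d = {}"
    unfolding lpp_mons_cap_mons[OF assms, symmetric] using finite_cap_mons by (auto simp: cap_mons_def)
  ultimately show ?thesis using lex_part(2)[of h d m es, OF g(1)] g(2) by (simp add: card_Un_disjoint)
qed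

lemma hdim_lpp:
  "lpp_growth m es h \<Longrightarrow> hdim d (monomial_ideal m (lpp_mons m es h) :: 'k::field mpoly set) = h d"
  by (simp add: hdim_monomial_ideal card_lpp_mons)

lemma lpp_growth_lex:
  assumes es: "length es \<le> m" and g: "lpp_growth m es h"
  shows "\<exists>L::'k::field mpoly set. lex_ideal m L \<and>
    ideal_gen m (L \<union> pow_ideal m es) = monomial_ideal m (lpp_mons m es h)"
proof -
  let ?U = "lpp_mons m es h"
  \<comment> \<open>The segments \<open>lex_part\<close> skip the monomials of the pure power ideal,
    so their union is not a lex segment. \<open>A\<close> fills these gaps: it is closed upwards in
    each degree by construction, and it differs from \<open>lpp_mons\<close> only in monomials of
    the pure power ideal.\<close>
  define A where "A = {t\<in>mons m. \<forall>v\<in>cap_mons m es (tdeg t). t \<le> v \<longrightarrow> v \<in> ?U}"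
  have seg: "segment (cap_mons m es d) (?U \<inter> cap_mons m es d)" for d
    unfolding lpp_mons_cap_mons[OF g] by (rule lex_part(1)) (use g in \<open>simp add: lpp_growth_def\<close>)
  have up: "up_closed m A"
    unfolding up_closed_def
  proof (intro ballI allI impI)
    fix t i assume t: "t \<in> A" and i: "i < m"
    have "v \<in> ?U" if v: "v \<in> cap_mons m es (Suc (tdeg t))" "t + xv i \<le> v" for v
    proof -
      let ?e = "caps es (Suc (tdeg t))"
      have "v \<in> capped {..<m} ?e" "tdeg v = Suc (tdeg t)"
        using v(1) cdeg_caps[OF es, of "Suc (tdeg t)" "Suc (tdeg t)"] by (auto simp: cdeg_def)
      then obtain u j where u: "v = u + xv j" "u \<in> cdeg {..<m} ?e (tdeg t)" "j \<in> {..<m}"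
        "\<forall>k\<in>keys v. k \<le> j"
        by (rule split_off_last)
      have ug: "u \<in> cap_mons m es (tdeg t)" using u(2) cdeg_caps[OF es, of "tdeg t" "Suc (tdeg t)"] by simp
      have "t \<le> u" by (rule remove_last_le[of t i u j]) (use v(2) u ug in \<open>auto simp: cap_mons_def\<close>)
      then have "u \<in> ?U" using t ug by (simp add: A_def)
      then show ?thesis using up_closed_lpp_mons[OF g] u(1,3) by (simp add: up_closed_def)
    qed
    then show "t + xv i \<in> A" using t i by (simp add: A_def mons_single_iff)
  qed
  let ?L = "monomial_ideal m A :: 'k mpoly set"
  have AL: "{t\<in>mons m. single t (1::'k) \<in> ?L} = A"
    by (auto simp: single_monomial_ideal A_def)
  have lex: "lex_ideal m ?L"
    unfolding lex_ideal_def
  proof (intro conjI ballI impI)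
    show "is_ideal m ?L" using homog_ideal_ideal[OF homog_monomial_ideal[OF up]] .
    show "(p \<in> ?L) = (\<forall>t\<in>keys p. single t 1 \<in> ?L)" if "p \<in> polys m" for p
      using that by (auto simp: monomial_ideal_def polys_iff)
    fix t u assume t: "t \<in> mons m" and u: "u \<in> mons m"
      and h: "tdeg t = tdeg u \<and> lex_gt t u \<and> single u 1 \<in> ?L"
    then have "u \<in> A" "u \<le> t" by (auto simp: single_monomial_ideal lex_gt_iff)
    then have "t \<in> A" using t h unfolding A_def by (auto dest: order_trans)
    then show "single t 1 \<in> ?L" using t by (simp add: single_monomial_ideal)
  qed
  have "A \<union> pow_mons m es = ?U"
  proof (intro equalityI subsetI)
    fix t assume "t \<in> A \<union> pow_mons m es"
    then consider "t \<in> pow_mons m es" | "t \<in> A" "t \<in> cap_mons m es (tdeg t)" by (auto simp: A_def cap_mons_def)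
    then show "t \<in> ?U" by cases (auto simp: lpp_mons_def A_def)
  next
    fix t assume t: "t \<in> ?U"
    show "t \<in> A \<union> pow_mons m es"
    proof (cases "t \<in> pow_mons m es")
      case False
      have tm: "t \<in> mons m" using t lpp_mons_mons[OF g] by blast
      then have "t \<in> ?U \<inter> cap_mons m es (tdeg t)" using t False by (simp add: cap_mons_def)
      then have "v \<in> ?U" if "v \<in> cap_mons m es (tdeg t)" "t \<le> v" for v
        using segmentD[OF seg _ that] by blast
      then show ?thesis using tm by (simp add: A_def)
    qed simp
  qed
  then show ?thesis using lex lex_plus_powers_eq(1)[OF es lex] AL by auto
qed

section \<open>Initial components with respect to the last variable\<close>

definition zcomp :: "nat \<Rightarrow> nat \<Rightarrow> 'k::field mpoly \<Rightarrow> 'k mpoly" where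
  "zcomp m k = restr (\<lambda>t. lookup t m = k)"

definition zgraded :: "nat \<Rightarrow> 'k::field mpoly set \<Rightarrow> bool" where
  "zgraded m I \<longleftrightarrow> (\<forall>p\<in>I. \<forall>k. zcomp m k p \<in> I)"

text \<open>The component of lowest, not highest, exponent is taken as initial. Exponent 0 has
  nothing below it, which is why the restriction to \<open>x_m = 0\<close> survives unchanged
  (\<open>trunc_init\<close>). Imposing the condition on each component separately makes the set
  graded in \<open>x_m\<close>.\<close>

definition init :: "nat \<Rightarrow> 'k::field mpoly set \<Rightarrow> 'k mpoly set" where
  "init m I = {p\<in>polys (Suc m). \<forall>k. \<exists>q\<in>I. (\<forall>j<k. zcomp m j q = 0) \<and> zcomp m k q = zcomp m k p}"

definition zsec :: "nat \<Rightarrow> nat \<Rightarrow> 'k::field mpoly set \<Rightarrow> 'k mpoly set" where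
  "zsec m k I = {q\<in>polys m. var m ^ k * q \<in> I}"

lemma zcomp_add: "zcomp m k (p + q) = zcomp m k p + zcomp m k q"
  and zcomp_0 [simp]: "zcomp m k 0 = 0"
  and zcomp_hcomp: "zcomp m k (hcomp d p) = hcomp d (zcomp m k p)"
  and zcomp_zcomp: "zcomp m k (zcomp m j p) = (if j = k then zcomp m k p else 0)"
  by (rule poly_mapping_eqI, auto simp: zcomp_def hcomp_restr lookup_add)+

lemma hcomp_add: "hcomp d (p + q) = hcomp d p + hcomp d q"
  and hcomp_0 [simp]: "hcomp d 0 = 0"
  by (auto simp: hcomp_restr restr_add)

lemma linear_zcomp: "Vector_Spaces.linear pscale pscale (zcomp m k)"
  unfolding zcomp_def by (rule linear_restr)

lemma zcomp_single_mult:
  "zcomp m k (single t c * p)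
    = (if lookup t m \<le> k then single t c * zcomp m (k - lookup t m) p else 0)"
proof (cases "lookup t m \<le> k")
  case True
  then have "(\<lambda>u. lookup (t + u) m = k) = (\<lambda>u. lookup u m = k - lookup t m)"
    by (auto simp: lookup_add)
  then show ?thesis using True by (simp add: zcomp_def restr_single_mult)
next
  case False
  then have "restr (\<lambda>u. lookup (t + u) m = k) p = 0"
    by (intro poly_mapping_eqI) (simp add: lookup_add)
  then show ?thesis using False by (simp add: zcomp_def restr_single_mult)
qed

lemma hcomp_single_mult:
  "hcomp d (single t c * p)
    = (if tdeg t \<le> d then single t c * hcomp (d - tdeg t) p else 0)"
proof (cases "tdeg t \<le> d")
  case True
  then have "(\<lambda>u. tdeg (t + u) = d) = (\<lambda>u. tdeg u = d - tdeg t)" by auto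
  then show ?thesis using True by (simp add: hcomp_restr restr_single_mult)
next
  case False
  then have "restr (\<lambda>u. tdeg (t + u) = d) p = 0" by (intro poly_mapping_eqI) simp
  then show ?thesis using False by (simp add: hcomp_restr restr_single_mult)
qed

lemma polys_zcomp: "p \<in> polys n \<Longrightarrow> zcomp m k p \<in> polys n"
  unfolding zcomp_def by (rule polys_restr)

lemma homog_zcomp: "homog d p \<Longrightarrow> homog d (zcomp m k p)"
  unfolding zcomp_def by (rule homog_restr)

lemma init_witness:
  assumes "p \<in> polys (Suc m)" "zcomp m k p = p" "q \<in> I" "0 \<in> I" "\<And>j. j < k \<Longrightarrow> zcomp m j q = 0" "zcomp m k q = p"
  shows "p \<in> init m I"
proof -
  have "\<exists>q\<in>I. (\<forall>j<k'. zcomp m j q = 0) \<and> zcomp m k' q = zcomp m k' p" for k'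
  proof (cases "k' = k")
    case True then show ?thesis using assms by metis
  next
    case False
    then have "zcomp m k' p = 0" using zcomp_zcomp[of m k' k p] assms(2) by simp
    then show ?thesis using assms(4) by (intro bexI[of _ 0]) auto
  qed
  then show ?thesis using assms(1) by (simp add: init_def)
qed

lemma homog_ideal_init:
  assumes I: "homog_ideal (Suc m) (I :: 'k::field mpoly set)" shows "homog_ideal (Suc m) (init m I)"
proof -
  have ideal: "is_ideal (Suc m) I" by (rule homog_ideal_ideal[OF I])
  have "is_ideal (Suc m) (init m I)"
  proof (rule is_idealI)
    show "init m I \<subseteq> polys (Suc m)" by (auto simp: init_def)
    show "0 \<in> init m I" using is_ideal_0[OF ideal] by (auto simp: init_def intro!: bexI[of _ 0])
  next
    fix p p' assume p: "p \<in> init m I" "p' \<in> init m I"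
    have "\<exists>q\<in>I. (\<forall>j<k. zcomp m j q = 0) \<and> zcomp m k q = zcomp m k (p + p')" for k
    proof -
      obtain q where q: "q \<in> I" "\<forall>j<k. zcomp m j q = 0" "zcomp m k q = zcomp m k p"
        using p(1) by (auto simp: init_def)
      obtain q' where q': "q' \<in> I" "\<forall>j<k. zcomp m j q' = 0" "zcomp m k q' = zcomp m k p'"
        using p(2) by (auto simp: init_def)
      show ?thesis using q q' is_ideal_add[OF ideal]
        by (intro bexI[of _ "q + q'"]) (auto simp: zcomp_add)
    qed
    then show "p + p' \<in> init m I" using p by (auto simp: init_def intro: polys_add)
  next
    fix t :: "nat \<Rightarrow>\<^sub>0 nat" and c :: 'k and p assume t: "t \<in> mons (Suc m)" and p: "p \<in> init m I"
    let ?a = "lookup t m"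
    have "\<exists>q\<in>I. (\<forall>j<k. zcomp m j q = 0) \<and> zcomp m k q = zcomp m k (single t c * p)" for k
    proof (cases "?a \<le> k")
      case True
      obtain q where q: "q \<in> I" "\<forall>j<k - ?a. zcomp m j q = 0" "zcomp m (k - ?a) q = zcomp m (k - ?a) p"
        using p by (auto simp: init_def)
      show ?thesis
        by (rule bexI[of _ "single t c * q"])
          (use q True t in \<open>auto simp: zcomp_single_mult intro: is_ideal_mult[OF ideal]\<close>)
    next
      case False
      then show ?thesis using is_ideal_0[OF ideal] by (intro bexI[of _ 0]) (auto simp: zcomp_single_mult)
    qed
    then show "single t c * p \<in> init m I"
      using p t by (auto simp: init_def intro: polys_mult)
  qed
  moreover have "hcomp d p \<in> init m I" if p: "p \<in> init m I" for p d
  proof -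
    have "\<exists>q\<in>I. (\<forall>j<k. zcomp m j q = 0) \<and> zcomp m k q = zcomp m k (hcomp d p)" for k
    proof -
      obtain q where q: "q \<in> I" "\<forall>j<k. zcomp m j q = 0" "zcomp m k q = zcomp m k p"
        using p by (auto simp: init_def)
      show ?thesis
        by (rule bexI[of _ "hcomp d q"]) (use q homog_ideal_hcomp[OF I] in \<open>auto simp: zcomp_hcomp\<close>)
    qed
    then show ?thesis using p by (auto simp: init_def hcomp_restr intro: polys_restr)
  qed
  ultimately show ?thesis by (simp add: homog_ideal_def)
qed

lemma zgraded_init:
  assumes "0 \<in> I" shows "zgraded m (init m I)"
  unfolding zgraded_def
proof (intro ballI allI)
  fix p k assume p: "p \<in> init m I"
  then obtain q where "q \<in> I" "\<forall>j<k. zcomp m j q = 0" "zcomp m k q = zcomp m k p" by (auto simp: init_def)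
  then show "zcomp m k p \<in> init m I"
    by (intro init_witness[of _ m k q]) (use p assms in \<open>auto simp: zcomp_zcomp init_def intro: polys_zcomp\<close>)
qed

text \<open>The exponent of \<open>x_m\<close> is at most the degree \<open>d\<close>, so the
  \<open>d + 1\<close> components for exponents \<open>0\<close> to \<open>d\<close>
  suffice.\<close>

lemma zcomp_faithful:
  assumes "homog d p" "\<And>j. j < Suc d \<Longrightarrow> zcomp m j p = 0" shows "p = 0"
proof (rule poly_mapping_eqI)
  fix t
  show "lookup p t = lookup 0 t"
  proof (cases "tdeg t = d")
    case True
    then have "zcomp m (lookup t m) p = 0" using assms(2) lookup_le_tdeg[of t m] by simp
    then have "lookup (zcomp m (lookup t m) p) t = 0" by simp
    then show ?thesis by (simp add: zcomp_def)
  next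
    case False then show ?thesis using assms(1) by (simp add: homog_iff)
  qed
qed

lemma initial_init:
  assumes I: "homog_ideal (Suc m) (I :: 'k::field mpoly set)"
  shows "initial (zcomp m) k (gpiece d (init m I)) = initial (zcomp m) k (gpiece d I)"
proof (intro equalityI subsetI)
  have ideal: "is_ideal (Suc m) I" by (rule homog_ideal_ideal[OF I])
  fix x assume "x \<in> initial (zcomp m) k (gpiece d (init m I))"
  then obtain w where w: "w \<in> init m I" "homog d w" "x = zcomp m k w"
    by (auto simp: initial_def gpiece_def)
  then obtain q where q: "q \<in> I" "\<forall>j<k. zcomp m j q = 0" "zcomp m k q = zcomp m k w" by (auto simp: init_def)
  have x: "x = zcomp m k (hcomp d q)" unfolding w(3) zcomp_hcomp q(3)
    using homog_hcomp_eq[OF homog_zcomp[OF w(2)]] by simp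
  show "x \<in> initial (zcomp m) k (gpiece d I)"
    unfolding initial_def
    by (rule image_eqI[of _ "zcomp m k", OF x])
      (use q homog_ideal_hcomp[OF I q(1), of d] homog_hcomp[of d q] in \<open>auto simp: gpiece_def zcomp_hcomp\<close>)
next
  have ideal: "is_ideal (Suc m) I" by (rule homog_ideal_ideal[OF I])
  fix x assume "x \<in> initial (zcomp m) k (gpiece d I)"
  then obtain w where w: "w \<in> I" "homog d w" "x = zcomp m k w" "\<forall>j<k. zcomp m j w = 0"
    by (auto simp: initial_def gpiece_def)
  have "x \<in> init m I" by (rule init_witness[of _ m k w])
      (use w is_ideal_polys[OF ideal] is_ideal_0[OF ideal] in \<open>auto simp: zcomp_zcomp intro: polys_zcomp\<close>)
  moreover have "homog d x" using w(2,3) homog_zcomp by blast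
  moreover have "zcomp m k x = x" "\<forall>j<k. zcomp m j x = 0" using w(3) by (auto simp: zcomp_zcomp)
  ultimately show "x \<in> initial (zcomp m) k (gpiece d (init m I))"
    unfolding initial_def by (intro image_eqI[of _ _ x]) (auto simp: gpiece_def)
qed

lemma hdim_eq_sum_initial:
  assumes "is_ideal n (I :: 'k::field mpoly set)"
  shows "hdim d I = (\<Sum>k<Suc d. pv.dim (initial (zcomp m) k (gpiece d I)))"
  unfolding hdim_def
  by (rule pv.dim_eq_sum_initial[of "zcomp m", OF linear_zcomp subspace_gpiece[OF is_ideal_subspace[OF assms]]
      fin_dim_gpiece[OF is_ideal_subset[OF assms]]])
    (rule zcomp_faithful, auto simp: gpiece_def)

text \<open>The ideal and its ideal of initial components have the same graded pieces for the
  filtration by powers of \<open>x_m\<close>, by \<open>initial_init\<close>.\<close>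

lemma hdim_init:
  assumes I: "homog_ideal (Suc m) (I :: 'k::field mpoly set)"
  shows "hdim d (init m I) = hdim d I"
  using hdim_eq_sum_initial[OF homog_ideal_ideal[OF I], of d m]
    hdim_eq_sum_initial[OF homog_ideal_ideal[OF homog_ideal_init[OF I]], of d m]
    initial_init[OF I] by simp

section \<open>Restriction to the hyperplane where the last variable vanishes\<close>

lemma mons_Suc_iff:
  assumes "t \<in> mons (Suc m)" shows "t \<in> mons m \<longleftrightarrow> lookup t m = 0"
proof
  assume l: "lookup t m = 0"
  have "lookup t i = 0" if "m \<le> i" for i
    using l assms that by (cases "i = m") (auto simp: mons_lookup)
  then show "t \<in> mons m" by (simp add: mons_lookup)
qed (simp add: mons_lookup)

lemma trunc_eq_zcomp:
  assumes "p \<in> polys (Suc m)" shows "trunc m p = zcomp m 0 p"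
proof (rule poly_mapping_eqI)
  fix t
  show "lookup (trunc m p) t = lookup (zcomp m 0 p) t"
  proof (cases "t \<in> mons (Suc m)")
    case True
    then show ?thesis using mons_Suc_iff[OF True] by (simp add: trunc_restr zcomp_def)
  next
    case False then show ?thesis using assms by (auto simp: trunc_restr zcomp_def polys_lookup)
  qed
qed

lemma trunc_polys: "trunc m p \<in> polys m"
  by (auto simp: trunc_restr polys_lookup)

lemma trunc_id: "p \<in> polys m \<Longrightarrow> trunc m p = p"
  unfolding trunc_restr by (rule restr_id) (auto simp: polys_def)

lemma trunc_trunc: "m \<le> n \<Longrightarrow> trunc m (trunc n p) = trunc m p"
  by (rule poly_mapping_eqI) (auto simp: trunc_restr mons_lookup)

lemma trunc_single_mult:
  assumes "t \<in> mons m" shows "trunc m (single t c * p) = single t c * trunc m p"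
  using assms by (simp add: trunc_restr restr_single_mult)

lemma homog_ideal_trunc:
  assumes I: "homog_ideal (Suc m) I" shows "homog_ideal m (trunc m ` I)"
proof -
  have ideal: "is_ideal (Suc m) I" by (rule homog_ideal_ideal[OF I])
  have "is_ideal m (trunc m ` I)"
  proof (rule is_idealI)
    show "0 \<in> trunc m ` I" using is_ideal_0[OF ideal] by (intro image_eqI[of _ _ 0]) (simp_all add: trunc_restr)
    fix p q assume "p \<in> trunc m ` I" "q \<in> trunc m ` I"
    then obtain p' q' where "p = trunc m p'" "q = trunc m q'" "p' \<in> I" "q' \<in> I" by blast
    then show "p + q \<in> trunc m ` I"
      by (intro image_eqI[of _ _ "p' + q'"]) (auto simp: trunc_restr restr_add intro: is_ideal_add[OF ideal])
  next
    fix t c p assume t: "t \<in> mons m" and "p \<in> trunc m ` I"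
    then obtain p' where p': "p = trunc m p'" "p' \<in> I" by blast
    have "t \<in> mons (Suc m)" using t by (simp add: mons_lookup)
    then show "single t c * p \<in> trunc m ` I"
      using p' t by (intro image_eqI[of _ _ "single t c * p'"])
        (auto simp: trunc_single_mult intro: is_ideal_mult[OF ideal])
  qed (use trunc_polys in blast)
  moreover have "hcomp d (trunc m p) = trunc m (hcomp d p)" for d and p :: "'a mpoly"
    by (rule poly_mapping_eqI) (simp add: trunc_restr hcomp_restr)
  ultimately show ?thesis using homog_ideal_hcomp[OF I] by (auto simp: homog_ideal_def)
qed

lemma trunc_init:
  assumes I: "homog_ideal (Suc m) I" shows "trunc m ` init m I = trunc m ` I"
proof (intro equalityI subsetI)
  have ideal: "is_ideal (Suc m) I" by (rule homog_ideal_ideal[OF I])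
  fix x assume "x \<in> trunc m ` init m I"
  then obtain p where p: "p \<in> init m I" "x = trunc m p" by blast
  then obtain q where q: "q \<in> I" "zcomp m 0 q = zcomp m 0 p" by (auto simp: init_def)
  have "x = trunc m q"
    using p q trunc_eq_zcomp[of p m] trunc_eq_zcomp[of q m] is_ideal_polys[OF ideal q(1)] by (auto simp: init_def)
  then show "x \<in> trunc m ` I" using q(1) by blast
next
  have ideal: "is_ideal (Suc m) I" by (rule homog_ideal_ideal[OF I])
  fix x assume "x \<in> trunc m ` I"
  then obtain p where p: "p \<in> I" "x = trunc m p" by blast
  then have e: "x = zcomp m 0 p" using trunc_eq_zcomp is_ideal_polys[OF ideal p(1)] by blast
  have "x \<in> init m I" by (rule init_witness[of _ m 0 p])
      (use e p is_ideal_polys[OF ideal] is_ideal_0[OF ideal] in \<open>auto simp: zcomp_zcomp intro: polys_zcomp\<close>)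
  moreover have "x = trunc m x" using p(2) trunc_id[OF trunc_polys] by metis
  ultimately show "x \<in> trunc m ` init m I" by blast
qed

section \<open>Sections of an ideal along the powers of the last variable\<close>

lemma homog_ideal_zsec:
  assumes I: "homog_ideal (Suc m) I" shows "homog_ideal m (zsec m k I)"
proof -
  have ideal: "is_ideal (Suc m) I" by (rule homog_ideal_ideal[OF I])
  have "is_ideal m (zsec m k I)"
  proof (rule is_idealI)
    fix t c p assume t: "t \<in> mons m" and p: "p \<in> zsec m k I"
    have "t \<in> mons (Suc m)" using t by (simp add: mons_lookup)
    then have "single t c * (var m ^ k * p) \<in> I"
      using p is_ideal_mult[OF ideal, of "var m ^ k * p" "single t c"] by (simp add: zsec_def)
    then have "var m ^ k * (single t c * p) \<in> I" by (simp only: mult.left_commute)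
    moreover have "single t c * p \<in> polys m"
      by (rule polys_mult) (use p t in \<open>auto simp: zsec_def\<close>)
    ultimately show "single t c * p \<in> zsec m k I" by (simp add: zsec_def)
  next
    fix p q assume "p \<in> zsec m k I" "q \<in> zsec m k I"
    then show "p + q \<in> zsec m k I"
      using is_ideal_add[OF ideal, of "var m ^ k * p" "var m ^ k * q"]
      by (simp add: zsec_def polys_add distrib_left[symmetric])
  next
    show "0 \<in> zsec m k I" using is_ideal_0[OF ideal] by (simp add: zsec_def)
  qed (simp add: zsec_def)
  moreover have "hcomp d p \<in> zsec m k I" if "p \<in> zsec m k I" for p d
  proof -
    have "hcomp (d + k) (var m ^ k * p) \<in> I" using that homog_ideal_hcomp[OF I] by (simp add: zsec_def)
    then have "var m ^ k * hcomp d p \<in> I" by (simp add: var_power hcomp_single_mult)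
    then show ?thesis using that by (auto simp: zsec_def hcomp_restr intro: polys_restr)
  qed
  ultimately show ?thesis by (simp add: homog_ideal_def)
qed

lemma zsec_mono:
  assumes I: "is_ideal (Suc m) I" and "j \<le> k" shows "zsec m j I \<subseteq> zsec m k I"
proof
  fix q assume q: "q \<in> zsec m j I"
  have "var m ^ (k - j) \<in> polys (Suc m)" by (simp add: var_power mons_single_iff)
  then have "var m ^ (k - j) * (var m ^ j * q) \<in> I"
    using q is_ideal_mult[OF I, of "var m ^ j * q" "var m ^ (k - j)"] by (simp add: zsec_def)
  moreover have "var m ^ (k - j) * (var m ^ j * q) = var m ^ k * q"
    using assms(2) by (simp add: mult.assoc[symmetric] power_add[symmetric])
  ultimately show "q \<in> zsec m k I" using q by (simp add: zsec_def)
qed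

text \<open>In an ideal graded in \<open>x_m\<close> the component of exponent 0 of each element
  again belongs to the ideal, so restricting to \<open>x_m = 0\<close> and intersecting with the
  smaller polynomial ring give the same result.\<close>

lemma zsec_0_eq_trunc:
  assumes "zgraded m I" and I: "is_ideal (Suc m) I" shows "zsec m 0 I = trunc m ` I"
proof (intro equalityI subsetI)
  fix q assume "q \<in> zsec m 0 I"
  then have "q \<in> I" "trunc m q = q" by (auto simp: zsec_def trunc_id)
  then show "q \<in> trunc m ` I" by (metis image_eqI)
next
  fix q assume "q \<in> trunc m ` I"
  then obtain p where p: "p \<in> I" "q = trunc m p" by blast
  then have "q \<in> I" using trunc_eq_zcomp[OF is_ideal_polys[OF I p(1)]] assms(1) by (simp add: zgraded_def)
  then show "q \<in> zsec m 0 I" using p(2) trunc_polys by (simp add: zsec_def)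
qed

lemma polys_sum: "(\<And>x. x \<in> A \<Longrightarrow> f x \<in> polys m) \<Longrightarrow> sum f A \<in> polys m"
  by (induction A rule: infinite_finite_induct) (auto intro: polys_add)

lemma zcomp_var_power:
  assumes "p \<in> polys (Suc m)" "zcomp m k p = p"
  obtains q where "q \<in> polys m" "p = var m ^ k * q"
proof -
  let ?z = "single m k"
  define q where "q = (\<Sum>t\<in>keys p. single (t - ?z) (lookup p t))"
  have k: "lookup t m = k" if "t \<in> keys p" for t
  proof -
    have "lookup (zcomp m k p) t \<noteq> 0" using that assms(2) by (simp add: in_keys_iff)
    then show ?thesis by (simp add: zcomp_def split: if_splits)
  qed
  have "t - ?z \<in> mons m" if "t \<in> keys p" for t
    unfolding mons_lookup
  proof (intro allI impI)
    fix i assume "m \<le> i"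
    moreover have "t \<in> mons (Suc m)" using that assms(1) by (simp add: polys_iff)
    ultimately show "lookup (t - ?z) i = 0" using k[OF that]
      by (cases "i = m") (auto simp: lookup_minus mons_lookup)
  qed
  then have "q \<in> polys m" unfolding q_def by (intro polys_sum) simp
  moreover have "p = var m ^ k * q"
  proof -
    have "var m ^ k * q = (\<Sum>t\<in>keys p. single (?z + (t - ?z)) (lookup p t))"
      by (simp add: var_power q_def sum_distrib_left mult_single)
    also have "\<dots> = (\<Sum>t\<in>keys p. single t (lookup p t))"
    proof (rule sum.cong)
      fix t assume "t \<in> keys p"
      then have "t = ?z + (t - ?z)"
        using k[of t] by (intro monomial_eq_add) (auto simp: lookup_single when_def)
      then show "single (?z + (t - ?z)) (lookup p t)
        = single t (lookup p t)" by simp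
    qed simp
    finally show ?thesis using poly_eq_sum[of p] by simp
  qed
  ultimately show thesis using that by blast
qed

lemma initial_zsec:
  assumes "zgraded m I" and I: "is_ideal (Suc m) I" and "k \<le> d"
  shows "initial (zcomp m) k (gpiece d I) = (*) (var m ^ k) ` gpiece (d - k) (zsec m k I)"
proof (intro equalityI subsetI)
  fix x assume "x \<in> initial (zcomp m) k (gpiece d I)"
  then obtain w where w: "w \<in> I" "homog d w" "x = zcomp m k w" by (auto simp: initial_def gpiece_def)
  then have x: "x \<in> I" "homog d x" "zcomp m k x = x"
    using assms(1) homog_zcomp by (auto simp: zgraded_def zcomp_zcomp)
  obtain q where q: "q \<in> polys m" "x = var m ^ k * q"
    by (rule zcomp_var_power[OF is_ideal_polys[OF I x(1)] x(3)])
  have "x = hcomp d (var m ^ k * q)" using homog_hcomp_eq[OF x(2)] q(2) by simp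
  also have "\<dots> = var m ^ k * hcomp (d - k) q" unfolding var_power hcomp_single_mult using assms(3) by simp
  finally have "x = var m ^ k * hcomp (d - k) q" .
  moreover have "hcomp (d - k) q \<in> gpiece (d - k) (zsec m k I)"
    using x(1) calculation q(1) homog_hcomp by (auto simp: gpiece_def zsec_def hcomp_restr intro: polys_restr)
  ultimately show "x \<in> (*) (var m ^ k) ` gpiece (d - k) (zsec m k I)" by blast
next
  fix x assume "x \<in> (*) (var m ^ k) ` gpiece (d - k) (zsec m k I)"
  then obtain q where q: "q \<in> polys m" "x \<in> I" "x = var m ^ k * q" "homog (d - k) q"
    by (auto simp: gpiece_def zsec_def)
  have "homog d x" using homog_mult[of k "var m ^ k" "d - k" q] q(3,4) assms(3) by (simp add: var_power)
  moreover have "zcomp m j x = (if j = k then x else 0)" for j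
  proof -
    have "zcomp m i q = (if i = 0 then q else 0)" for i
      using q(1) by (intro poly_mapping_eqI) (auto simp: zcomp_def polys_lookup mons_lookup)
    then show ?thesis by (auto simp: q(3) var_power zcomp_single_mult)
  qed
  ultimately show "x \<in> initial (zcomp m) k (gpiece d I)"
    unfolding initial_def using q(2) by (intro image_eqI[of _ _ x]) (simp_all add: gpiece_def)
qed

lemma var_power_mult_eq_0: "var m ^ k * (q :: 'k::field mpoly) = 0 \<longleftrightarrow> q = 0"
proof
  assume e: "var m ^ k * q = 0"
  show "q = 0"
  proof (rule poly_mapping_eqI)
    fix t
    have "lookup (var m ^ k * q) (single m k + t) = lookup q t"
      unfolding var_power lookup_single_mult_add by simp
    then show "lookup q t = lookup 0 t" using e by simp
  qed
qed simp

lemma poly_pair: "vector_space_pair pscale pscale"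
  by (intro vector_space_pair.intro pv.vector_space_axioms)

text \<open>An ideal graded in \<open>x_m\<close> is the direct sum of its sections, the
  \<open>k\<close>-th multiplied by \<open>x_m ^ k\<close>, and this multiplication is injective. In
  degree \<open>d\<close> only \<open>k \<le> d\<close> contributes.\<close>

lemma hdim_zsec:
  assumes "zgraded m I" and I: "homog_ideal (Suc m) (I :: 'k::field mpoly set)"
  shows "hdim d I = (\<Sum>k<Suc d. hdim (d - k) (zsec m k I))"
proof -
  have ideal: "is_ideal (Suc m) I" by (rule homog_ideal_ideal[OF I])
  have "pv.dim (initial (zcomp m) k (gpiece d I)) = hdim (d - k) (zsec m k I)" if "k < Suc d" for k
  proof -
    have s: "is_ideal m (zsec m k I)" by (rule homog_ideal_ideal[OF homog_ideal_zsec[OF I]])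
    have "pv.dim ((*) (var m ^ k) ` gpiece (d - k) (zsec m k I)) = hdim (d - k) (zsec m k I)"
      unfolding hdim_def
      by (rule vector_space_pair.dim_image_inj[OF poly_pair linear_mult
          subspace_gpiece[OF is_ideal_subspace[OF s]] fin_dim_gpiece[OF is_ideal_subset[OF s]]])
        (simp only: var_power_mult_eq_0)
    then show ?thesis using initial_zsec[OF assms(1) ideal, of k d] that by simp
  qed
  then show ?thesis using hdim_eq_sum_initial[OF ideal, of d m] by simp
qed

text \<open>In each degree both sets consist of the pure power monomials and a segment, and segments
  of a finite chain are nested according to size. An inequality of Hilbert functions thus becomes an
  inclusion of ideals.\<close>

lemma lpp_mons_mono:
  assumes "lpp_growth m es h" "lpp_growth m es h'" "\<And>d. h d \<le> h' d"
  shows "lpp_mons m es h \<subseteq> lpp_mons m es h'"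
proof -
  have "lex_part m es h d \<subseteq> lex_part m es h' d" for d
  proof (rule segment_subset[OF _ _ finite_cap_mons])
    have b: "h d \<le> card {t\<in>mons m. tdeg t = d}" "h' d \<le> card {t\<in>mons m. tdeg t = d}"
      using assms(1,2) by (auto simp: lpp_growth_def)
    show "segment (cap_mons m es d) (lex_part m es h d)" "segment (cap_mons m es d) (lex_part m es h' d)"
      using lex_part(1)[of h d m es, OF b(1)] lex_part(1)[of h' d m es, OF b(2)] by auto
    show "card (lex_part m es h d) \<le> card (lex_part m es h' d)"
      using lex_part(2)[of h d m es, OF b(1)] lex_part(2)[of h' d m es, OF b(2)] assms(3)[of d] by simp
  qed
  then show ?thesis unfolding lpp_mons_def by blast
qed

section \<open>Gluing lex-plus-powers ideals along the powers of the last variable\<close>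

lemma mons_Suc_decomp:
  assumes "t \<in> mons (Suc m)"
  shows "t - single m (lookup t m) \<in> mons m"
  using assms unfolding mons_lookup by (auto simp: lookup_minus lookup_single when_def)

lemma pow_mons_add_last:
  assumes "length es \<le> m" "u \<in> mons m"
  shows "u + single m k \<in> pow_mons (Suc m) es \<longleftrightarrow> u \<in> pow_mons m es"
  using assms by (auto simp: pow_mons_def lookup_add lookup_single mons_single_iff mons_lookup)

lemma mons_Suc_obtain:
  assumes "t \<in> mons (Suc m)"
  obtains u k where "t = u + single m k" "u \<in> mons m"
  using split_off_power(1)[of t m] mons_Suc_decomp[OF assms] that by blast

lemma mons_Suc_glue: "u \<in> mons m \<Longrightarrow> u + single m k \<in> mons (Suc m)"
  by (simp add: mons_single_iff) (simp add: mons_lookup)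

lemma card_mons_slices:
  "card {t\<in>U. t \<in> mons (Suc m) \<and> tdeg t = d}
    = (\<Sum>k<Suc d. card {u\<in>mons m. u + single m k \<in> U \<and> tdeg u = d - k})"
proof -
  let ?S = "{t\<in>U. t \<in> mons (Suc m) \<and> tdeg t = d}"
  have "finite ?S" by (rule finite_subset[OF _ finite_mons_deg[of "Suc m" d]]) auto
  then have "card ?S = (\<Sum>k<Suc d. card (slice m k ?S))"
    by (rule card_slices) (auto simp: less_Suc_eq_le intro: lookup_le_tdeg)
  also have "\<dots> = (\<Sum>k<Suc d. card {u\<in>mons m. u + single m k \<in> U \<and> tdeg u = d - k})"
  proof (rule sum.cong[OF refl])
    fix k assume k: "k \<in> {..<Suc d}"
    have "slice m k ?S = {u\<in>mons m. u + single m k \<in> U \<and> tdeg u = d - k}"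
    proof (intro equalityI subsetI)
      fix u assume "u \<in> slice m k ?S"
      then have u: "lookup u m = 0" "u + single m k \<in> ?S" by (auto simp: slice_iff)
      then show "u \<in> {u\<in>mons m. u + single m k \<in> U \<and> tdeg u = d - k}"
        using mons_Suc_iff[of u m] by auto
    next
      fix u assume "u \<in> {u\<in>mons m. u + single m k \<in> U \<and> tdeg u = d - k}"
      then show "u \<in> slice m k ?S"
        using mons_Suc_glue[of u m k] k by (auto simp: slice_iff mons_lookup)
    qed
    then show "card (slice m k ?S) = card {u\<in>mons m. u + single m k \<in> U \<and> tdeg u = d - k}" by simp
  qed
  finally show ?thesis .
qed

definition zglue :: "nat \<Rightarrow> nat list \<Rightarrow> (nat \<Rightarrow> nat \<Rightarrow> nat) \<Rightarrow> (nat \<Rightarrow>\<^sub>0 nat) set" where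
  "zglue m es h = {u + single m k | u k. u \<in> lpp_mons m es (h k)}"

lemma zglue_iff:
  assumes "\<And>k. lpp_growth m es (h k)" "u \<in> mons m"
  shows "u + single m k \<in> zglue m es h \<longleftrightarrow> u \<in> lpp_mons m es (h k)"
proof
  assume "u + single m k \<in> zglue m es h"
  then obtain v j where v: "u + single m k = v + single m j" "v \<in> lpp_mons m es (h j)"
    by (auto simp: zglue_def)
  have "v \<in> mons m" using v(2) lpp_mons_mons[OF assms(1)] by blast
  then have "k = j" using arg_cong[OF v(1), of "\<lambda>t. lookup t m"] assms(2)
    by (simp add: lookup_add mons_lookup)
  then show "u \<in> lpp_mons m es (h k)" using v by simp
qed (auto simp: zglue_def)

text \<open>A factor \<open>x_m\<close> leads from layer \<open>k\<close> to layer
  \<open>k + 1\<close>, so the layers have to increase. The inequality \<open>mono\<close> between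
  the Hilbert functions is enough for this, by \<open>lpp_mons_mono\<close>.\<close>

lemma up_closed_zglue:
  assumes g: "\<And>k. lpp_growth m es (h k)" and mono: "\<And>k d. h k d \<le> h (Suc k) d"
  shows "up_closed (Suc m) (zglue m es h)"
  unfolding up_closed_def
proof (intro ballI allI impI)
  fix t i assume "t \<in> zglue m es h" and i: "i < Suc m"
  then obtain u k where u: "t = u + single m k" "u \<in> lpp_mons m es (h k)" by (auto simp: zglue_def)
  show "t + xv i \<in> zglue m es h"
  proof (cases "i = m")
    case True
    have "u \<in> lpp_mons m es (h (Suc k))" using u(2) lpp_mons_mono[OF g g mono] by blast
    moreover have "t + xv i = u + single m (Suc k)"
      using u(1) True by (simp add: add.assoc single_add[symmetric])
    ultimately show ?thesis by (auto simp: zglue_def)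
  next
    case False
    then have "u + xv i \<in> lpp_mons m es (h k)" using u(2) i up_closed_lpp_mons[OF g] by (simp add: up_closed_def)
    moreover have "t + xv i = (u + xv i) + single m k" using u(1) by (simp add: ac_simps)
    ultimately show ?thesis unfolding zglue_def by blast
  qed
qed

lemma card_zglue:
  assumes g: "\<And>k. lpp_growth m es (h k)"
  shows "card {t\<in>zglue m es h. t \<in> mons (Suc m) \<and> tdeg t = d} = (\<Sum>k<Suc d. h k (d - k))"
proof -
  have "{u\<in>mons m. u + single m k \<in> zglue m es h \<and> tdeg u = d - k}
    = {u\<in>lpp_mons m es (h k). u \<in> mons m \<and> tdeg u = d - k}" for k
    using zglue_iff[of m es h, OF g] by blast
  then show ?thesis unfolding card_mons_slices using card_lpp_mons[OF g] by simp
qed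

lemma pow_mons_subset_zglue:
  assumes "length es \<le> m" shows "pow_mons (Suc m) es \<subseteq> zglue m es h"
proof
  fix t assume t: "t \<in> pow_mons (Suc m) es"
  then have "t \<in> mons (Suc m)" by (simp add: pow_mons_def)
  then obtain u k where u: "t = u + single m k" "u \<in> mons m" by (rule mons_Suc_obtain)
  then have "u \<in> pow_mons m es" using pow_mons_add_last[OF assms u(2)] t by simp
  then show "t \<in> zglue m es h" using u(1) unfolding zglue_def lpp_mons_def by blast
qed

text \<open>The truncated sequence lies in the section for \<open>k = 0\<close>, and the sections
  increase with \<open>k\<close>. Hypotheses on the truncated sequence therefore apply to every
  section, not only to the restriction to the hyperplane.\<close>

lemma zsec_contains:
  assumes "ideal_gen (Suc m) (set gs) \<subseteq> I" and I: "homog_ideal (Suc m) I" and zg: "zgraded m X"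
    and X: "homog_ideal (Suc m) X" and eq: "trunc m ` I \<subseteq> trunc m ` X"
  shows "ideal_gen m (set (map (trunc m) gs)) \<subseteq> zsec m k X"
proof (rule ideal_gen_minimal[OF homog_ideal_ideal[OF homog_ideal_zsec[OF X]]])
  have "set gs \<subseteq> I" using assms(1) ideal_gen_subset by blast
  then have "trunc m ` set gs \<subseteq> zsec m 0 X"
    using eq zsec_0_eq_trunc[OF zg homog_ideal_ideal[OF X]] by blast
  then show "set (map (trunc m) gs) \<subseteq> zsec m k X"
    using zsec_mono[OF homog_ideal_ideal[OF X], of 0 k] by auto
qed

lemma EGH_step:
  fixes gs :: "'k::field mpoly list"
  assumes es: "length es \<le> m" "sorted es" and E: "EGH m (map (trunc m) gs) es"
  shows "EGH (Suc m) gs es"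
  unfolding EGH_def
proof (intro allI impI)
  fix I :: "'k mpoly set" assume I: "homog_ideal (Suc m) I \<and> ideal_gen (Suc m) (set gs) \<subseteq> I"
  then have hI: "homog_ideal (Suc m) I" by blast
  let ?X = "init m I"
  have X: "homog_ideal (Suc m) ?X" by (rule homog_ideal_init[OF hI])
  have zg: "zgraded m ?X" by (rule zgraded_init[OF is_ideal_0[OF homog_ideal_ideal[OF hI]]])
  define h where "h = (\<lambda>k d. hdim d (zsec m k ?X))"
  have g: "lpp_growth m es (h k)" for k
    unfolding h_def
    by (rule EGH_lpp_growth[OF es E homog_ideal_zsec[OF X] zsec_contains[OF _ hI zg X]])
      (use I trunc_init[OF hI] in auto)
  have mono: "h k d \<le> h (Suc k) d" for k d
    unfolding h_def
    by (rule hdim_mono[OF zsec_mono[OF homog_ideal_ideal[OF X]] is_ideal_subset[OF homog_ideal_ideal[OF homog_ideal_zsec[OF X]]]]) simp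
  let ?J = "monomial_ideal (Suc m) (zglue m es h) :: 'k mpoly set"
  have J: "homog_ideal (Suc m) ?J" by (rule homog_monomial_ideal[OF up_closed_zglue[of m es h, OF g mono]])
  have "pow_ideal (Suc m) es \<subseteq> ?J"
    using pow_ideal_eq[of es "Suc m"] es(1) pow_mons_subset_zglue[OF es(1), of h] by (auto simp: monomial_ideal_def)
  moreover have "hdim d ?J = hdim d I" for d
    unfolding hdim_monomial_ideal card_zglue[of m es h, OF g]
    using hdim_zsec[OF zg X, of d] hdim_init[OF hI, of d] by (simp add: h_def)
  then have "hilb (Suc m) ?J = hilb (Suc m) I"
    using hilb_eq_iff[OF is_ideal_subset[OF homog_ideal_ideal[OF J]] is_ideal_subset[OF homog_ideal_ideal[OF hI]]] by simp
  ultimately show "\<exists>I'::'k mpoly set. homog_ideal (Suc m) I' \<and> pow_ideal (Suc m) es \<subseteq> I' \<and> hilb (Suc m) I' = hilb (Suc m) I"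
    using J by blast
qed

section \<open>Comparing the hyperplane sections of two ideals\<close>

lemma lex_part_cong: "h d = h' d \<Longrightarrow> lex_part m es h d = lex_part m es h' d"
  by (simp add: lex_part_def)

text \<open>The growth condition is applied to an ideal \<open>Q\<close> that interpolates between \<open>A\<close> in degree \<open>d\<close>
  and \<open>B\<close> in degree \<open>d - a\<close>.\<close>

lemma lex_part_carry:
  fixes gs :: "'k::field mpoly list"
  assumes es: "length es \<le> m" "sorted es" and E: "EGH m gs es"
    and A: "homog_ideal m A" "ideal_gen m (set gs) \<subseteq> A" and B: "homog_ideal m B" "A \<subseteq> B"
    and a: "a \<le> d"
    and carry: "\<And>w q. w \<in> mons m \<Longrightarrow> tdeg w = a \<Longrightarrow> q \<in> gpiece (d - a) B \<Longrightarrow> single w 1 * q \<in> A"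
    and s: "s \<in> lex_part m es (\<lambda>d. hdim d B) (d - a)" and w: "s + w \<in> cap_mons m es d"
  shows "s + w \<in> lex_part m es (\<lambda>d. hdim d A) d"
proof -
  have iA: "is_ideal m A" and iB: "is_ideal m B" using A(1) B(1) homog_ideal_ideal by auto
  \<comment> \<open>An element of \<open>B\<close> belongs to \<open>Q\<close> if each of its
    homogeneous components is sent into \<open>A\<close> by all monomials that raise it to degree
    \<open>d\<close>. In degree \<open>d\<close> the monomial 1 is among these, leaving only
    \<open>A\<close>; in degree \<open>d - a\<close> the condition holds on all of \<open>B\<close>
    by \<open>carry\<close>. Being an ideal, \<open>Q\<close> obeys the growth condition between
    these two degrees.\<close>
  define Q where "Q = {p\<in>B. \<forall>e w. w \<in> mons m \<and> tdeg w + e = d \<longrightarrow> single w 1 * hcomp e p \<in> A}"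
  have AQ: "A \<subseteq> Q"
    unfolding Q_def using B(2) by (auto intro!: is_ideal_mult[OF iA] homog_ideal_hcomp[OF A(1)])
  have "is_ideal m Q"
  proof (rule is_idealI)
    show "Q \<subseteq> polys m" using is_ideal_subset[OF iB] by (auto simp: Q_def)
    show "0 \<in> Q" using is_ideal_0[OF iA] AQ by blast
    show "p + q \<in> Q" if "p \<in> Q" "q \<in> Q" for p q
      using that by (auto simp: Q_def hcomp_add distrib_left intro: is_ideal_add[OF iA] is_ideal_add[OF iB])
    fix t c p assume t: "t \<in> mons m" and p: "p \<in> Q"
    have "single w 1 * hcomp e (single t c * p) \<in> A"
      if w: "w \<in> mons m" "tdeg w + e = d" for e w
    proof (cases "tdeg t \<le> e")
      case True
      have "single (w + t) 1 * hcomp (e - tdeg t) p \<in> A"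
        using p w t True by (auto simp: Q_def)
      then have "pscale c (single (w + t) 1 * hcomp (e - tdeg t) p) \<in> A" by (rule is_ideal_pscale[OF iA])
      moreover have "pscale c (single (w + t) 1 * hcomp (e - tdeg t) p)
        = single w 1 * hcomp e (single t c * p)"
        using True by (simp add: hcomp_single_mult pscale_def const_def mult_single mult.assoc[symmetric])
      ultimately show ?thesis by simp
    next
      case False then show ?thesis using is_ideal_0[OF iA] by (simp add: hcomp_single_mult)
    qed
    moreover have "single t c * p \<in> B" using p t by (auto simp: Q_def intro: is_ideal_mult[OF iB])
    ultimately show "single t c * p \<in> Q" by (simp add: Q_def)
  qed
  moreover have "hcomp e p \<in> Q" if "p \<in> Q" for p e
  proof -
    have "hcomp e' (hcomp e p) = (if e' = e then hcomp e p else 0)" for e'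
      using homog_hcomp_eq[OF homog_hcomp] by blast
    then show ?thesis using that homog_ideal_hcomp[OF B(1)] is_ideal_0[OF iA] by (auto simp: Q_def)
  qed
  ultimately have Q: "homog_ideal m Q" by (simp add: homog_ideal_def)
  have g: "lpp_growth m es (\<lambda>d. hdim d Q)"
    by (rule EGH_lpp_growth[OF es E Q]) (use A(2) AQ in blast)
  have "gpiece (d - a) Q = gpiece (d - a) B"
  proof (intro equalityI subsetI)
    fix q assume q: "q \<in> gpiece (d - a) B"
    have "single w 1 * hcomp e q \<in> A" if "w \<in> mons m" "tdeg w + e = d" for e w
    proof (cases "e = d - a")
      case True
      then have "tdeg w = a" using that(2) a by simp
      then show ?thesis using carry[OF that(1) _ q] True homog_hcomp_eq[of "d - a" q e] q by (simp add: gpiece_def)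
    next
      case False
      then show ?thesis using homog_hcomp_eq[of "d - a" q e] q is_ideal_0[OF iA] by (simp add: gpiece_def)
    qed
    then show "q \<in> gpiece (d - a) Q" using q by (simp add: gpiece_def Q_def)
  qed (auto simp: gpiece_def Q_def)
  then have 1: "lex_part m es (\<lambda>d. hdim d B) (d - a) = lex_part m es (\<lambda>d. hdim d Q) (d - a)"
    by (intro lex_part_cong) (simp add: hdim_def)
  have "gpiece d Q = gpiece d A"
  proof (intro equalityI subsetI)
    fix q assume q: "q \<in> gpiece d Q"
    then have "single 0 1 * hcomp d q \<in> A" by (simp add: gpiece_def Q_def del: single_one)
    then show "q \<in> gpiece d A" using q homog_hcomp_eq[of d q d] by (simp add: gpiece_def)
  qed (use AQ in \<open>auto simp: gpiece_def\<close>)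
  then have 2: "lex_part m es (\<lambda>d. hdim d A) d = lex_part m es (\<lambda>d. hdim d Q) d"
    by (intro lex_part_cong) (simp add: hdim_def)
  have "s \<in> lpp_mons m es (\<lambda>d. hdim d Q)" using s unfolding 1 lpp_mons_def by blast
  moreover have "w \<in> mons m" using w by (simp add: cap_mons_def)
  ultimately have "w + s \<in> lpp_mons m es (\<lambda>d. hdim d Q)" by (rule up_closed_add[OF up_closed_lpp_mons[OF g]])
  then show ?thesis unfolding 2 lpp_mons_cap_mons[OF g, symmetric] using w by (simp add: add.commute)
qed

text \<open>In degree \<open>d\<close>, \<open>U\<close> and the set glued from the lex-plus-powers
  ideals of the sections have equally many monomials outside the pure powers. The former is a
  segment there, so \<open>slice_0_le\<close> compares their monomials free of \<open>x_m\<close>.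
  The result is the inclusion of hyperplane sections that \<open>betti_compare\<close> asks
  for.\<close>

lemma hyperplane_section:
  fixes gs :: "'k::field mpoly list"
  assumes es: "length es \<le> m" "sorted es" and E: "EGH m gs es"
    and X: "homog_ideal (Suc m) X" "zgraded m X" and gs: "\<And>k. ideal_gen m (set gs) \<subseteq> zsec m k X"
    and carry: "\<And>k w q. k \<le> d \<Longrightarrow> w \<in> mons m \<Longrightarrow> tdeg w = k \<Longrightarrow> q \<in> gpiece (d - k) (zsec m k X)
      \<Longrightarrow> single w 1 * q \<in> zsec m 0 X"
    and T: "segment (cap_mons (Suc m) es d) (U \<inter> cap_mons (Suc m) es d)" "pow_mons (Suc m) es \<subseteq> U"
    and card: "card {t\<in>U. t \<in> mons (Suc m) \<and> tdeg t = d} = hdim d X"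
    and t: "t \<in> U" "t \<in> mons m" "tdeg t = d"
  shows "t \<in> lpp_mons m es (\<lambda>d. hdim d (zsec m 0 X))"
proof (cases "t \<in> pow_mons m es")
  case True then show ?thesis by (simp add: lpp_mons_def)
next
  case False
  define h where "h = (\<lambda>k d. hdim d (zsec m k X))"
  have zs: "homog_ideal m (zsec m k X)" for k by (rule homog_ideal_zsec[OF X(1)])
  have g: "lpp_growth m es (h k)" for k unfolding h_def by (rule EGH_lpp_growth[OF es E zs gs])
  let ?V = "{..<Suc m}" and ?e = "caps es d"
  have V: "?V - {m} = {..<m}" by auto
  have cd: "cdeg ?V ?e d = cap_mons (Suc m) es d" by (rule cdeg_caps) (use es in auto)
  have cd': "cdeg {..<m} ?e b = cap_mons m es b" if "b \<le> d" for b by (rule cdeg_caps) (use es that in auto)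
  define S where "S = zglue m es h \<inter> cap_mons (Suc m) es d"
  define T' where "T' = U \<inter> cap_mons (Suc m) es d"
  have cc: "card (W \<inter> cap_mons (Suc m) es d) = card {t\<in>W. t \<in> mons (Suc m) \<and> tdeg t = d} - card {t\<in>pow_mons (Suc m) es. tdeg t = d}"
    if "pow_mons (Suc m) es \<subseteq> W" for W
  proof -
    have "W \<inter> cap_mons (Suc m) es d = {t\<in>W. t \<in> mons (Suc m) \<and> tdeg t = d} - {t\<in>pow_mons (Suc m) es. tdeg t = d}"
      by (auto simp: cap_mons_def)
    moreover have "{t\<in>pow_mons (Suc m) es. tdeg t = d} \<subseteq> {t\<in>W. t \<in> mons (Suc m) \<and> tdeg t = d}"
      using that by (auto simp: pow_mons_def)
    moreover have "finite {t\<in>pow_mons (Suc m) es. tdeg t = d}"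
      by (rule finite_subset[OF _ finite_mons_deg[of "Suc m" d]]) (auto simp: pow_mons_def)
    ultimately show ?thesis by (simp add: card_Diff_subset)
  qed
  have cardTS: "card T' = card S"
    unfolding T'_def S_def cc[OF T(2)] cc[OF pow_mons_subset_zglue[OF es(1)]] card card_zglue[of m es h, OF g] hdim_zsec[OF X(2,1)]
    by (simp add: h_def)
  have slice: "slice m k S = lex_part m es (h k) (d - k)" if "k \<le> d" for k
  proof (intro equalityI subsetI)
    fix u assume u: "u \<in> slice m k S"
    then have u0: "lookup u m = 0" "u + single m k \<in> zglue m es h" "u + single m k \<in> cap_mons (Suc m) es d"
      by (auto simp: slice_iff S_def)
    have um: "u \<in> mons m" using u0(1,3) mons_Suc_iff[of u m] by (simp add: cap_mons_def)
    then have "u \<in> lpp_mons m es (h k)" using u0(2) zglue_iff[of m es h, OF g] by blast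
    moreover have "u \<in> cap_mons m es (d - k)" using u0(3) um pow_mons_add_last[OF es(1) um] by (auto simp: cap_mons_def)
    ultimately show "u \<in> lex_part m es (h k) (d - k)" unfolding lpp_mons_cap_mons[OF g, symmetric] by blast
  next
    fix u assume "u \<in> lex_part m es (h k) (d - k)"
    then have u: "u \<in> lpp_mons m es (h k)" "u \<in> cap_mons m es (d - k)" unfolding lpp_mons_cap_mons[OF g, symmetric] by auto
    have um: "u \<in> mons m" using u(2) by (simp add: cap_mons_def)
    have "u + single m k \<in> cap_mons (Suc m) es d"
      using u(2) pow_mons_add_last[OF es(1) um] mons_Suc_glue[OF um] that by (simp add: cap_mons_def)
    moreover have "u + single m k \<in> zglue m es h" using u(1) zglue_iff[of m es h, OF g um] by blast
    ultimately show "u \<in> slice m k S" using um by (simp add: slice_iff S_def mons_lookup)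
  qed
  have seg: "segment (cap_mons m es b) (lex_part m es (h k) b)" for k b
    by (rule lex_part(1)) (use g in \<open>simp add: lpp_growth_def\<close>)
  have S: "S \<subseteq> cdeg ?V ?e d" by (simp add: cd S_def)
  have "slice m 0 T' \<subseteq> slice m 0 S"
  proof (rule slice_0_le[of ?V m S ?e d T'])
    show "segment (cdeg ?V ?e d) T'" unfolding cd T'_def by (rule T(1))
    show "segment (cdeg (?V - {m}) ?e d) (slice m 0 S)"
      unfolding V cd'[OF order_refl] slice[OF le0] using seg[of d 0] by simp
    show "S \<subseteq> cdeg ?V ?e d" by (rule S)
    fix a s v assume s: "s \<in> slice m a S" and v: "v \<in> cdeg (?V - {m}) ?e d" "s \<le> v"
    have a: "a \<le> d" using slice_cdeg(2)[of m ?V S ?e d s a] S s by simp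
    have sl: "s \<in> lex_part m es (h a) (d - a)" using s slice[OF a] by simp
    then have "s \<in> cap_mons m es (d - a)" using seg unfolding segment_def by blast
    then have sc: "s \<in> cdeg {..<m} ?e (d - a)" using cd'[of "d - a"] by simp
    have vc: "v \<in> cdeg {..<m} ?e d" using v(1) V by simp
    \<comment> \<open>As in \<open>stable_compressed_lex\<close>, \<open>s\<close> is multiplied up
      to the degree of \<open>v\<close> without passing \<open>v\<close>. The loss of the factors
      \<open>x_m\<close> is now justified by \<open>carry\<close>, through
      \<open>lex_part_carry\<close>.\<close>
    have "\<exists>w. s + w \<in> capped {..<m} ?e \<and> tdeg (s + w) = tdeg v \<and> s + w \<le> v"
      by (rule fill) (use sc vc v(2) in \<open>auto simp: cdeg_def\<close>)
    then obtain w where w: "s + w \<in> capped {..<m} ?e" "tdeg (s + w) = tdeg v" "s + w \<le> v" by blast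
    have "s + w \<in> cdeg {..<m} ?e d" using w(1,2) vc by (simp add: cdeg_def)
    then have wg: "s + w \<in> cap_mons m es d" using cd'[of d] by simp
    have "s + w \<in> lex_part m es (\<lambda>d. hdim d (zsec m 0 X)) d"
      by (rule lex_part_carry[OF es E zs gs zs zsec_mono[OF homog_ideal_ideal[OF X(1)] le0] a _ sl[unfolded h_def] wg])
        (use carry[OF a] in blast)
    then have "v \<in> lex_part m es (h 0) d"
      using segmentD[OF seg[of d 0] _ _ w(3)] vc cd'[of d] by (simp add: h_def)
    then show "v \<in> slice m 0 S" using slice[of 0] by simp
  qed (use cardTS in auto)
  moreover have "t \<in> slice m 0 T'"
  proof -
    have "t \<notin> pow_mons (Suc m) es" using pow_mons_add_last[OF es(1) t(2), of 0] False by simp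
    then show ?thesis using t by (auto simp: slice_iff T'_def cap_mons_def mons_lookup)
  qed
  ultimately have "t \<in> lex_part m es (h 0) d" using slice[of 0] by auto
  then show ?thesis by (auto simp: lpp_mons_def h_def)
qed

section \<open>Koszul homology and the last variable\<close>

text \<open>A direct sum of copies of \<open>V\<close> indexed by \<open>F\<close>, encoded as
  functions on all sets. Koszul chains are the instance where \<open>F\<close> consists of the
  \<open>i\<close>-subsets, which makes their dimension a product.\<close>

definition chain_space :: "nat set set \<Rightarrow> 'k::field mpoly set \<Rightarrow> (nat set \<Rightarrow> 'k mpoly) set" where
  "chain_space F V = {f. \<forall>S. f S \<in> V \<and> (S \<notin> F \<longrightarrow> f S = 0)}"

definition subsets :: "nat \<Rightarrow> nat \<Rightarrow> nat set set" where
  "subsets m i = {S. S \<subseteq> {..<m} \<and> card S = i}"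

definition cycles :: "nat \<Rightarrow> 'k::field mpoly set \<Rightarrow> nat \<Rightarrow> nat \<Rightarrow> (nat set \<Rightarrow> 'k mpoly) set" where
  "cycles m I i j = {f\<in>kchains m I i j. kdiff m i f = (\<lambda>_. 0)}"

definition boundaries :: "nat \<Rightarrow> 'k::field mpoly set \<Rightarrow> nat \<Rightarrow> nat \<Rightarrow> (nat set \<Rightarrow> 'k mpoly) set" where
  "boundaries m I i j = kdiff m (Suc i) ` kchains m I (Suc i) j"

lemma betti_eq: "betti m I i j = cv.dim (cycles m I i j) - cv.dim (boundaries m I i j)"
  by (simp add: betti_def cycles_def boundaries_def)

lemma finite_subsets: "finite (subsets m i)"
  by (rule finite_subset[of _ "Pow {..<m}"]) (auto simp: subsets_def)

lemma kchains_eq_chain_space: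
  "i \<le> j \<Longrightarrow> kchains m I i j = chain_space (subsets m i) (gpiece (j - i) I)"
  by (auto simp: kchains_def chain_space_def subsets_def)

lemma kchains_trivial: "\<not> i \<le> j \<Longrightarrow> is_ideal m I \<Longrightarrow> kchains m I i j = {0}"
  by (auto simp: kchains_def gpiece_def is_ideal_0 fun_eq_iff)

lemma subspace_chain_space: "pv.subspace V \<Longrightarrow> cv.subspace (chain_space F V)"
  by (rule cv.subspaceI) (auto simp: chain_space_def pv.subspace_0 pv.subspace_add pv.subspace_scale lookup_cscale)

lemma mixed_pair: "vector_space_pair pscale cscale"
  by (intro vector_space_pair.intro pv.vector_space_axioms cv.vector_space_axioms)

lemma chain_pair: "vector_space_pair cscale cscale"
  by (intro vector_space_pair.intro cv.vector_space_axioms)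

lemma linear_at: "Vector_Spaces.linear pscale cscale (\<lambda>p T. if T = S then p else 0)"
  unfolding Vector_Spaces.linear_iff
  using pv.vector_space_axioms cv.vector_space_axioms by (auto simp: fun_eq_iff lookup_cscale)

lemma chain_space_singleton: "pv.subspace V \<Longrightarrow> chain_space {S} V = (\<lambda>p T. if T = S then p else 0) ` V"
proof (intro equalityI subsetI)
  fix f assume "f \<in> chain_space {S} V"
  then have "f = (\<lambda>T. if T = S then f S else 0)" "f S \<in> V" by (auto simp: chain_space_def fun_eq_iff)
  then show "f \<in> (\<lambda>p T. if T = S then p else 0) ` V" by (rule image_eqI)
qed (auto simp: chain_space_def pv.subspace_0 split: if_splits)

lemma fin_dim_chain_space:
  assumes "finite F" "pv.subspace V" "pv.fin_dim V" shows "cv.fin_dim (chain_space F V)"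
proof -
  obtain B where B: "finite B" "V \<subseteq> pv.span B" using assms(3) by (auto simp: pv.fin_dim_def)
  let ?e = "\<lambda>S p T. if T = S then p else 0"
  let ?C = "\<Union>S\<in>F. ?e S ` B"
  have "f \<in> cv.span ?C" if f: "f \<in> chain_space F V" for f
  proof -
    have "f = (\<Sum>S\<in>F. ?e S (f S))"
    proof
      fix T
      have "(\<Sum>S\<in>F. ?e S (f S)) T = (\<Sum>S\<in>F. if T = S then f S else 0)"
        by (induction F rule: infinite_finite_induct) auto
      also have "\<dots> = f T" using f assms(1) by (auto simp: chain_space_def sum.delta)
      finally show "f T = (\<Sum>S\<in>F. ?e S (f S)) T" by simp
    qed
    also have "\<dots> \<in> cv.span ?C"
    proof (rule cv.span_sum)
      fix S assume S: "S \<in> F"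
      have "f S \<in> pv.span B" using f B(2) by (auto simp: chain_space_def)
      then have "?e S (f S) \<in> cv.span (?e S ` B)"
        using vector_space_pair.linear_span_image[OF mixed_pair linear_at] by blast
      moreover have "cv.span (?e S ` B) \<subseteq> cv.span ?C" by (rule cv.span_mono) (use S in blast)
      ultimately show "?e S (f S) \<in> cv.span ?C" by blast
    qed
    finally show ?thesis .
  qed
  moreover have "finite ?C" using assms(1) B(1) by blast
  ultimately show ?thesis unfolding cv.fin_dim_def by blast
qed

lemma dim_chain_space:
  assumes "finite F" and V: "pv.subspace V" "pv.fin_dim V"
  shows "cv.dim (chain_space F V) = card F * pv.dim V"
  using assms(1)
proof (induction F rule: finite_induct)
  case empty
  have "chain_space {} V \<subseteq> {0}" by (auto simp: chain_space_def fun_eq_iff)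
  then show ?case using cv.dim_le_card[of "chain_space {} V" "{}"] by simp
next
  case (insert S F)
  let ?P = "\<lambda>f::nat set \<Rightarrow> 'a mpoly. (\<lambda>T. if T = S then f T else 0)"
  have lin: "Vector_Spaces.linear cscale cscale ?P"
    by (rule linear_cscaleI) (auto simp: fun_eq_iff lookup_cscale)
  have "{f\<in>chain_space (insert S F) V. ?P f = 0} = chain_space F V"
  proof (intro equalityI subsetI)
    fix f assume f: "f \<in> {f\<in>chain_space (insert S F) V. ?P f = 0}"
    then have "?P f = 0" by blast
    then have "?P f S = 0 S" by (rule fun_cong)
    then show "f \<in> chain_space F V" using f by (auto simp: chain_space_def)
  next
    fix f assume "f \<in> chain_space F V"
    then show "f \<in> {f\<in>chain_space (insert S F) V. ?P f = 0}"
      using insert.hyps(2) by (auto simp: chain_space_def fun_eq_iff)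
  qed
  moreover have "?P ` chain_space (insert S F) V = chain_space {S} V"
  proof (intro equalityI subsetI)
    fix f assume "f \<in> chain_space {S} V"
    then show "f \<in> ?P ` chain_space (insert S F) V"
      by (intro image_eqI[of _ _ f]) (auto simp: chain_space_def fun_eq_iff)
  qed (auto simp: chain_space_def pv.subspace_0[OF V(1)] split: if_splits)
  moreover have "cv.dim (chain_space {S} V) = pv.dim V"
    unfolding chain_space_singleton[OF V(1)]
    by (rule vector_space_pair.dim_image_inj[OF mixed_pair linear_at V]) (drule fun_cong[of _ _ S], simp)
  ultimately show ?case
    using vector_space_pair.rank_nullity[OF chain_pair lin subspace_chain_space[OF V(1)] fin_dim_chain_space[OF _ V], of "insert S F"]
      insert by simp
qed

lemma
  assumes "is_ideal m I"
  shows subspace_kchains: "cv.subspace (kchains m I i j)" and fin_dim_kchains: "cv.fin_dim (kchains m I i j)"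
proof -
  note V = subspace_gpiece[OF is_ideal_subspace[OF assms]] fin_dim_gpiece[OF is_ideal_subset[OF assms]]
  have "cv.subspace (kchains m I i j) \<and> cv.fin_dim (kchains m I i j)"
  proof (cases "i \<le> j")
    case True
    then show ?thesis unfolding kchains_eq_chain_space[OF True]
      using subspace_chain_space[OF V(1)] fin_dim_chain_space[OF finite_subsets V] by blast
  next
    case False
    have "cv.fin_dim {0}" unfolding cv.fin_dim_def by (rule exI[of _ "{}"]) simp
    then show ?thesis unfolding kchains_trivial[OF False assms] by (simp add: cv.subspace_single_0)
  qed
  then show "cv.subspace (kchains m I i j)" "cv.fin_dim (kchains m I i j)" by auto
qed

section \<open>The Koszul differential, its cycles and boundaries\<close>

lemma kdiff_add: "kdiff m i (f + g) = kdiff m i f + kdiff m i g"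
  by (rule ext) (simp add: kdiff_def distrib_left sum.distrib)

lemma kdiff_cscale: "kdiff m i (cscale c f) = cscale c (kdiff m i f)"
  by (rule ext) (simp add: kdiff_def lookup_cscale pscale_def sum_distrib_left mult.left_commute)

lemma linear_kdiff: "Vector_Spaces.linear cscale cscale (kdiff m i)"
  by (rule linear_cscaleI) (rule kdiff_add, rule kdiff_cscale)

lemma kdiff_0 [simp]: "kdiff m i 0 = 0"
  by (rule ext) (simp add: kdiff_def)

lemma sign_cases: "(- 1) ^ n = (1::'k::field mpoly) \<or> (- 1) ^ n = (- 1::'k mpoly)"
  by (cases "even n") auto

lemma sign_mult_ideal: "is_ideal m I \<Longrightarrow> p \<in> I \<Longrightarrow> (- 1) ^ n * p \<in> I"
  using sign_cases[of n] is_ideal_uminus[of m I p] by (metis mult_1 mult_minus1)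

lemma homog_sum: "(\<And>x. x \<in> A \<Longrightarrow> homog d (f x)) \<Longrightarrow> homog d (sum f A)"
  by (induction A rule: infinite_finite_induct) (auto intro: homog_add)

lemma homog_sign: "homog d p \<Longrightarrow> homog d ((- 1) ^ n * p)"
  using sign_cases[of n, where 'k='a] by (auto simp: homog_iff)

lemma homog_sign_var: "homog d p \<Longrightarrow> homog (Suc d) ((- 1) ^ n * var s * p)"
  using homog_sign[OF homog_mult[OF homog_var], of d p n s] by (simp add: mult.assoc)

lemma kdiff_kchains:
  assumes I: "is_ideal m I" and f: "f \<in> kchains m I (Suc i) j"
  shows "kdiff m (Suc i) f \<in> kchains m I i j"
proof (cases "Suc i \<le> j")
  case True
  have f': "f S \<in> gpiece (j - Suc i) I" for S using f by (auto simp: kchains_def)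
  have "kdiff m (Suc i) f T \<in> gpiece (j - i) I" for T
  proof -
    have "(- 1) ^ card {t\<in>T. t < s} * var s * f (insert s T) \<in> I" if "s < m" for s
      using f' sign_mult_ideal[OF I is_ideal_mult[OF I _ polys_var[OF that]]]
      by (auto simp: gpiece_def mult.assoc)
    moreover have "homog (j - i) ((- 1) ^ card {t\<in>T. t < s} * var s * f (insert s T))" for s
      using homog_sign_var[of "j - Suc i" "f (insert s T)" "card {t\<in>T. t < s}" s] f' True
      by (simp add: gpiece_def Suc_diff_Suc)
    ultimately show ?thesis
      unfolding kdiff_def gpiece_def using is_ideal_0[OF I] by (auto intro: is_ideal_sum[OF I] homog_sum)
  qed
  then show ?thesis using True unfolding kchains_def by (auto simp: kdiff_def split: if_splits)
next
  case False
  then have "f = 0" using kchains_trivial[OF False I] f by simp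
  then have "kdiff m (Suc i) f = 0" by simp
  then show ?thesis using cv.subspace_0[OF subspace_kchains[OF I]] by simp
qed

text \<open>The terms for \<open>(s, r)\<close> and \<open>(r, s)\<close> cancel. The induction adds
  a new index together with all its pairs; adding the whole sum to its mirror image would only show
  that twice the sum vanishes, which says nothing in characteristic 2.\<close>

lemma antisymmetric_sum_zero:
  fixes g :: "nat \<Rightarrow> nat \<Rightarrow> 'b::ab_group_add"
  assumes "finite D" "\<And>s r. s \<in> D \<Longrightarrow> r \<in> D \<Longrightarrow> s \<noteq> r \<Longrightarrow> g s r + g r s = 0"
  shows "(\<Sum>s\<in>D. \<Sum>r\<in>D - {s}. g s r) = 0"
  using assms
proof (induction D rule: finite_induct)
  case (insert x D)
  have 1: "(\<Sum>r\<in>insert x D - {s}. g s r) = g s x + (\<Sum>r\<in>D - {s}. g s r)" if "s \<in> D" for s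
  proof -
    have "insert x D - {s} = insert x (D - {s})" using that insert.hyps(2) by auto
    then show ?thesis using insert.hyps by simp
  qed
  have "insert x D - {x} = D" using insert.hyps by auto
  then have "(\<Sum>s\<in>insert x D. \<Sum>r\<in>insert x D - {s}. g s r)
    = (\<Sum>r\<in>D. g x r) + (\<Sum>s\<in>D. g s x + (\<Sum>r\<in>D - {s}. g s r))"
    using insert.hyps 1 by simp
  also have "\<dots> = (\<Sum>r\<in>D. g x r + g r x) + (\<Sum>s\<in>D. \<Sum>r\<in>D - {s}. g s r)"
    by (simp add: sum.distrib add.assoc)
  also have "(\<Sum>r\<in>D. g x r + g r x) = 0" by (rule sum.neutral) (use insert in auto)
  finally show ?case using insert by simp
qed simp

lemma card_less_insert:
  assumes "finite T" "s \<notin> T"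
  shows "card {t\<in>insert s T. t < r} = card {t\<in>T. t < r} + (if s < r then 1 else 0)"
proof (cases "s < r")
  case True
  then have "{t\<in>insert s T. t < r} = insert s {t\<in>T. t < r}" by auto
  then show ?thesis using assms True by simp
next
  case False
  then have "{t\<in>insert s T. t < r} = {t\<in>T. t < r}" by auto
  then show ?thesis using False by simp
qed

lemma kdiff_kdiff: "kdiff m i (kdiff m (Suc i) f) = 0"
proof
  fix T
  show "kdiff m i (kdiff m (Suc i) f) T = 0 T"
  proof (cases "0 < i \<and> T \<subseteq> {..<m} \<and> card T = i - 1")
    case False then show ?thesis by (simp only: kdiff_def[of m i] False if_False zero_fun_def)
  next
    case True
    let ?D = "{..<m} - T"
    have fT: "finite T" using True finite_subset by blast
    let ?\<sigma> = "\<lambda>s T. card {t\<in>T. t < s}"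
    let ?g = "\<lambda>s r. (- 1) ^ ?\<sigma> s T * var s * ((- 1) ^ ?\<sigma> r (insert s T) * var r * f (insert r (insert s T)))"
    have "kdiff m i (kdiff m (Suc i) f) T = (\<Sum>s\<in>?D. (- 1) ^ ?\<sigma> s T * var s * kdiff m (Suc i) f (insert s T))"
      using True by (simp add: kdiff_def[of m i])
    also have "\<dots> = (\<Sum>s\<in>?D. \<Sum>r\<in>?D - {s}. ?g s r)"
    proof (rule sum.cong[OF refl])
      fix s assume s: "s \<in> ?D"
      have "insert s T \<subseteq> {..<m}" "card (insert s T) = i" using s True fT by auto
      moreover have "{..<m} - insert s T = ?D - {s}" by auto
      ultimately show "(- 1) ^ ?\<sigma> s T * var s * kdiff m (Suc i) f (insert s T) = (\<Sum>r\<in>?D - {s}. ?g s r)"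
        by (simp add: kdiff_def sum_distrib_left)
    qed
    also have "\<dots> = 0"
    proof (rule antisymmetric_sum_zero)
      fix s r assume s: "s \<in> ?D" and r: "r \<in> ?D" and sr: "s \<noteq> r"
      let ?p = "var s * var r * f (insert r (insert s T))"
      have e1: "?g s r = (- 1) ^ (?\<sigma> s T + ?\<sigma> r (insert s T)) * ?p" by (simp add: power_add ac_simps)
      have e2: "?g r s = (- 1) ^ (?\<sigma> r T + ?\<sigma> s (insert r T)) * ?p"
        by (simp add: power_add ac_simps insert_commute)
      \<comment> \<open>Inserting the smaller of \<open>s\<close> and \<open>r\<close> shifts the
        position of the larger one, not conversely, so exactly one of the two exponents picks up an
        extra 1.\<close>
      have e3: "(- 1) ^ (?\<sigma> r T + ?\<sigma> s (insert r T)) = (- ((- 1) ^ (?\<sigma> s T + ?\<sigma> r (insert s T))) :: 'a mpoly)"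
        using card_less_insert[OF fT, of s r] card_less_insert[OF fT, of r s] s r sr
        by (cases s r rule: linorder_cases) (simp_all add: power_add)
      show "?g s r + ?g r s = 0" unfolding e1 e2 e3 by simp
    qed simp
    finally show ?thesis by simp
  qed
qed

lemma cycles_subset: "cycles m I i j \<subseteq> kchains m I i j"
  by (auto simp: cycles_def)

lemma boundaries_subset: "is_ideal m I \<Longrightarrow> boundaries m I i j \<subseteq> cycles m I i j"
  using kdiff_kchains kdiff_kdiff by (fastforce simp: boundaries_def cycles_def zero_fun_def)

lemma subspace_cycles: "is_ideal m I \<Longrightarrow> cv.subspace (cycles m I i j)"
  using subspace_kchains[of m I i j] unfolding cv.subspace_def cycles_def
  by (auto simp: kdiff_add kdiff_cscale zero_fun_def[symmetric])

lemma fin_dim_cycles: "is_ideal m I \<Longrightarrow> cv.fin_dim (cycles m I i j)"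
  by (rule cv.fin_dim_subset[OF fin_dim_kchains cycles_subset])

lemma subspace_boundaries: "is_ideal m I \<Longrightarrow> cv.subspace (boundaries m I i j)"
  unfolding boundaries_def
  by (rule vector_space_pair.linear_subspace_image[OF chain_pair linear_kdiff subspace_kchains])

lemma fin_dim_boundaries: "is_ideal m I \<Longrightarrow> cv.fin_dim (boundaries m I i j)"
  by (rule cv.fin_dim_subset[OF fin_dim_cycles boundaries_subset])

lemma dim_boundaries_le: "is_ideal m I \<Longrightarrow> cv.dim (boundaries m I i j) \<le> cv.dim (cycles m I i j)"
  by (rule cv.dim_le_of_subset[OF boundaries_subset fin_dim_cycles])

text \<open>A basis element \<open>e_S\<close> with \<open>m \<in> S\<close> counts as one power of
  \<open>x_m\<close>. With these weights the Koszul differential, which trades \<open>e_m\<close>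
  for a factor \<open>x_m\<close>, preserves the grading, as \<open>zchain_kdiff\<close>
  states.\<close>

definition zchain :: "nat \<Rightarrow> nat \<Rightarrow> (nat set \<Rightarrow> 'k::field mpoly) \<Rightarrow> (nat set \<Rightarrow> 'k mpoly)" where
  "zchain m k f S = (if m \<in> S then (if k = 0 then 0 else zcomp m (k - 1) (f S)) else zcomp m k (f S))"

lemma zcomp_pscale: "zcomp m k (pscale c p) = pscale c (zcomp m k p)"
  by (simp add: zcomp_def restr_pscale)

lemma zcomp_sum: "zcomp m k (sum f A) = (\<Sum>x\<in>A. zcomp m k (f x))"
  by (simp add: zcomp_def restr_sum)

lemma zcomp_sign: "zcomp m k ((- 1) ^ n * p) = (- 1) ^ n * zcomp m k p"
  using sign_cases[of n, where 'k='a] by (auto simp: zcomp_def restr_uminus)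

lemma zcomp_var: "zcomp m k (var s * p) = (if s = m then (if k = 0 then 0 else var m * zcomp m (k - 1) p) else var s * zcomp m k p)"
  unfolding var_def zcomp_single_mult by (auto simp: lookup_single)

lemma linear_zchain: "Vector_Spaces.linear cscale cscale (zchain m k)"
  by (rule linear_cscaleI) (auto simp: zchain_def fun_eq_iff zcomp_add zcomp_pscale lookup_cscale)

lemma zchain_kdiff: "zchain m k (kdiff n i f) = kdiff n i (zchain m k f)"
proof
  fix T
  show "zchain m k (kdiff n i f) T = kdiff n i (zchain m k f) T"
  proof (cases "0 < i \<and> T \<subseteq> {..<n} \<and> card T = i - 1")
    case False then show ?thesis by (auto simp: kdiff_def zchain_def)
  next
    case True
    let ?k = "\<lambda>k. \<Sum>s\<in>{..<n} - T. (- 1) ^ card {t\<in>T. t < s} * zcomp m k (var s * f (insert s T))"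
    have e: "zcomp m k (kdiff n i f T) = ?k k" for k
      using True by (simp add: kdiff_def zcomp_sum zcomp_sign mult.assoc)
    have r: "kdiff n i (zchain m k f) T = (\<Sum>s\<in>{..<n} - T. (- 1) ^ card {t\<in>T. t < s} * (var s * zchain m k f (insert s T)))"
      using True by (simp add: kdiff_def mult.assoc)
    show ?thesis
    proof (cases "m \<in> T")
      case mT: True
      have "(if k = 0 then 0 else zcomp m (k - 1) (var s * f (insert s T))) = var s * zchain m k f (insert s T)"
        if "s \<in> {..<n} - T" for s
        using that mT by (auto simp: zchain_def zcomp_var)
      then show ?thesis unfolding r using mT e[of "k - 1"] by (auto simp: zchain_def intro!: sum.cong)
    next
      case mT: False
      have "zcomp m k (var s * f (insert s T)) = var s * zchain m k f (insert s T)"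
        if "s \<in> {..<n} - T" for s
        using that mT by (auto simp: zchain_def zcomp_var)
      then show ?thesis unfolding r using mT e[of k] by (auto simp: zchain_def intro!: sum.cong)
    qed
  qed
qed

lemma zchain_zchain: "zchain m k (zchain m l f) = (if k = l then zchain m k f else 0)"
  by (auto simp: zchain_def fun_eq_iff zcomp_zcomp)

text \<open>The coefficients have degree \<open>j - i\<close>, and \<open>e_m\<close> may add one to
  the weight, so all weights lie between 0 and \<open>j + 1\<close>.\<close>

lemma zchain_faithful:
  assumes "f \<in> kchains n I i j" "\<And>k. k < j + 2 \<Longrightarrow> zchain m k f = 0"
  shows "f = 0"
proof
  fix S
  have h: "homog (j - i) (f S)" using assms(1) by (auto simp: kchains_def gpiece_def)
  have "zcomp m k (f S) = 0" if "k < Suc (j - i)" for k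
  proof (cases "m \<in> S")
    case True then show ?thesis using fun_cong[OF assms(2)[of "Suc k"], of S] that by (simp add: zchain_def)
  next
    case False then show ?thesis using fun_cong[OF assms(2)[of k], of S] that by (simp add: zchain_def)
  qed
  then show "f S = 0 S" using zcomp_faithful[OF h, of m] by simp
qed

lemma init_lift:
  assumes I: "homog_ideal (Suc m) I" and p: "p \<in> init m I" "homog d p"
  shows "\<exists>q\<in>gpiece d I. (\<forall>j<k. zcomp m j q = 0) \<and> zcomp m k q = zcomp m k p"
proof -
  obtain q where q: "q \<in> I" "\<forall>j<k. zcomp m j q = 0" "zcomp m k q = zcomp m k p"
    using p(1) by (auto simp: init_def)
  have "hcomp d q \<in> gpiece d I" using homog_ideal_hcomp[OF I q(1)] homog_hcomp by (simp add: gpiece_def)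
  moreover have "zcomp m k (hcomp d q) = zcomp m k p"
    unfolding zcomp_hcomp q(3) using homog_hcomp_eq[OF homog_zcomp[OF p(2)]] by simp
  moreover have "\<forall>j<k. zcomp m j (hcomp d q) = 0" using q(2) by (simp add: zcomp_hcomp)
  ultimately show ?thesis by blast
qed

text \<open>Passing to initial components can only enlarge the cycles and
  shrink the boundaries.\<close>

theorem betti_init:
  assumes I: "homog_ideal (Suc m) (I :: 'k::field mpoly set)"
  shows "betti (Suc m) I i j \<le> betti (Suc m) (init m I) i j"
proof -
  let ?n = "Suc m"
  have iI: "is_ideal ?n I" and iX: "is_ideal ?n (init m I)"
    using homog_ideal_ideal[OF I] homog_ideal_ideal[OF homog_ideal_init[OF I]] by auto
  have "cv.dim (cycles ?n I i j) \<le> cv.dim (cycles ?n (init m I) i j)"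
  proof (rule cv.dim_le_of_initial_le[of "zchain m" _ _ "j + 2", OF linear_zchain subspace_cycles[OF iI]
      fin_dim_cycles[OF iI] subspace_cycles[OF iX] fin_dim_cycles[OF iX]])
    show "w = 0" if "w \<in> cycles ?n I i j" "\<And>k. k < j + 2 \<Longrightarrow> zchain m k w = 0" for w
      using zchain_faithful[OF _ that(2)] that(1) cycles_subset by blast
    show "w = 0" if "w \<in> cycles ?n (init m I) i j" "\<And>k. k < j + 2 \<Longrightarrow> zchain m k w = 0" for w
      using zchain_faithful[OF _ that(2)] that(1) cycles_subset by blast
    show "initial (zchain m) k (cycles ?n I i j) \<subseteq> initial (zchain m) k (cycles ?n (init m I) i j)" for k
    proof
      fix g assume "g \<in> initial (zchain m) k (cycles ?n I i j)"
      then obtain f where f: "f \<in> kchains ?n I i j" "kdiff ?n i f = 0" "\<forall>l<k. zchain m l f = 0" "g = zchain m k f"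
        by (auto simp: initial_def cycles_def zero_fun_def)
      have fS: "f S \<in> I" "homog (j - i) (f S)" for S using f(1) by (auto simp: kchains_def gpiece_def)
      have "g S \<in> init m I" for S
      proof -
        have w: "zcomp m l (f S) \<in> init m I" if "\<And>l'. l' < l \<Longrightarrow> zcomp m l' (f S) = 0" for l
          by (rule init_witness[of _ m l "f S"])
            (use that fS(1) is_ideal_polys[OF iI] is_ideal_0[OF iI] in \<open>auto simp: zcomp_zcomp intro: polys_zcomp\<close>)
        show ?thesis
        proof (cases "m \<in> S")
          case True
          have "zcomp m l' (f S) = 0" if "l' < k - 1" for l'
            using fun_cong[OF f(3)[rule_format, of "Suc l'"], of S] that True by (simp add: zchain_def)
          then show ?thesis using w[of "k - 1"] True is_ideal_0[OF iX] by (simp add: f(4) zchain_def)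
        next
          case False
          have "zcomp m l' (f S) = 0" if "l' < k" for l'
            using fun_cong[OF f(3)[rule_format, of l'], of S] that False by (simp add: zchain_def)
          then show ?thesis using w[of k] False by (simp add: f(4) zchain_def)
        qed
      qed
      moreover have "homog (j - i) (g S)" for S using fS(2) by (simp add: f(4) zchain_def homog_zcomp)
      moreover have "g S \<noteq> 0 \<Longrightarrow> f S \<noteq> 0" for S by (auto simp: f(4) zchain_def split: if_splits)
      ultimately have "g \<in> kchains ?n (init m I) i j" using f(1) unfolding kchains_def gpiece_def by blast
      moreover have "kdiff ?n i g = 0"
        unfolding f(4) zchain_kdiff[symmetric] f(2) by (auto simp: zchain_def fun_eq_iff)
      ultimately have "g \<in> cycles ?n (init m I) i j" by (simp add: cycles_def zero_fun_def)
      moreover have "\<forall>l<k. zchain m l g = 0" "zchain m k g = g" by (auto simp: f(4) zchain_zchain)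
      ultimately show "g \<in> initial (zchain m) k (cycles ?n (init m I) i j)"
        unfolding initial_def by (intro image_eqI[of _ _ g]) auto
    qed
  qed
  moreover have "cv.dim (boundaries ?n (init m I) i j) \<le> cv.dim (boundaries ?n I i j)"
  proof (rule cv.dim_le_of_initial_le[of "zchain m" _ _ "j + 2", OF linear_zchain subspace_boundaries[OF iX]
      fin_dim_boundaries[OF iX] subspace_boundaries[OF iI] fin_dim_boundaries[OF iI]])
    show "w = 0" if "w \<in> boundaries ?n I i j" "\<And>k. k < j + 2 \<Longrightarrow> zchain m k w = 0" for w
      using zchain_faithful[OF _ that(2)] that(1) boundaries_subset[OF iI] cycles_subset by blast
    show "w = 0" if "w \<in> boundaries ?n (init m I) i j" "\<And>k. k < j + 2 \<Longrightarrow> zchain m k w = 0" for w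
      using zchain_faithful[OF _ that(2)] that(1) boundaries_subset[OF iX] cycles_subset by blast
    show "initial (zchain m) k (boundaries ?n (init m I) i j) \<subseteq> initial (zchain m) k (boundaries ?n I i j)" for k
    proof
      fix x assume "x \<in> initial (zchain m) k (boundaries ?n (init m I) i j)"
      then obtain g where g: "g \<in> kchains ?n (init m I) (Suc i) j" "x = zchain m k (kdiff ?n (Suc i) g)"
        by (auto simp: initial_def boundaries_def)
      \<comment> \<open>The exponent of \<open>x_m\<close> that belongs to weight \<open>k\<close>
        in the coefficient of \<open>e_S\<close>. For \<open>k = 0\<close> and
        \<open>m \<in> S\<close> there is no such exponent, since \<open>k - 1\<close> is truncated,
        and \<open>G\<close> is set to 0 there.\<close>
      define k' where "k' = (\<lambda>S. if m \<in> S then k - 1 else k)"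
      have gS: "g S \<in> init m I" "homog (j - Suc i) (g S)" for S using g(1) by (auto simp: kchains_def gpiece_def)
      have "\<forall>S. \<exists>q. q \<in> gpiece (j - Suc i) I \<and> (\<forall>l<k' S. zcomp m l q = 0) \<and> zcomp m (k' S) q = zcomp m (k' S) (g S)"
        using init_lift[OF I gS] by blast
      then obtain G0 where G0: "\<And>S. G0 S \<in> gpiece (j - Suc i) I" "\<And>S l. l < k' S \<Longrightarrow> zcomp m l (G0 S) = 0"
        "\<And>S. zcomp m (k' S) (G0 S) = zcomp m (k' S) (g S)" by metis
      define G where "G = (\<lambda>S. if g S = 0 \<or> (m \<in> S \<and> k = 0) then 0 else G0 S)"
      have "G \<in> kchains ?n I (Suc i) j"
        using g(1) G0(1) is_ideal_0[OF iI] unfolding kchains_def G_def by (auto simp: gpiece_def)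
      moreover have "zchain m k G = zchain m k g"
      proof
        fix S
        show "zchain m k G S = zchain m k g S"
          using G0(3)[of S] by (cases "g S = 0") (auto simp: zchain_def G_def k'_def)
      qed
      moreover have "\<forall>l<k. zchain m l G = 0"
        using G0(2) by (auto simp: zchain_def fun_eq_iff G_def k'_def)
      ultimately show "x \<in> initial (zchain m) k (boundaries ?n I i j)"
        unfolding initial_def boundaries_def g(2) zchain_kdiff
        by (intro image_eqI[of _ _ "kdiff ?n (Suc i) G"]) (auto simp: zchain_kdiff)
    qed
  qed
  ultimately show ?thesis unfolding betti_eq by arith
qed

section \<open>Koszul chains modulo the last variable\<close>

definition drop_last :: "nat \<Rightarrow> (nat set \<Rightarrow> 'k::field mpoly) \<Rightarrow> (nat set \<Rightarrow> 'k mpoly)" where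
  "drop_last m f S = (if m \<in> S then 0 else f S)"

definition ctrunc :: "nat \<Rightarrow> (nat set \<Rightarrow> 'k::field mpoly) \<Rightarrow> (nat set \<Rightarrow> 'k mpoly)" where
  "ctrunc m f S = trunc m (f S)"

lemma trunc_add: "trunc m (p + q) = trunc m p + trunc m q"
  and trunc_0 [simp]: "trunc m 0 = 0"
  and trunc_diff: "trunc m (p - q) = trunc m p - trunc m q"
  and trunc_uminus: "trunc m (- p) = - trunc m p"
  and trunc_pscale: "trunc m (pscale c p) = pscale c (trunc m p)"
  and trunc_sum: "trunc m (sum f A) = (\<Sum>x\<in>A. trunc m (f x))"
  by (simp_all add: trunc_restr restr_add restr_diff restr_uminus restr_pscale restr_sum)

lemma trunc_sign: "trunc m ((- 1) ^ n * p) = (- 1) ^ n * trunc m p"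
  using sign_cases[of n, where 'k='a] by (auto simp: trunc_uminus)

lemma trunc_var_mult: "trunc m (var s * p) = (if s < m then var s * trunc m p else 0)"
proof (cases "s < m")
  case True then show ?thesis by (simp add: var_def trunc_single_mult mons_single_iff)
next
  case False
  then have "restr (\<lambda>u. xv s + u \<in> mons m) p = 0"
    by (intro poly_mapping_eqI) (simp add: mons_single_iff)
  then show ?thesis using False by (simp add: trunc_restr var_def restr_single_mult del: mons_add_iff)
qed

lemma linear_trunc: "Vector_Spaces.linear pscale pscale (trunc m)"
  unfolding trunc_restr by (rule linear_restr)

lemma homog_trunc: "homog d p \<Longrightarrow> homog d (trunc m p)"
  unfolding trunc_restr by (rule homog_restr)

lemma linear_drop_last: "Vector_Spaces.linear cscale cscale (drop_last m)"
  by (rule linear_cscaleI) (auto simp: drop_last_def fun_eq_iff lookup_cscale)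

lemma linear_ctrunc: "Vector_Spaces.linear cscale cscale (ctrunc m)"
  by (rule linear_cscaleI) (auto simp: ctrunc_def fun_eq_iff lookup_cscale trunc_add trunc_pscale)

lemma var_mult_eq_0: "var m * (q :: 'k::field mpoly) = 0 \<longleftrightarrow> q = 0"
  using var_power_mult_eq_0[of m 1 q] by simp

lemma sign_mult_eq_0: "(- 1) ^ n * (p :: 'k::field mpoly) = 0 \<longleftrightarrow> p = 0"
  using sign_cases[of n, where 'k='k] by auto

lemma sign_sign: "(- 1) ^ n * ((- 1) ^ n * (p :: 'k::field mpoly)) = p"
  using sign_cases[of n, where 'k='k] by auto

text \<open>All elements of \<open>T\<close> precede \<open>m\<close>, so the sign of the new term
  depends on the size of \<open>T\<close> alone.\<close>

lemma kdiff_Suc: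
  assumes "T \<subseteq> {..<m}" "card T = i"
  shows "kdiff (Suc m) (Suc i) f T = kdiff m (Suc i) f T + (- 1) ^ i * (var m * f (insert m T))"
proof -
  have "finite T" using assms(1) finite_subset by blast
  have "{..<Suc m} - T = insert m ({..<m} - T)" using assms(1) by auto
  moreover have "{t\<in>T. t < m} = T" using assms(1) by auto
  moreover have "T \<subseteq> {..<Suc m}" using assms(1) by auto
  ultimately show ?thesis using assms by (simp add: kdiff_def mult.assoc add.commute)
qed

lemma kdiff_support: "kdiff m i f T \<noteq> 0 \<Longrightarrow> 0 < i \<and> T \<subseteq> {..<m} \<and> card T = i - 1"
  by (auto simp: kdiff_def split: if_splits)

lemma subset_less_Suc: "S \<subseteq> {..<Suc m} \<Longrightarrow> m \<notin> S \<Longrightarrow> S \<subseteq> {..<m}"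
  by (auto simp: less_Suc_eq)

text \<open>Discarding the part with \<open>e_m\<close> and setting \<open>x_m = 0\<close> is a
  chain map to the complex of the restricted ideal: a term leading from the discarded part back to
  the rest carries a factor \<open>x_m\<close>.\<close>

lemma drop_ctrunc_kdiff:
  "ctrunc m (drop_last m (kdiff (Suc m) i f)) = kdiff m i (ctrunc m (drop_last m f))"
proof
  fix T
  show "ctrunc m (drop_last m (kdiff (Suc m) i f)) T = kdiff m i (ctrunc m (drop_last m f)) T"
  proof (cases "0 < i \<and> T \<subseteq> {..<m} \<and> card T = i - 1")
    case False
    then have r: "kdiff m i (ctrunc m (drop_last m f)) T = 0" by (simp only: kdiff_def False if_False)
    have "m \<in> T \<or> kdiff (Suc m) i f T = 0"
      using False kdiff_support[of "Suc m" i f T] subset_less_Suc[of T m] by blast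
    then show ?thesis unfolding r by (auto simp: ctrunc_def drop_last_def)
  next
    case True
    then obtain i' where i: "i = Suc i'" "card T = i'" by (cases i) auto
    have mT: "m \<notin> T" using True by auto
    have "trunc m (kdiff (Suc m) i f T) = trunc m (kdiff m i f T)"
      unfolding i(1) using True i by (simp add: kdiff_Suc trunc_add trunc_sign trunc_var_mult)
    also have "\<dots> = kdiff m i (ctrunc m (drop_last m f)) T"
      using True mT by (auto simp: kdiff_def trunc_sum trunc_sign trunc_var_mult mult.assoc ctrunc_def drop_last_def
          intro!: sum.cong)
    finally show ?thesis using mT by (simp add: ctrunc_def drop_last_def)
  qed
qed

text \<open>This is where \<open>x\<^sub>m\<close> being a nonzerodivisor enters.\<close>

lemma cycle_vanish:
  assumes c: "kdiff (Suc m) k g = 0" and supp: "\<And>T. g T \<noteq> 0 \<Longrightarrow> T \<subseteq> {..<Suc m} \<and> card T = k"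
    and d: "drop_last m g = 0"
  shows "g = 0"
proof
  fix T
  show "g T = 0 T"
  proof (rule ccontr)
    assume "g T \<noteq> 0 T"
    then have gT: "g T \<noteq> 0" by simp
    then have mT: "m \<in> T" using fun_cong[OF d, of T] by (auto simp: drop_last_def split: if_splits)
    let ?T = "T - {m}"
    have fT: "finite T" using supp[OF gT] finite_subset by blast
    have "card T = k" using supp[OF gT] by blast
    then obtain k' where k: "k = Suc k'" using mT fT by (cases k) auto
    have T': "?T \<subseteq> {..<m}" "card ?T = k'" using supp[OF gT] mT fT k by (auto simp: less_Suc_eq)
    have z: "g (insert s ?T) = 0" if "s \<in> {..<m} - ?T" for s
      using fun_cong[OF d, of "insert s ?T"] that by (auto simp: drop_last_def split: if_splits)
    have "kdiff m (Suc k') g ?T = 0"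
      unfolding kdiff_def using z by (simp add: sum.neutral)
    moreover have "kdiff (Suc m) (Suc k') g ?T = 0" using c k by simp
    ultimately have "(- 1) ^ k' * (var m * g (insert m ?T)) = 0"
      using kdiff_Suc[OF T', of g] by simp
    then have "g (insert m ?T) = 0" unfolding sign_mult_eq_0 var_mult_eq_0 .
    then show False using gT mT by (simp add: insert_absorb)
  qed
qed

lemma kchains_support: "f \<in> kchains m I i j \<Longrightarrow> f S \<noteq> 0 \<Longrightarrow> S \<subseteq> {..<m} \<and> card S = i \<and> i \<le> j"
  and kchains_gpiece: "f \<in> kchains m I i j \<Longrightarrow> f S \<in> gpiece (j - i) I"
  by (auto simp: kchains_def)

lemma kchainsI:
  assumes "i \<le> j" "\<And>S. f S \<in> gpiece (j - i) I" "\<And>S. f S \<noteq> 0 \<Longrightarrow> S \<subseteq> {..<m} \<and> card S = i"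
  shows "f \<in> kchains m I i j"
  using assms by (auto simp: kchains_def)

lemma drop_ctrunc_kchains:
  assumes "f \<in> kchains (Suc m) I i j"
  shows "ctrunc m (drop_last m f) \<in> kchains m (trunc m ` I) i j"
proof -
  have "trunc m (if m \<in> S then 0 else f S) \<in> gpiece (j - i) (trunc m ` I)" for S
  proof (cases "m \<in> S")
    case False then show ?thesis using kchains_gpiece[OF assms, of S] by (auto simp: gpiece_def homog_trunc)
  next
    case True
    have "m \<notin> S - {m}" by simp
    \<comment> \<open>The infinite set \<open>UNIV\<close> does not support a chain, so the value
      there is 0. As values of chains lie in \<open>I\<close>, this yields
      \<open>0 \<in> I\<close>.\<close>
    have "f UNIV \<in> gpiece (j - i) I" using kchains_gpiece[OF assms] .
    moreover have "f UNIV = 0"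
      using kchains_support[OF assms, of UNIV] infinite_UNIV_nat finite_subset[of UNIV "{..<Suc m}"] by blast
    ultimately have "0 \<in> I" by (simp add: gpiece_def)
    then show ?thesis using True by (auto simp: gpiece_def intro: image_eqI[of _ _ 0])
  qed
  moreover have "ctrunc m (drop_last m f) S \<noteq> 0 \<Longrightarrow> S \<subseteq> {..<m} \<and> card S = i \<and> i \<le> j" for S
  proof -
    assume "ctrunc m (drop_last m f) S \<noteq> 0"
    then have "m \<notin> S" "f S \<noteq> 0" by (auto simp: ctrunc_def drop_last_def split: if_splits)
    then show ?thesis using kchains_support[OF assms, of S] subset_less_Suc[of S m] by blast
  qed
  ultimately show ?thesis unfolding kchains_def by (auto simp: ctrunc_def drop_last_def)
qed

lemma trunc_lift:
  assumes I: "homog_ideal (Suc m) I" and q: "q \<in> gpiece d (trunc m ` I)"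
  shows "\<exists>p\<in>gpiece d I. trunc m p = q"
proof -
  obtain p where p: "p \<in> I" "q = trunc m p" "homog d q" using q by (auto simp: gpiece_def)
  have "trunc m (hcomp d p) = hcomp d (trunc m p)"
    by (rule poly_mapping_eqI) (simp add: trunc_restr hcomp_restr)
  then have "trunc m (hcomp d p) = q" using p(2) homog_hcomp_eq[OF p(3), of d] by simp
  moreover have "hcomp d p \<in> gpiece d I" using homog_ideal_hcomp[OF I p(1)] homog_hcomp by (auto simp: gpiece_def)
  ultimately show ?thesis by blast
qed

lemma var_lift:
  assumes I: "homog_ideal n I" and q: "q \<in> gpiece d ((*) (var m) ` I)" "q \<noteq> 0"
  shows "0 < d \<and> (\<exists>p\<in>gpiece (d - 1) I. var m * p = q)"
proof -
  obtain p where p: "p \<in> I" "q = var m * p" "homog d q" using q(1) by (auto simp: gpiece_def)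
  have e: "q = hcomp d (var m * p)" using homog_hcomp_eq[OF p(3), of d] p(2) by simp
  then have d: "0 < d" using q(2) by (auto simp: var_def hcomp_single_mult split: if_splits)
  then have "q = var m * hcomp (d - 1) p" using e by (simp add: var_def hcomp_single_mult)
  moreover have "hcomp (d - 1) p \<in> gpiece (d - 1) I"
    using homog_ideal_hcomp[OF I p(1)] homog_hcomp by (auto simp: gpiece_def)
  ultimately show ?thesis using d by blast
qed

lemma kchains_trunc_surj:
  assumes I: "homog_ideal (Suc m) I" and h: "h \<in> kchains m (trunc m ` I) i j"
  shows "\<exists>g\<in>kchains (Suc m) I i j. ctrunc m (drop_last m g) = h"
proof -
  have "\<forall>S. \<exists>p. p \<in> gpiece (j - i) I \<and> trunc m p = h S"
    using trunc_lift[OF I kchains_gpiece[OF h]] by blast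
  then obtain G where G: "\<And>S. G S \<in> gpiece (j - i) I" "\<And>S. trunc m (G S) = h S" by metis
  define g where "g = (\<lambda>S. if h S = 0 then 0 else G S)"
  have "g \<in> kchains (Suc m) I i j"
    using kchains_support[OF h] G(1) is_ideal_0[OF homog_ideal_ideal[OF I]]
    unfolding kchains_def g_def by (force simp: gpiece_def)
  moreover have "ctrunc m (drop_last m g) = h"
  proof
    fix S
    have "h S = 0" if "m \<in> S" using kchains_support[OF h, of S] that by auto
    then show "ctrunc m (drop_last m g) S = h S" using G(2)[of S] by (auto simp: ctrunc_def drop_last_def g_def)
  qed
  ultimately show ?thesis by blast
qed

section \<open>Cycles and boundaries compared with those of the hyperplane section\<close>

abbreviation trunc_kernel :: "nat \<Rightarrow> 'k::field mpoly set \<Rightarrow> 'k mpoly set" where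
  "trunc_kernel m I \<equiv> {p\<in>I. trunc m p = 0}"

lemma subspace_trunc_kernel: "is_ideal n I \<Longrightarrow> pv.subspace (trunc_kernel m I)"
  by (rule pv.subspaceI) (auto simp: trunc_add trunc_pscale intro: is_ideal_0 is_ideal_add is_ideal_pscale)

lemma subspace_var_mult: "is_ideal n I \<Longrightarrow> pv.subspace ((*) (var m) ` I)"
  by (rule vector_space_pair.linear_subspace_image[OF poly_pair linear_mult is_ideal_subspace])

lemma dim_decompose:
  assumes V: "cv.subspace V" "cv.fin_dim V"
  shows "cv.dim (drop_last m ` V) = cv.dim {v\<in>drop_last m ` V. ctrunc m v = 0} + cv.dim (ctrunc m ` drop_last m ` V)"
  by (rule vector_space_pair.rank_nullity[OF chain_pair linear_ctrunc
      vector_space_pair.linear_subspace_image[OF chain_pair linear_drop_last V(1)]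
      vector_space_pair.fin_dim_image[OF chain_pair linear_drop_last V(2)]])

lemma fin_dim_drop_kernel:
  assumes "cv.fin_dim V" shows "cv.fin_dim {v\<in>drop_last m ` V. ctrunc m v = 0}"
  by (rule cv.fin_dim_subset[OF vector_space_pair.fin_dim_image[OF chain_pair linear_drop_last assms]]) auto

lemma fin_dim_ctrunc_drop: "cv.fin_dim V \<Longrightarrow> cv.fin_dim (ctrunc m ` drop_last m ` V)"
  by (intro vector_space_pair.fin_dim_image[OF chain_pair] linear_drop_last linear_ctrunc)

lemma dim_drop_last_cycles:
  assumes I: "is_ideal (Suc m) I" and V: "cv.subspace V" "V \<subseteq> cycles (Suc m) I i j"
  shows "cv.dim (drop_last m ` V) = cv.dim V"
proof (rule vector_space_pair.dim_image_inj[OF chain_pair linear_drop_last V(1)])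
  show "cv.fin_dim V" by (rule cv.fin_dim_subset[OF fin_dim_cycles[OF I] V(2)])
  fix v assume v: "v \<in> V" "drop_last m v = 0"
  then have c: "v \<in> kchains (Suc m) I i j" "kdiff (Suc m) i v = 0"
    using V(2) by (auto simp: cycles_def zero_fun_def)
  show "v = 0" by (rule cycle_vanish[OF c(2) _ v(2)]) (use kchains_support[OF c(1)] in blast)
qed

lemma dim_chain_space_gpiece:
  assumes "pv.subspace X" "X \<subseteq> polys n"
  shows "cv.dim (chain_space (subsets m i) (gpiece d X)) = card (subsets m i) * hdim d X"
    and "cv.fin_dim (chain_space (subsets m i) (gpiece d X))"
  unfolding hdim_def
  using dim_chain_space[OF finite_subsets subspace_gpiece[OF assms(1)] fin_dim_gpiece[OF assms(2)]]
    fin_dim_chain_space[OF finite_subsets subspace_gpiece[OF assms(1)] fin_dim_gpiece[OF assms(2)]] by auto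

text \<open>By \<open>cycle_vanish\<close> a cycle is determined by its part without
  \<open>e_m\<close>. Setting \<open>x_m = 0\<close> sends these parts to cycles of the restricted
  ideal; those sent to 0 have all coefficients in \<open>trunc_kernel m I\<close>, one for each
  \<open>i\<close>-subset of the first \<open>m\<close> indices.\<close>

lemma dim_cycles_le:
  assumes I: "homog_ideal (Suc m) I" and ij: "i \<le> j"
  shows "cv.dim (cycles (Suc m) I i j)
    \<le> cv.dim (cycles m (trunc m ` I) i j) + card (subsets m i) * hdim (j - i) (trunc_kernel m I)"
proof -
  have iI: "is_ideal (Suc m) I" by (rule homog_ideal_ideal[OF I])
  have i0: "is_ideal m (trunc m ` I)" by (rule homog_ideal_ideal[OF homog_ideal_trunc[OF I]])
  let ?V = "cycles (Suc m) I i j"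
  have "{v\<in>drop_last m ` ?V. ctrunc m v = 0} \<subseteq> chain_space (subsets m i) (gpiece (j - i) (trunc_kernel m I))"
  proof
    fix v assume "v \<in> {v\<in>drop_last m ` ?V. ctrunc m v = 0}"
    then obtain f where f: "f \<in> kchains (Suc m) I i j" "v = drop_last m f" "ctrunc m v = 0" by (auto simp: cycles_def)
    have "v S \<in> gpiece (j - i) (trunc_kernel m I)" for S
      using fun_cong[OF f(3), of S] kchains_gpiece[OF f(1), of S] is_ideal_0[OF iI]
      by (auto simp: f(2) drop_last_def ctrunc_def gpiece_def)
    moreover have "v S = 0" if "S \<notin> subsets m i" for S
      using that kchains_support[OF f(1), of S] subset_less_Suc[of S m] by (auto simp: f(2) drop_last_def subsets_def)
    ultimately show "v \<in> chain_space (subsets m i) (gpiece (j - i) (trunc_kernel m I))" by (simp add: chain_space_def)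
  qed
  moreover have k: "trunc_kernel m I \<subseteq> polys (Suc m)" using is_ideal_subset[OF iI] by auto
  ultimately have "cv.dim {v\<in>drop_last m ` ?V. ctrunc m v = 0}
      \<le> cv.dim (chain_space (subsets m i) (gpiece (j - i) (trunc_kernel m I)))"
    by (intro cv.dim_le_of_subset dim_chain_space_gpiece(2)[OF subspace_trunc_kernel[OF iI]])
  then have 1: "cv.dim {v\<in>drop_last m ` ?V. ctrunc m v = 0} \<le> card (subsets m i) * hdim (j - i) (trunc_kernel m I)"
    unfolding dim_chain_space_gpiece(1)[OF subspace_trunc_kernel[OF iI] k] .
  have "ctrunc m ` drop_last m ` ?V \<subseteq> cycles m (trunc m ` I) i j"
  proof (rule subsetI)
    fix v assume "v \<in> ctrunc m ` drop_last m ` ?V"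
    then obtain f where f: "f \<in> kchains (Suc m) I i j" "kdiff (Suc m) i f = 0" "v = ctrunc m (drop_last m f)"
      by (auto simp: cycles_def zero_fun_def)
    have "kdiff m i v = 0" unfolding f(3) drop_ctrunc_kdiff[symmetric] f(2) by (auto simp: ctrunc_def drop_last_def)
    then show "v \<in> cycles m (trunc m ` I) i j" using drop_ctrunc_kchains[OF f(1)] f(3) by (simp add: cycles_def zero_fun_def)
  qed
  then have 2: "cv.dim (ctrunc m ` drop_last m ` ?V) \<le> cv.dim (cycles m (trunc m ` I) i j)"
    by (rule cv.dim_le_of_subset[OF _ fin_dim_cycles[OF i0]])
  show ?thesis
    using 1 2 dim_decompose[OF subspace_cycles[OF iI] fin_dim_cycles[OF iI], of m i j]
      dim_drop_last_cycles[OF iI subspace_cycles[OF iI] subset_refl] by simp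
qed

text \<open>For \<open>p\<close> in \<open>I\<close>, the chain with coefficient
  \<open>x_m p\<close> at \<open>e_S\<close> is, up to sign and up to terms with \<open>e_m\<close>,
  the boundary of the chain with coefficient \<open>p\<close> at \<open>e_S\<close> joined with
  \<open>e_m\<close>. So all chains with coefficients in \<open>x_m I\<close> occur among the parts
  killed by \<open>x_m = 0\<close>. Boundaries of the restricted ideal are reached because chains
  lift.\<close>

lemma dim_boundaries_ge:
  assumes I: "homog_ideal (Suc m) I" and ij: "i \<le> j"
  shows "cv.dim (boundaries m (trunc m ` I) i j) + card (subsets m i) * hdim (j - i) ((*) (var m) ` I)
    \<le> cv.dim (boundaries (Suc m) I i j)"
proof -
  have iI: "is_ideal (Suc m) I" by (rule homog_ideal_ideal[OF I])
  let ?V = "boundaries (Suc m) I i j"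
  let ?Z = "(*) (var m) ` I"
  have Zp: "?Z \<subseteq> polys (Suc m)" using is_ideal_subset[OF iI] by (auto intro: polys_mult polys_var)
  have "chain_space (subsets m i) (gpiece (j - i) ?Z) \<subseteq> {v\<in>drop_last m ` ?V. ctrunc m v = 0}"
  proof
    fix f assume f: "f \<in> chain_space (subsets m i) (gpiece (j - i) ?Z)"
    have fS: "f S \<in> gpiece (j - i) ?Z" "S \<notin> subsets m i \<Longrightarrow> f S = 0" for S using f by (auto simp: chain_space_def)
    have "trunc m (f S) = 0" for S using fS(1)[of S] by (auto simp: gpiece_def trunc_var_mult)
    then have c: "ctrunc m f = 0" by (auto simp: ctrunc_def)
    have "f \<in> drop_last m ` ?V"
    \<comment> \<open>A nonzero coefficient is a multiple of \<open>x_m\<close> and has positive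
      degree, which gives \<open>Suc i \<le> j\<close>. For \<open>f = 0\<close> this may fail, but
      then there is nothing to lift.\<close>
    proof (cases "f = 0")
      case True
      have "drop_last m 0 = (0 :: nat set \<Rightarrow> 'a mpoly)" by (auto simp: drop_last_def)
      then show ?thesis using True cv.subspace_0[OF subspace_boundaries[OF iI]] by (metis image_eqI)
    next
      case False
      then obtain S0 where "f S0 \<noteq> 0" by (auto simp: fun_eq_iff)
      then have lt: "Suc i \<le> j" using var_lift[OF I fS(1)[of S0]] by simp
      have "\<forall>S. \<exists>q. f S \<noteq> 0 \<longrightarrow> q \<in> gpiece (j - Suc i) I \<and> var m * q = f S"
      proof
        fix S
        have "j - i - 1 = j - Suc i" by simp
        then show "\<exists>q. f S \<noteq> 0 \<longrightarrow> q \<in> gpiece (j - Suc i) I \<and> var m * q = f S"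
          using var_lift[OF I fS(1)[of S]] by auto
      qed
      then obtain q where q: "\<And>S. f S \<noteq> 0 \<Longrightarrow> q S \<in> gpiece (j - Suc i) I" "\<And>S. f S \<noteq> 0 \<Longrightarrow> var m * q S = f S" by metis
      \<comment> \<open>The sign cancels the one in front of the last term in
        \<open>kdiff_Suc\<close>.\<close>
      define g where "g = (\<lambda>U. if m \<in> U \<and> f (U - {m}) \<noteq> 0 then (- 1) ^ i * q (U - {m}) else 0)"
      have "g \<in> kchains (Suc m) I (Suc i) j"
      proof (rule kchainsI[OF lt])
        show "g U \<in> gpiece (j - Suc i) I" for U
          using q(1)[of "U - {m}"] sign_mult_ideal[OF iI] is_ideal_0[OF iI]
          by (auto simp: g_def gpiece_def homog_sign)
        fix U assume "g U \<noteq> 0"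
        then have "m \<in> U" "f (U - {m}) \<noteq> 0" by (auto simp: g_def split: if_splits)
        then have "m \<in> U" "U - {m} \<in> subsets m i" using fS(2) by blast+
        then have U: "m \<in> U" "U - {m} \<subseteq> {..<m}" "card (U - {m}) = i" by (auto simp: subsets_def)
        have "finite (U - {m})" by (rule finite_subset[OF U(2) finite_lessThan])
        then have "card U = Suc i" using card.remove[OF _ U(1)] U(3) by simp
        moreover have "U \<subseteq> {..<Suc m}" using U(2) by (auto simp: less_Suc_eq)
        ultimately show "U \<subseteq> {..<Suc m} \<and> card U = Suc i" by simp
      qed
      moreover have "f = drop_last m (kdiff (Suc m) (Suc i) g)"
      proof
        fix T
        show "f T = drop_last m (kdiff (Suc m) (Suc i) g) T"
        proof (cases "T \<in> subsets m i")
          case False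
          then have "m \<in> T \<or> kdiff (Suc m) (Suc i) g T = 0"
            using kdiff_support[of "Suc m" "Suc i" g T] subset_less_Suc[of T m] by (auto simp: subsets_def)
          then show ?thesis using fS(2)[OF False] by (auto simp: drop_last_def)
        next
          case True
          then have T: "T \<subseteq> {..<m}" "card T = i" by (auto simp: subsets_def)
          then have mT: "m \<notin> T" by auto
          have "g (insert s T) = 0" if "s \<in> {..<m} - T" for s using that mT by (auto simp: g_def)
          then have "kdiff m (Suc i) g T = 0" unfolding kdiff_def by (simp add: sum.neutral)
          moreover have "(- 1) ^ i * (var m * g (insert m T)) = f T"
            using q(2)[of T] mT by (auto simp: g_def mult.left_commute sign_sign)
          ultimately show ?thesis using kdiff_Suc[OF T, of g] mT by (simp add: drop_last_def)
        qed
      qed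
      ultimately show ?thesis unfolding boundaries_def by blast
    qed
    then show "f \<in> {v\<in>drop_last m ` ?V. ctrunc m v = 0}" using c by blast
  qed
  then have "cv.dim (chain_space (subsets m i) (gpiece (j - i) ?Z)) \<le> cv.dim {v\<in>drop_last m ` ?V. ctrunc m v = 0}"
    by (rule cv.dim_le_of_subset) (rule fin_dim_drop_kernel[OF fin_dim_boundaries[OF iI]])
  then have 1: "card (subsets m i) * hdim (j - i) ?Z \<le> cv.dim {v\<in>drop_last m ` ?V. ctrunc m v = 0}"
    unfolding dim_chain_space_gpiece(1)[OF subspace_var_mult[OF iI] Zp] .
  have "boundaries m (trunc m ` I) i j \<subseteq> ctrunc m ` drop_last m ` ?V"
  proof
    fix v assume "v \<in> boundaries m (trunc m ` I) i j"
    then obtain h where h: "h \<in> kchains m (trunc m ` I) (Suc i) j" "v = kdiff m (Suc i) h" by (auto simp: boundaries_def)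
    obtain g where "g \<in> kchains (Suc m) I (Suc i) j" "ctrunc m (drop_last m g) = h"
      using kchains_trunc_surj[OF I h(1)] by blast
    then show "v \<in> ctrunc m ` drop_last m ` ?V"
      using h(2) drop_ctrunc_kdiff[of m "Suc i" g] unfolding boundaries_def by (metis image_eqI)
  qed
  then have 2: "cv.dim (boundaries m (trunc m ` I) i j) \<le> cv.dim (ctrunc m ` drop_last m ` ?V)"
    by (rule cv.dim_le_of_subset) (rule fin_dim_ctrunc_drop[OF fin_dim_boundaries[OF iI]])
  show ?thesis
    using 1 2 dim_decompose[OF subspace_boundaries[OF iI] fin_dim_boundaries[OF iI], of m i j]
      vector_space_pair.dim_image_le[OF chain_pair linear_drop_last[of m] subspace_boundaries[OF iI, of i j] fin_dim_boundaries[OF iI]]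
    by simp
qed

text \<open>For these ideals the bounds of \<open>dim_cycles_le\<close> and \<open>dim_boundaries_ge\<close> are attained.\<close>

definition last_stable :: "nat \<Rightarrow> 'k::field mpoly set \<Rightarrow> bool" where
  "last_stable m I \<longleftrightarrow> trunc m ` I \<subseteq> I \<and>
    (\<forall>p\<in>trunc_kernel m I. \<forall>s<m. var s * p \<in> (*) (var m) ` I)"

text \<open>Every chain with coefficients in \<open>trunc_kernel m I\<close> is the part without
  \<open>e_m\<close> of a cycle: by stability its differential in the first \<open>m\<close>
  variables is \<open>x_m\<close> times a chain with coefficients in \<open>I\<close>, and this
  chain can serve as the part with \<open>e_m\<close>. Cycles of the restricted ideal are themselves
  cycles, because \<open>trunc m\<close> maps \<open>I\<close> into itself.\<close>

lemma dim_cycles_ge: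
  assumes I: "homog_ideal (Suc m) I" and ij: "i \<le> j" and st: "last_stable m I"
  shows "cv.dim (cycles m (trunc m ` I) i j) + card (subsets m i) * hdim (j - i) (trunc_kernel m I)
    \<le> cv.dim (cycles (Suc m) I i j)"
proof -
  have iI: "is_ideal (Suc m) I" by (rule homog_ideal_ideal[OF I])
  have i0: "is_ideal m (trunc m ` I)" by (rule homog_ideal_ideal[OF homog_ideal_trunc[OF I]])
  let ?V = "cycles (Suc m) I i j"
  let ?N = "trunc_kernel m I"
  let ?Z = "(*) (var m) ` I"
  have Np: "?N \<subseteq> polys (Suc m)" using is_ideal_subset[OF iI] by auto
  have "chain_space (subsets m i) (gpiece (j - i) ?N) \<subseteq> {v\<in>drop_last m ` ?V. ctrunc m v = 0}"
  proof
    fix f assume f: "f \<in> chain_space (subsets m i) (gpiece (j - i) ?N)"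
    have fS: "f S \<in> gpiece (j - i) ?N" "S \<notin> subsets m i \<Longrightarrow> f S = 0" for S using f by (auto simp: chain_space_def)
    have c: "ctrunc m f = 0" using fS(1) by (auto simp: ctrunc_def gpiece_def)
    let ?D = "kdiff m i f"
    have lift: "\<exists>q. ?D T \<noteq> 0 \<longrightarrow> q \<in> gpiece (j - i) I \<and> var m * q = ?D T" for T
    proof (cases "?D T = 0")
      case False
      then have T: "0 < i" "T \<subseteq> {..<m}" "card T = i - 1" using kdiff_support by blast+
      have "?D T \<in> ?Z"
      proof -
        have "(- 1) ^ card {t\<in>T. t < s} * var s * f (insert s T) \<in> ?Z" if "s < m" for s
        proof -
          have "var s * f (insert s T) \<in> ?Z" using st fS(1)[of "insert s T"] that by (auto simp: last_stable_def gpiece_def)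
          then obtain p where p: "p \<in> I" "var s * f (insert s T) = var m * p" by blast
          then have "(- 1) ^ card {t\<in>T. t < s} * var s * f (insert s T) = var m * ((- 1) ^ card {t\<in>T. t < s} * p)"
            by (simp add: mult.assoc mult.left_commute)
          then show ?thesis using sign_mult_ideal[OF iI p(1)] by blast
        qed
        then show ?thesis unfolding kdiff_def using T
          by (simp) (intro pv.subspace_sum[OF subspace_var_mult[OF iI]], auto)
      qed
      moreover have "homog (Suc (j - i)) (?D T)"
        unfolding kdiff_def using fS(1) by (auto simp: gpiece_def intro!: homog_sum homog_sign_var)
      ultimately have mem: "?D T \<in> gpiece (Suc (j - i)) ?Z" by (simp add: gpiece_def)
      show ?thesis using var_lift[OF I mem False] by auto
    qed simp
    then obtain q where q: "\<And>T. ?D T \<noteq> 0 \<Longrightarrow> q T \<in> gpiece (j - i) I" "\<And>T. ?D T \<noteq> 0 \<Longrightarrow> var m * q T = ?D T" by metis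
    \<comment> \<open>The sign is chosen so that the last term in \<open>kdiff_Suc\<close> becomes
      the negative of \<open>?D\<close>.\<close>
    define F where "F = (\<lambda>S. if m \<in> S then (if ?D (S - {m}) = 0 then 0 else - ((- 1) ^ (i - 1) * q (S - {m}))) else f S)"
    have Fk: "F \<in> kchains (Suc m) I i j"
    proof (rule kchainsI[OF ij])
      have neg: "- ((- 1) ^ n * p) \<in> gpiece (j - i) I" if "p \<in> gpiece (j - i) I" for p n
        using that is_ideal_uminus[OF iI sign_mult_ideal[OF iI]] homog_sign[of "j - i" p n]
        by (simp add: gpiece_def homog_iff)
      show "F S \<in> gpiece (j - i) I" for S
        using neg[OF q(1)] fS(1)[of S] is_ideal_0[OF iI] by (auto simp: F_def gpiece_def)
      fix S assume FS: "F S \<noteq> 0"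
      show "S \<subseteq> {..<Suc m} \<and> card S = i"
      proof (cases "m \<in> S")
        case True
        then have "?D (S - {m}) \<noteq> 0" using FS by (auto simp: F_def)
        then have T: "0 < i" "S - {m} \<subseteq> {..<m}" "card (S - {m}) = i - 1" using kdiff_support by blast+
        have "finite (S - {m})" by (rule finite_subset[OF T(2) finite_lessThan])
        then have "card S = i" using card.remove[OF _ True] T(1,3) by simp
        then show ?thesis using T(2) by (auto simp: less_Suc_eq)
      next
        case False
        then have "f S \<noteq> 0" using FS by (simp add: F_def)
        then have "S \<in> subsets m i" using fS(2) by blast
        then show ?thesis by (auto simp: subsets_def)
      qed
    qed
    have "kdiff (Suc m) i F = 0"
    proof (cases i)
      case 0 then show ?thesis by (auto simp: kdiff_def)
    next
      case (Suc i')
      let ?G = "kdiff (Suc m) i F"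
      have G0: "?G T = 0" if mT: "m \<notin> T" for T
      proof (cases "T \<in> subsets m i'")
        case False
        then show ?thesis using kdiff_support[of "Suc m" i F T] mT subset_less_Suc[of T m] Suc
          by (auto simp: subsets_def)
      next
        case True
        then have T: "T \<subseteq> {..<m}" "card T = i'" by (auto simp: subsets_def)
        have "kdiff m i F T = ?D T"
          unfolding kdiff_def using mT by (auto simp: F_def intro!: sum.cong)
        moreover have "(- 1) ^ i' * (var m * F (insert m T)) = - ?D T"
        proof (cases "?D T = 0")
          case True then show ?thesis using mT by (simp add: F_def)
        next
          case False
          then have "(- 1) ^ i' * (var m * F (insert m T)) = - ((- 1) ^ i' * ((- 1) ^ i' * (var m * q T)))"
            using mT Suc by (simp add: F_def mult.left_commute)
          then show ?thesis using q(2)[OF False] by (simp only: sign_sign)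
        qed
        ultimately show ?thesis using kdiff_Suc[OF T, of F] Suc by simp
      qed
      \<comment> \<open>The coefficients of this differential at sets containing \<open>m\<close>
        need no computation: the differential is itself a cycle and its part without
        \<open>e_m\<close> vanishes, so \<open>cycle_vanish\<close> applies.\<close>
      show ?thesis
      proof (rule cycle_vanish[of m i'])
        show "kdiff (Suc m) i' ?G = 0" unfolding Suc by (rule kdiff_kdiff)
        show "T \<subseteq> {..<Suc m} \<and> card T = i'" if "?G T \<noteq> 0" for T using kdiff_support[OF that] Suc by simp
        show "drop_last m ?G = 0" using G0 by (auto simp: drop_last_def)
      qed
    qed
    then have "F \<in> ?V" using Fk by (simp add: cycles_def zero_fun_def)
    moreover have "f = drop_last m F"
    proof
      fix S
      have "f S = 0" if "m \<in> S" using that fS(2)[of S] by (auto simp: subsets_def)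
      then show "f S = drop_last m F S" by (auto simp: drop_last_def F_def)
    qed
    ultimately show "f \<in> {v\<in>drop_last m ` ?V. ctrunc m v = 0}" using c by blast
  qed
  then have "cv.dim (chain_space (subsets m i) (gpiece (j - i) ?N)) \<le> cv.dim {v\<in>drop_last m ` ?V. ctrunc m v = 0}"
    by (rule cv.dim_le_of_subset) (rule fin_dim_drop_kernel[OF fin_dim_cycles[OF iI]])
  then have 1: "card (subsets m i) * hdim (j - i) ?N \<le> cv.dim {v\<in>drop_last m ` ?V. ctrunc m v = 0}"
    unfolding dim_chain_space_gpiece(1)[OF subspace_trunc_kernel[OF iI] Np] .
  have "cycles m (trunc m ` I) i j \<subseteq> ctrunc m ` drop_last m ` ?V"
  proof
    fix f assume "f \<in> cycles m (trunc m ` I) i j"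
    then have f: "f \<in> kchains m (trunc m ` I) i j" "kdiff m i f = 0" by (auto simp: cycles_def zero_fun_def)
    have fm: "f S = 0" if "m \<in> S" for S using kchains_support[OF f(1), of S] that by auto
    have "f \<in> kchains (Suc m) I i j"
    proof (rule kchainsI[OF ij])
      show "f S \<in> gpiece (j - i) I" for S
        using kchains_gpiece[OF f(1), of S] st by (auto simp: gpiece_def last_stable_def)
      show "f S \<noteq> 0 \<Longrightarrow> S \<subseteq> {..<Suc m} \<and> card S = i" for S
        using kchains_support[OF f(1), of S] by auto
    qed
    moreover have "kdiff (Suc m) i f = 0"
    proof
      fix T
      show "kdiff (Suc m) i f T = 0 T"
      proof (cases "T \<in> subsets m (i - 1) \<and> 0 < i")
        case True
        then obtain i' where i': "i = Suc i'" by (cases i) auto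
        then have T: "T \<subseteq> {..<m}" "card T = i'" using True by (auto simp: subsets_def)
        show ?thesis using kdiff_Suc[OF T, of f] f(2) fm[of "insert m T"] i' by simp
      next
        case False
        show ?thesis
        proof (cases "m \<in> T")
          case True
          then show ?thesis unfolding kdiff_def using fm by (simp add: sum.neutral)
        next
          case mT: False
          then show ?thesis using False kdiff_support[of "Suc m" i f T] subset_less_Suc[of T m]
            by (auto simp: subsets_def)
        qed
      qed
    qed
    ultimately have "f \<in> ?V" by (simp add: cycles_def zero_fun_def)
    moreover have "f = ctrunc m (drop_last m f)"
    proof
      fix S
      have "f S \<in> polys m" using kchains_gpiece[OF f(1), of S] is_ideal_polys[OF i0] by (auto simp: gpiece_def)
      then show "f S = ctrunc m (drop_last m f) S" using fm[of S] by (simp add: ctrunc_def drop_last_def trunc_id)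
    qed
    ultimately show "f \<in> ctrunc m ` drop_last m ` ?V" by blast
  qed
  then have 2: "cv.dim (cycles m (trunc m ` I) i j) \<le> cv.dim (ctrunc m ` drop_last m ` ?V)"
    by (rule cv.dim_le_of_subset) (rule fin_dim_ctrunc_drop[OF fin_dim_cycles[OF iI]])
  show ?thesis
    using 1 2 dim_decompose[OF subspace_cycles[OF iI] fin_dim_cycles[OF iI], of m i j]
      dim_drop_last_cycles[OF iI subspace_cycles[OF iI] subset_refl] by simp
qed

text \<open>If the part without \<open>e_m\<close> of a boundary vanishes at \<open>x_m = 0\<close>,
  then subtracting its truncation changes nothing. In the sum this replaces each coefficient of the
  chain by its difference from its own truncation, an element of \<open>trunc_kernel m I\<close>,
  and stability puts \<open>x_s\<close> times such an element into \<open>x_m I\<close>.\<close>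

lemma dim_boundaries_le_stable:
  assumes I: "homog_ideal (Suc m) I" and ij: "i \<le> j" and st: "last_stable m I"
  shows "cv.dim (boundaries (Suc m) I i j)
    \<le> cv.dim (boundaries m (trunc m ` I) i j) + card (subsets m i) * hdim (j - i) ((*) (var m) ` I)"
proof -
  have iI: "is_ideal (Suc m) I" by (rule homog_ideal_ideal[OF I])
  have i0: "is_ideal m (trunc m ` I)" by (rule homog_ideal_ideal[OF homog_ideal_trunc[OF I]])
  let ?V = "boundaries (Suc m) I i j"
  let ?Z = "(*) (var m) ` I"
  have Zp: "?Z \<subseteq> polys (Suc m)" using is_ideal_subset[OF iI] by (auto intro: polys_mult polys_var)
  have sZ: "pv.subspace ?Z" by (rule subspace_var_mult[OF iI])
  have "{v\<in>drop_last m ` ?V. ctrunc m v = 0} \<subseteq> chain_space (subsets m i) (gpiece (j - i) ?Z)"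
  proof
    fix v assume "v \<in> {v\<in>drop_last m ` ?V. ctrunc m v = 0}"
    then obtain g where g: "g \<in> kchains (Suc m) I (Suc i) j" and v: "v = drop_last m (kdiff (Suc m) (Suc i) g)"
      and c: "ctrunc m v = 0" by (auto simp: boundaries_def)
    have kd: "kdiff (Suc m) (Suc i) g \<in> kchains (Suc m) I i j" by (rule kdiff_kchains[OF iI g])
    have gI: "g S \<in> I" for S using kchains_gpiece[OF g, of S] by (simp add: gpiece_def)
    have supp: "v S = 0" if "S \<notin> subsets m i" for S
      using that kchains_support[OF kd, of S] subset_less_Suc[of S m] by (auto simp: v drop_last_def subsets_def)
    have "v S \<in> ?Z" for S
    proof (cases "S \<in> subsets m i")
      case False then show ?thesis using supp pv.subspace_0[OF sZ] by simp
    next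
      case True
      then have S: "S \<subseteq> {..<m}" "card S = i" and mS: "m \<notin> S" by (auto simp: subsets_def)
      let ?\<epsilon> = "\<lambda>s. (- 1) ^ card {t\<in>S. t < s} :: 'a mpoly"
      let ?D = "{..<m} - S"
      have e: "v S = (\<Sum>s\<in>?D. ?\<epsilon> s * (var s * g (insert s S))) + (- 1) ^ i * (var m * g (insert m S))"
        unfolding v drop_last_def using mS S by (simp add: kdiff_Suc) (simp add: kdiff_def mult.assoc)
      have "0 = trunc m (v S)" using fun_cong[OF c, of S] by (simp add: ctrunc_def)
      also have "\<dots> = (\<Sum>s\<in>?D. ?\<epsilon> s * (var s * trunc m (g (insert s S))))"
        unfolding e by (simp add: trunc_add trunc_sum trunc_sign trunc_var_mult)
      finally have "v S = (\<Sum>s\<in>?D. ?\<epsilon> s * (var s * g (insert s S))) + (- 1) ^ i * (var m * g (insert m S))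
          - (\<Sum>s\<in>?D. ?\<epsilon> s * (var s * trunc m (g (insert s S))))" using e by simp
      also have "\<dots> = (\<Sum>s\<in>?D. ?\<epsilon> s * (var s * (g (insert s S) - trunc m (g (insert s S))))) + (- 1) ^ i * (var m * g (insert m S))"
        by (simp add: right_diff_distrib sum_subtractf)
      also have "\<dots> \<in> ?Z"
      proof (rule pv.subspace_add[OF sZ])
        have sg: "(- 1) ^ n * q \<in> ?Z" if q: "q \<in> ?Z" for n q
        proof -
          obtain r where r: "r \<in> I" "q = var m * r" using q by blast
          then have "(- 1) ^ n * q = var m * ((- 1) ^ n * r)" by (simp add: mult.left_commute)
          then show ?thesis using sign_mult_ideal[OF iI r(1)] by blast
        qed
        show "(- 1) ^ i * (var m * g (insert m S)) \<in> ?Z" by (rule sg) (use gI in blast)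
        show "(\<Sum>s\<in>?D. ?\<epsilon> s * (var s * (g (insert s S) - trunc m (g (insert s S))))) \<in> ?Z"
        proof (intro pv.subspace_sum[OF sZ] sg)
          fix s assume "s \<in> ?D"
          moreover have "g (insert s S) - trunc m (g (insert s S)) \<in> trunc_kernel m I"
            using gI[of "insert s S"] st is_ideal_diff[OF iI] trunc_trunc[of m m "g (insert s S)"]
            by (auto simp: last_stable_def trunc_diff)
          ultimately show "var s * (g (insert s S) - trunc m (g (insert s S))) \<in> ?Z"
            using st by (auto simp: last_stable_def)
        qed
      qed
      finally show ?thesis .
    qed
    moreover have "homog (j - i) (v S)" for S
      using kchains_gpiece[OF kd, of S] by (simp add: v drop_last_def gpiece_def)
    ultimately show "v \<in> chain_space (subsets m i) (gpiece (j - i) ?Z)"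
      using supp by (simp add: chain_space_def gpiece_def)
  qed
  then have "cv.dim {v\<in>drop_last m ` ?V. ctrunc m v = 0} \<le> cv.dim (chain_space (subsets m i) (gpiece (j - i) ?Z))"
    by (rule cv.dim_le_of_subset) (rule dim_chain_space_gpiece(2)[OF sZ Zp])
  then have 1: "cv.dim {v\<in>drop_last m ` ?V. ctrunc m v = 0} \<le> card (subsets m i) * hdim (j - i) ?Z"
    unfolding dim_chain_space_gpiece(1)[OF sZ Zp] .
  have "ctrunc m ` drop_last m ` ?V \<subseteq> boundaries m (trunc m ` I) i j"
  proof (rule subsetI)
    fix v assume "v \<in> ctrunc m ` drop_last m ` ?V"
    then obtain g where g: "g \<in> kchains (Suc m) I (Suc i) j" "v = ctrunc m (drop_last m (kdiff (Suc m) (Suc i) g))"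
      by (auto simp: boundaries_def)
    show "v \<in> boundaries m (trunc m ` I) i j"
      unfolding boundaries_def g(2) drop_ctrunc_kdiff using drop_ctrunc_kchains[OF g(1)] by blast
  qed
  then have 2: "cv.dim (ctrunc m ` drop_last m ` ?V) \<le> cv.dim (boundaries m (trunc m ` I) i j)"
    by (rule cv.dim_le_of_subset) (rule fin_dim_boundaries[OF i0])
  show ?thesis
    using 1 2 dim_decompose[OF subspace_boundaries[OF iI] fin_dim_boundaries[OF iI], of m i j]
      dim_drop_last_cycles[OF iI subspace_boundaries[OF iI] boundaries_subset[OF iI]] by simp
qed

lemma hdim_trunc_kernel:
  assumes I: "homog_ideal (Suc m) I"
  shows "hdim d I = hdim d (trunc_kernel m I) + hdim d (trunc m ` I)"
proof -
  have iI: "is_ideal (Suc m) I" by (rule homog_ideal_ideal[OF I])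
  have "trunc m ` gpiece d I = gpiece d (trunc m ` I)"
  proof (intro equalityI subsetI)
    fix q assume "q \<in> gpiece d (trunc m ` I)"
    then obtain p where "p \<in> gpiece d I" "trunc m p = q" using trunc_lift[OF I] by blast
    then show "q \<in> trunc m ` gpiece d I" by blast
  qed (auto simp: gpiece_def homog_trunc)
  moreover have "{p\<in>gpiece d I. trunc m p = 0} = gpiece d (trunc_kernel m I)" by (auto simp: gpiece_def)
  ultimately show ?thesis unfolding hdim_def
    using vector_space_pair.rank_nullity[OF poly_pair linear_trunc[of m] subspace_gpiece[OF is_ideal_subspace[OF iI]]
        fin_dim_gpiece[OF is_ideal_subset[OF iI]], of d] by simp
qed

lemma hdim_var_mult:
  assumes I: "homog_ideal n I"
  shows "hdim d ((*) (var m) ` I) = (if d = 0 then 0 else hdim (d - 1) I)"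
proof (cases "d = 0")
  case True
  then have "gpiece d ((*) (var m) ` I) \<subseteq> {0}" using var_lift[OF I, of _ d m] by auto
  then show ?thesis unfolding hdim_def using True pv.dim_le_card[of "gpiece d ((*) (var m) ` I)" "{}"] by simp
next
  case False
  have iI: "is_ideal n I" by (rule homog_ideal_ideal[OF I])
  have "gpiece d ((*) (var m) ` I) = (*) (var m) ` gpiece (d - 1) I"
  proof (intro equalityI subsetI)
    fix q assume q: "q \<in> gpiece d ((*) (var m) ` I)"
    show "q \<in> (*) (var m) ` gpiece (d - 1) I"
    proof (cases "q = 0")
      case True
      then show ?thesis using is_ideal_0[OF iI] by (auto simp: gpiece_def intro: image_eqI[of _ _ 0])
    next
      case False then show ?thesis using var_lift[OF I q] by blast
    qed
  next
    fix q assume "q \<in> (*) (var m) ` gpiece (d - 1) I"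
    then show "q \<in> gpiece d ((*) (var m) ` I)"
      using False homog_mult[OF homog_var, of "d - 1" _ m] by (auto simp: gpiece_def)
  qed
  moreover have "pv.dim ((*) (var m) ` gpiece (d - 1) I) = pv.dim (gpiece (d - 1) I)"
    by (rule vector_space_pair.dim_image_inj[OF poly_pair linear_mult subspace_gpiece[OF is_ideal_subspace[OF iI]]
        fin_dim_gpiece[OF is_ideal_subset[OF iI]]]) (simp only: var_mult_eq_0)
  ultimately show ?thesis using False by (simp add: hdim_def)
qed

text \<open>Chains with coefficients in \<open>L\<close> are chains with coefficients in
  \<open>J\<close>. The surplus of cycles is bounded by the surplus of chains, by
  \<open>dim_kernel_le\<close>, and boundaries only increase. The inclusion is needed up to degree
  \<open>j - i\<close> only, since chains for \<open>i\<close> and \<open>Suc i\<close> have no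
  coefficients in higher degrees.\<close>

lemma cycles_boundaries_compare:
  assumes J: "homog_ideal m J" and L: "homog_ideal m L" and ij: "i \<le> j"
    and sub: "\<And>d. d \<le> j - i \<Longrightarrow> gpiece d L \<subseteq> gpiece d J"
  shows "cv.dim (cycles m J i j) + card (subsets m i) * hdim (j - i) L
      \<le> cv.dim (cycles m L i j) + card (subsets m i) * hdim (j - i) J"
    and "cv.dim (boundaries m L i j) \<le> cv.dim (boundaries m J i j)"
proof -
  have iJ: "is_ideal m J" and iL: "is_ideal m L" using J L homog_ideal_ideal by auto
  have k: "kchains m L i j \<subseteq> kchains m J i j" using sub[of "j - i"] by (auto simp: kchains_def)
  have "cv.dim (kchains m X i j) = card (subsets m i) * hdim (j - i) X" if "is_ideal m X" for X :: "'a mpoly set"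
    unfolding kchains_eq_chain_space[OF ij]
    by (rule dim_chain_space_gpiece(1)[OF is_ideal_subspace[OF that] is_ideal_subset[OF that]])
  then show "cv.dim (cycles m J i j) + card (subsets m i) * hdim (j - i) L
      \<le> cv.dim (cycles m L i j) + card (subsets m i) * hdim (j - i) J"
    using cv.dim_kernel_le[OF linear_kdiff[of m i] subspace_kchains[OF iJ] fin_dim_kchains[OF iJ] subspace_kchains[OF iL] k]
      iJ iL by (simp add: cycles_def zero_fun_def)
  have "j - Suc i \<le> j - i" by simp
  then have "kchains m L (Suc i) j \<subseteq> kchains m J (Suc i) j" using sub[of "j - Suc i"] unfolding kchains_def by blast
  then have "boundaries m L i j \<subseteq> boundaries m J i j" by (auto simp: boundaries_def)
  then show "cv.dim (boundaries m L i j) \<le> cv.dim (boundaries m J i j)"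
    by (rule cv.dim_le_of_subset) (rule fin_dim_boundaries[OF iJ])
qed

text \<open>The estimates are added as statements about dimensions of cycles and boundaries. The
  multiples of \<open>?C\<close> cancel because \<open>I\<close> and \<open>L\<close> have the same
  Hilbert function, and so do \<open>J\<close> and the restriction of \<open>I\<close>.\<close>

theorem betti_compare:
  assumes I: "homog_ideal (Suc m) I" and L: "homog_ideal (Suc m) L" and st: "last_stable m L"
    and hIL: "\<And>d. hdim d I = hdim d L"
    and J: "homog_ideal m J" and hJ: "\<And>d. hdim d J = hdim d (trunc m ` I)"
    and bJ: "betti m (trunc m ` I) i j \<le> betti m J i j"
    and sub: "\<And>d. d \<le> j - i \<Longrightarrow> gpiece d (trunc m ` L) \<subseteq> gpiece d J"
  shows "betti (Suc m) I i j \<le> betti (Suc m) L i j"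
proof (cases "i \<le> j")
  case False
  have iI: "is_ideal (Suc m) I" by (rule homog_ideal_ideal[OF I])
  have "cycles (Suc m) I i j \<subseteq> {0}" using cycles_subset[of "Suc m" I i j] kchains_trivial[OF False iI] by auto
  then have "cv.dim (cycles (Suc m) I i j) = 0" using cv.dim_le_card[of "cycles (Suc m) I i j" "{}"] by simp
  then show ?thesis by (simp add: betti_eq)
next
  case ij: True
  have L0: "homog_ideal m (trunc m ` L)" by (rule homog_ideal_trunc[OF L])
  let ?C = "card (subsets m i)" and ?d = "j - i"
  have 1: "?C * hdim ?d I = ?C * hdim ?d (trunc_kernel m I) + ?C * hdim ?d (trunc m ` I)"
    "?C * hdim ?d L = ?C * hdim ?d (trunc_kernel m L) + ?C * hdim ?d (trunc m ` L)"
    using hdim_trunc_kernel[OF I, of ?d] hdim_trunc_kernel[OF L, of ?d] by (simp_all add: distrib_left)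
  have 2: "?C * hdim ?d ((*) (var m) ` I) = ?C * hdim ?d ((*) (var m) ` L)"
    unfolding hdim_var_mult[OF I] hdim_var_mult[OF L] using hIL by simp
  have 3: "?C * hdim ?d J = ?C * hdim ?d (trunc m ` I)" "?C * hdim ?d I = ?C * hdim ?d L" using hJ hIL by simp_all
  \<comment> \<open>Undoing the truncated subtraction in the Betti numbers requires that the
    boundaries of \<open>J\<close> do not outnumber its cycles.\<close>
  have 4: "cv.dim (cycles m (trunc m ` I) i j) + cv.dim (boundaries m J i j)
      \<le> cv.dim (cycles m J i j) + cv.dim (boundaries m (trunc m ` I) i j)"
    using bJ dim_boundaries_le[OF homog_ideal_ideal[OF J], of i j] unfolding betti_eq by arith
  have "cv.dim (cycles (Suc m) I i j) + cv.dim (boundaries (Suc m) L i j)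
      \<le> cv.dim (cycles (Suc m) L i j) + cv.dim (boundaries (Suc m) I i j)"
    using 1 2 3 4 dim_cycles_le[OF I ij] dim_boundaries_ge[OF I ij] dim_cycles_ge[OF L ij st]
      dim_boundaries_le_stable[OF L ij st] cycles_boundaries_compare[OF J L0 ij sub] by linarith
  then show ?thesis unfolding betti_eq by arith
qed

text \<open>A monomial \<open>t\<close> divisible by \<open>x_m\<close> satisfies
  \<open>x_s t = x_m t'\<close>, where \<open>t'\<close> arises from \<open>t\<close> by exchanging
  one factor \<open>x_m\<close> for \<open>x_s\<close>, and \<open>st\<close> keeps
  \<open>t'\<close> in \<open>U\<close>.\<close>

lemma last_stable_monomial_ideal:
  assumes U: "up_closed (Suc m) U"
    and st: "\<And>u s. u + xv m \<in> U \<Longrightarrow> u \<in> mons (Suc m) \<Longrightarrow> s < m \<Longrightarrow> u + xv s \<in> U"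
  shows "last_stable m (monomial_ideal (Suc m) U :: 'k::field mpoly set)"
  unfolding last_stable_def
proof (intro conjI ballI allI impI)
  let ?L = "monomial_ideal (Suc m) U :: 'k mpoly set"
  show "trunc m ` ?L \<subseteq> ?L"
    by (auto simp: monomial_ideal_def trunc_restr keys_restr intro: polys_restr)
  have iL: "is_ideal (Suc m) ?L" by (rule homog_ideal_ideal[OF homog_monomial_ideal[OF U]])
  fix p s assume p: "p \<in> trunc_kernel m ?L" and s: "s < m"
  have "var s * single t (lookup p t) \<in> (*) (var m) ` ?L" if t: "t \<in> keys p" for t
  proof -
    have tU: "t \<in> U" "t \<in> mons (Suc m)" using p t by (auto simp: monomial_ideal_def polys_iff)
    have "t \<notin> mons m" using p t by (auto simp: trunc_restr restr_eq_0_iff)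
    then have "m \<in> keys t" using mons_Suc_iff[OF tU(2)] by (simp add: in_keys_iff)
    then have e: "t = (t - xv m) + xv m" by (rule split_off_variable)
    then have m: "t - xv m \<in> mons (Suc m)" using tU(2) mons_add_iff by metis
    have "t - xv m + xv s \<in> U" using st[OF _ m s] e tU(1) by simp
    then have "single (t - xv m + xv s) (lookup p t) \<in> ?L"
      using m s by (auto simp: monomial_ideal_def mons_single_iff)
    moreover have "var s * single t (lookup p t)
      = var m * single (t - xv m + xv s) (lookup p t)"
    proof -
      have "xv s + t = xv m + (t - xv m + xv s)" using e by (metis add.assoc add.commute)
      then show ?thesis by (simp add: var_def mult_single)
    qed
    ultimately show ?thesis by (metis image_eqI)
  qed
  then have "(\<Sum>t\<in>keys p. var s * single t (lookup p t)) \<in> (*) (var m) ` ?L"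
    by (rule pv.subspace_sum[OF subspace_var_mult[OF iL]])
  then show "var s * p \<in> (*) (var m) ` ?L" using poly_eq_sum[of p] by (simp add: sum_distrib_left[symmetric])
qed

section \<open>Distractions\<close>

definition linear_ext :: "((nat \<Rightarrow>\<^sub>0 nat) \<Rightarrow> 'k::field mpoly) \<Rightarrow> 'k mpoly \<Rightarrow> 'k mpoly" where
  "linear_ext \<phi> p = (\<Sum>t\<in>keys p. pscale (lookup p t) (\<phi> t))"

lemma linear_ext_superset:
  assumes "finite F" "keys p \<subseteq> F"
  shows "linear_ext \<phi> p = (\<Sum>t\<in>F. pscale (lookup p t) (\<phi> t))"
  unfolding linear_ext_def
  by (rule sum.mono_neutral_left) (use assms in \<open>auto simp: in_keys_iff\<close>)

lemma linear_ext_add: "linear_ext \<phi> (p + q) = linear_ext \<phi> p + linear_ext \<phi> q"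
proof -
  let ?F = "keys p \<union> keys q"
  have f: "finite ?F" by simp
  show ?thesis
    using linear_ext_superset[OF f, of p \<phi>] linear_ext_superset[OF f, of q \<phi>]
      linear_ext_superset[OF f, of "p + q" \<phi>] Poly_Mapping.keys_add[of p q]
    by (simp add: lookup_add pv.scale_left_distrib sum.distrib)
qed

lemma linear_ext_single: "linear_ext \<phi> (single t c) = pscale c (\<phi> t)"
  by (subst linear_ext_superset[of "{t}"]) auto

lemma linear_ext_0 [simp]: "linear_ext \<phi> 0 = 0"
  by (simp add: linear_ext_def)

lemma linear_ext_pscale: "linear_ext \<phi> (pscale c p) = pscale c (linear_ext \<phi> p)"
  by (subst linear_ext_superset[of "keys p"])
    (auto simp: linear_ext_def in_keys_iff pv.scale_sum_right)

text \<open>\<open>distr m a\<close> is linear over the polynomials in the first \<open>m\<close> variables and replaces \<open>x\<^sub>m\<^sup>k\<close> by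
  \<open>(x\<^sub>m - x\<^bsub>a 0\<^esub>) \<dots> (x\<^sub>m - x\<^bsub>a (k - 1)\<^esub>)\<close>.\<close>

definition factors :: "nat \<Rightarrow> (nat \<Rightarrow> nat) \<Rightarrow> nat \<Rightarrow> 'k::field mpoly" where
  "factors m a k = (\<Prod>r<k. var m - var (a r))"

definition distr :: "nat \<Rightarrow> (nat \<Rightarrow> nat) \<Rightarrow> 'k::field mpoly \<Rightarrow> 'k mpoly" where
  "distr m a = linear_ext (\<lambda>t. single (t - single m (lookup t m)) 1
      * factors m a (lookup t m))"

text \<open>The terms whose next linear factor in the distraction is \<open>x_m - x_s\<close>. They
  record how far \<open>distr m a\<close> is from commuting with multiplication by
  \<open>x_m\<close>; see \<open>var_distr\<close>.\<close>

definition part :: "nat \<Rightarrow> (nat \<Rightarrow> nat) \<Rightarrow> nat \<Rightarrow> 'k::field mpoly \<Rightarrow> 'k mpoly" where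
  "part m a s = restr (\<lambda>t. a (lookup t m) = s)"

lemma distr_add: "distr m a (p + q) = distr m a p + distr m a q"
  and distr_0 [simp]: "distr m a 0 = 0"
  and distr_pscale: "distr m a (pscale c p) = pscale c (distr m a p)"
  by (simp_all add: distr_def linear_ext_add linear_ext_pscale)

lemma distr_uminus: "distr m a (- p) = - distr m a p"
  using distr_add[of m a p "- p"] by (simp add: eq_neg_iff_add_eq_0 add.commute)

lemma distr_sum: "distr m a (sum f A) = (\<Sum>x\<in>A. distr m a (f x))"
  by (induction A rule: infinite_finite_induct) (simp_all add: distr_add)

lemma distr_sign: "distr m a ((- 1) ^ n * p) = (- 1) ^ n * distr m a p"
  using sign_cases[of n, where 'k='a] by (auto simp: distr_uminus)

lemma linear_distr: "Vector_Spaces.linear pscale pscale (distr m a)"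
  by (rule linear_pscaleI) (rule distr_add, rule distr_pscale)

lemma pscale_mult: "pscale c p * q = pscale c (p * q)"
  by (simp add: pscale_def mult.assoc)

lemma single_eq_pscale: "single t c = pscale c (single t 1)"
  by (simp add: pscale_def const_def mult_single)

lemma distr_single:
  "distr m a (single t c)
    = single (t - single m (lookup t m)) c * factors m a (lookup t m)"
  unfolding distr_def linear_ext_single by (subst (2) single_eq_pscale) (simp add: pscale_mult)

lemma distr_single_mult:
  assumes "u \<in> mons m"
  shows "distr m a (single u c * p) = single u c * distr m a p"
proof (induction p rule: poly_induct)
  case (add_single t d q)
  have l: "lookup (u + t) m = lookup t m" using assms by (simp add: lookup_add mons_lookup)
  have "u + t - single m (lookup t m) = u + (t - single m (lookup t m))"
  proof (rule poly_mapping_eqI)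
    fix i
    show "lookup (u + t - single m (lookup t m)) i
      = lookup (u + (t - single m (lookup t m))) i"
      using assms by (cases "i = m") (simp_all add: lookup_add lookup_minus lookup_single mons_lookup)
  qed
  then have "distr m a (single u c * single t d)
      = single u c * distr m a (single t d)"
    by (simp add: mult_single distr_single l mult.assoc[symmetric])
  then show ?case using add_single by (simp add: distrib_left distr_add)
qed simp

lemma distr_mult:
  assumes "r \<in> polys m" shows "distr m a (r * p) = r * distr m a p"
proof -
  have "distr m a (r * p) = distr m a (\<Sum>t\<in>keys r. single t (lookup r t) * p)"
    using poly_eq_sum[of r] by (simp add: sum_distrib_right[symmetric])
  also have "\<dots> = (\<Sum>t\<in>keys r. single t (lookup r t) * distr m a p)"
    unfolding distr_sum by (rule sum.cong) (use assms in \<open>auto simp: polys_iff distr_single_mult\<close>)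
  also have "\<dots> = r * distr m a p" using poly_eq_sum[of r] by (simp add: sum_distrib_right[symmetric])
  finally show ?thesis .
qed

lemma part_add: "part m a s (p + q) = part m a s p + part m a s q"
  and part_0 [simp]: "part m a s 0 = 0"
  and part_pscale: "part m a s (pscale c p) = pscale c (part m a s p)"
  and part_sum: "part m a s (sum f A) = (\<Sum>x\<in>A. part m a s (f x))"
  by (simp_all add: part_def restr_add restr_pscale restr_sum)

lemma part_sign: "part m a s ((- 1) ^ n * p) = (- 1) ^ n * part m a s p"
  using sign_cases[of n, where 'k='a] by (auto simp: part_def restr_uminus)

lemma part_var: "r < m \<Longrightarrow> part m a s (var r * p) = var r * part m a s p"
  by (simp add: part_def var_def restr_single_mult lookup_add lookup_single)

lemma homog_part: "homog d p \<Longrightarrow> homog d (part m a s p)"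
  unfolding part_def by (rule homog_restr)

lemma part_single: "part m a s (single t c) = (if a (lookup t m) = s then single t c else 0)"
  by (rule poly_mapping_eqI) (auto simp: part_def lookup_single when_def)

lemma part_mem:
  assumes I: "is_ideal n I" "zgraded m I" and p: "p \<in> I" shows "part m a s p \<in> I"
proof -
  let ?K = "{k\<in>(\<lambda>t. lookup t m) ` keys p. a k = s}"
  have "part m a s p = (\<Sum>k\<in>?K. zcomp m k p)"
  proof (rule poly_mapping_eqI)
    fix t
    have "lookup (\<Sum>k\<in>?K. zcomp m k p) t
      = (\<Sum>k\<in>?K. if lookup t m = k then lookup p t else 0)"
      by (simp add: lookup_sum zcomp_def)
    also have "\<dots> = lookup (part m a s p) t"
      by (subst sum.delta') (auto simp: part_def in_keys_iff)
    finally show "lookup (part m a s p) t = lookup (\<Sum>k\<in>?K. zcomp m k p) t" by simp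
  qed
  also have "\<dots> \<in> I" by (rule is_ideal_sum[OF I(1)]) (use I(2) p in \<open>simp add: zgraded_def\<close>)
  finally show ?thesis .
qed

text \<open>By definition \<open>factors m a (Suc k)\<close> is \<open>x_m - x_s\<close> times
  \<open>factors m a k\<close> with \<open>s = a k\<close>. Multiplication by \<open>x_m\<close>
  therefore gives the next product plus \<open>x_s\<close> times the old one, and
  \<open>part\<close> sorts the correction terms by \<open>s\<close>.\<close>

lemma var_distr:
  assumes a: "\<And>r. a r < m"
  shows "var m * distr m a p = distr m a (var m * p + (\<Sum>s<m. var s * part m a s p))"
proof (induction p rule: poly_induct)
  case (add_single t c q)
  let ?k = "lookup t m" and ?u = "t - single m (lookup t m)"
  have "(\<Sum>s<m. var s * part m a s (single t c)) = (\<Sum>s<m. if a ?k = s then var s * single t c else 0)"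
    by (rule sum.cong) (auto simp: part_single)
  also have "\<dots> = var (a ?k) * single t c" using a by (subst sum.delta') auto
  finally have s: "(\<Sum>s<m. var s * part m a s (single t c)) = var (a ?k) * single t c" .
  have 1: "distr m a (var (a ?k) * single t c) = var (a ?k) * distr m a (single t c)"
    by (rule distr_mult[OF polys_var[OF a]])
  have 2: "distr m a (var m * single t c) = single ?u c * factors m a (Suc ?k)"
  proof -
    have "xv m + t - single m (Suc ?k) = ?u"
      by (rule poly_mapping_eqI) (auto simp: lookup_add lookup_minus lookup_single when_def)
    then show ?thesis by (simp add: var_def mult_single distr_single lookup_add)
  qed
  have 3: "var m * factors m a ?k = factors m a (Suc ?k) + var (a ?k) * (factors m a ?k :: 'a mpoly)"
    by (simp add: factors_def algebra_simps)
  have "var m * distr m a (single t c) = single ?u c * (var m * factors m a ?k)"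
    unfolding distr_single by (simp only: mult.left_commute)
  also have "\<dots> = single ?u c * factors m a (Suc ?k) + var (a ?k) * (single ?u c * factors m a ?k)"
    unfolding 3 distrib_left by (simp only: mult.left_commute)
  also have "\<dots> = distr m a (var m * single t c + var (a ?k) * single t c)"
    unfolding distr_add 1 2 distr_single ..
  finally have "var m * distr m a (single t c)
    = distr m a (var m * single t c + var (a ?k) * single t c)" .
  then have "var m * distr m a (single t c)
    = distr m a (var m * single t c) + distr m a (\<Sum>s<m. var s * part m a s (single t c))"
    using s by (simp add: distr_add)
  then show ?case using add_single by (simp add: distrib_left distr_add part_add sum.distrib)
qed simp

lemma homog_factors: "homog k (factors m a k :: 'k::field mpoly)"
proof (induction k)
  case (Suc k)
  have "homog 1 (var m - var (a k) :: 'k mpoly)"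
    using homog_var[of m, where 'a='k] homog_var[of "a k", where 'a='k] unfolding homog_iff lookup_minus by simp
  then show ?case using homog_mult[OF Suc, of 1 "var m - var (a k)"] by (simp add: factors_def)
qed (simp add: factors_def homog_def)

lemma homog_distr_single: "homog (tdeg t) (distr m a (single t c))"
proof -
  have "tdeg t = tdeg (t - single m (lookup t m)) + lookup t m"
    using arg_cong[OF split_off_power(1)[of t m], of tdeg] by simp
  then show ?thesis unfolding distr_single
    using homog_mult[OF _ homog_factors[of "lookup t m" m a],
        of "tdeg (t - single m (lookup t m))"
          "single (t - single m (lookup t m)) c"] by simp
qed

lemma hcomp_distr: "hcomp d (distr m a p) = distr m a (hcomp d p)"
proof (induction p rule: poly_induct)
  case (add_single t c q)
  have "hcomp d (single t c) = (if d = tdeg t then single t c else 0)"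
    by (rule homog_hcomp_eq) simp
  then show ?case
    using add_single homog_hcomp_eq[OF homog_distr_single[of t m a c], of d] by (simp add: hcomp_add distr_add)
qed simp

lemma homog_distr: "homog d p \<Longrightarrow> homog d (distr m a p)"
  using hcomp_distr[of d m a p] homog_hcomp_eq[of d p d] homog_hcomp[of d "distr m a p"] by simp

lemma polys_factors: "(\<And>r. a r < m) \<Longrightarrow> factors m a k \<in> polys (Suc m)"
proof (induction k)
  case (Suc k)
  then show ?case unfolding factors_def prod.lessThan_Suc
    by (intro polys_mult polys_diff polys_var) (auto intro: less_SucI)
qed (simp add: factors_def flip: single_one)

lemma polys_distr:
  assumes "\<And>r. a r < m" "p \<in> polys (Suc m)" shows "distr m a p \<in> polys (Suc m)"
  unfolding distr_def linear_ext_def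
proof (intro polys_sum polys_pscale polys_mult polys_factors assms(1))
  fix t assume "t \<in> keys p"
  then have "t \<in> mons (Suc m)" using assms(2) by (simp add: polys_iff)
  then have "t - single m (lookup t m) \<in> mons m" by (rule mons_Suc_decomp)
  then show "single (t - single m (lookup t m)) 1 \<in> polys (Suc m)"
    by (simp add: mons_lookup)
qed

lemma zcomp_diff: "zcomp m k (p - q) = zcomp m k p - zcomp m k q"
  by (simp add: zcomp_def restr_diff)

lemma zcomp_factors:
  assumes a: "\<And>r. a r < m"
  shows "k \<le> j \<Longrightarrow> zcomp m j (factors m a k) = (if j = k then var m ^ k else 0 :: 'k::field mpoly)"
proof (induction k arbitrary: j)
  case 0
  have "zcomp m j (1 :: 'k mpoly) = (if j = 0 then 1 else 0)"
    by (rule poly_mapping_eqI) (auto simp: zcomp_def lookup_one when_def)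
  then show ?case by (simp add: factors_def)
next
  case (Suc k)
  have "factors m a (Suc k) = var m * factors m a k - var (a k) * (factors m a k :: 'k mpoly)"
    by (simp add: factors_def algebra_simps)
  then have "zcomp m j (factors m a (Suc k) :: 'k mpoly)
    = var m * zcomp m (j - 1) (factors m a k) - var (a k) * zcomp m j (factors m a k)"
    using Suc.prems a[of k] by (simp add: zcomp_diff zcomp_var)
  also have "zcomp m j (factors m a k :: 'k mpoly) = 0" using Suc.IH[of j] Suc.prems by simp
  also have "zcomp m (j - 1) (factors m a k :: 'k mpoly) = (if j = Suc k then var m ^ k else 0)"
    using Suc.IH[of "j - 1"] Suc.prems by auto
  finally show ?case by simp
qed

text \<open>Each product of linear factors is monic in \<open>x_m\<close>, and its other terms have
  lower exponents of \<open>x_m\<close>. The component of highest exponent is thus unchanged, which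
  makes the distraction injective.\<close>

lemma zcomp_distr_top:
  assumes a: "\<And>r. a r < m" and top: "\<And>t. t \<in> keys p \<Longrightarrow> lookup t m \<le> k"
  shows "zcomp m k (distr m a p) = zcomp m k (p :: 'k::field mpoly)"
proof -
  have "zcomp m k (distr m a (single t c)) = zcomp m k (single t (c :: 'k))"
    if t: "lookup t m \<le> k" for t c
  proof -
    let ?u = "t - single m (lookup t m)"
    have "zcomp m k (distr m a (single t c))
      = single ?u c * zcomp m k (factors m a (lookup t m))"
      unfolding distr_single zcomp_single_mult using split_off_power(2)[of t m] by simp
    also have "\<dots> = (if k = lookup t m then single t c else 0)"
      using zcomp_factors[of a m, OF a t, where 'k='k] split_off_power(1)[of t m] by (simp add: var_power mult_single)
    also have "\<dots> = zcomp m k (single t c)"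
      by (rule poly_mapping_eqI) (auto simp: zcomp_def lookup_single when_def)
    finally show ?thesis .
  qed
  then have "zcomp m k (distr m a (\<Sum>t\<in>keys p. single t (lookup p t)))
    = zcomp m k (\<Sum>t\<in>keys p. single t (lookup p t))"
    unfolding distr_sum zcomp_sum using top by (intro sum.cong) auto
  then show ?thesis by (simp add: poly_eq_sum[symmetric])
qed

lemma distr_eq_0:
  assumes a: "\<And>r. a r < m" and z: "distr m a (p :: 'k::field mpoly) = 0" shows "p = 0"
proof (rule ccontr)
  assume "p \<noteq> 0"
  then have ne: "keys p \<noteq> {}" by simp
  define k where "k = Max ((\<lambda>t. lookup t m) ` keys p)"
  have "k \<in> (\<lambda>t. lookup t m) ` keys p" unfolding k_def by (rule Max_in) (use ne in auto)
  then obtain t where t: "t \<in> keys p" "k = lookup t m" by blast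
  have "zcomp m k p = zcomp m k (distr m a p)"
    by (rule zcomp_distr_top[OF a, symmetric]) (simp add: k_def)
  then have "zcomp m k p = 0" using z by simp
  then have "lookup (zcomp m k p) t = 0" by simp
  then show False using t by (simp add: zcomp_def in_keys_iff)
qed

text \<open>The distraction is linear over the first \<open>m\<close> variables; only closure under
  \<open>x_m\<close> is at stake. By \<open>var_distr\<close> it holds once all parts of an element
  of \<open>I\<close> lie in \<open>I\<close>, which is why \<open>I\<close> must be graded in
  \<open>x_m\<close>.\<close>

lemma homog_ideal_distr:
  assumes a: "\<And>r. a r < m" and I: "homog_ideal (Suc m) I" and zg: "zgraded m I"
  shows "homog_ideal (Suc m) (distr m a ` I)"
proof -
  have iI: "is_ideal (Suc m) I" by (rule homog_ideal_ideal[OF I])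
  have mz: "var m * y \<in> distr m a ` I" if y: "y \<in> distr m a ` I" for y
  proof -
    obtain p where p: "p \<in> I" "y = distr m a p" using y by blast
    have "var s * part m a s p \<in> I" if "s < m" for s
      by (rule is_ideal_mult[OF iI part_mem[OF iI zg p(1)]]) (use that in \<open>simp add: polys_var\<close>)
    then have "var m * p + (\<Sum>s<m. var s * part m a s p) \<in> I"
      using is_ideal_mult[OF iI p(1) polys_var[of m "Suc m"]] by (intro is_ideal_add[OF iI] is_ideal_sum[OF iI]) auto
    then show ?thesis unfolding p(2) var_distr[of a m, OF a] by blast
  qed
  have "is_ideal (Suc m) (distr m a ` I)"
  proof (rule is_idealI)
    show "distr m a ` I \<subseteq> polys (Suc m)" using polys_distr[of a m, OF a] is_ideal_polys[OF iI] by blast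
    show "0 \<in> distr m a ` I" using is_ideal_0[OF iI] by (intro image_eqI[of _ _ 0]) simp_all
    fix p q assume "p \<in> distr m a ` I" "q \<in> distr m a ` I"
    then obtain p' q' where "p' \<in> I" "q' \<in> I" "p = distr m a p'" "q = distr m a q'" by blast
    then show "p + q \<in> distr m a ` I"
      by (intro image_eqI[of _ _ "p' + q'"]) (auto simp: distr_add intro: is_ideal_add[OF iI])
  next
    fix t c y assume t: "t \<in> mons (Suc m)" and y: "y \<in> distr m a ` I"
    obtain u k where u: "t = u + single m k" "u \<in> mons m" by (rule mons_Suc_obtain[OF t])
    have "var m ^ k * y \<in> distr m a ` I"
    proof (induction k)
      case (Suc k) then show ?case using mz[OF Suc] by (simp add: mult.assoc)
    qed (use y in simp)
    then obtain p where p: "p \<in> I" "var m ^ k * y = distr m a p" by blast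
    have "single t c * y = single u c * (var m ^ k * y)"
      by (simp add: u(1) var_power mult_single mult.assoc[symmetric])
    also have "\<dots> = distr m a (single u c * p)" unfolding p(2) by (rule distr_single_mult[OF u(2), symmetric])
    finally show "single t c * y \<in> distr m a ` I"
      using is_ideal_mult[OF iI p(1), of "single u c"] u(2) by (auto simp: mons_lookup)
  qed
  then show ?thesis using homog_ideal_hcomp[OF I] by (auto simp: homog_ideal_def hcomp_distr)
qed

lemma gpiece_distr:
  assumes a: "\<And>r. a r < m" and I: "homog_ideal (Suc m) I"
  shows "gpiece d (distr m a ` I) = distr m a ` gpiece d I"
proof (intro equalityI subsetI)
  fix q assume "q \<in> gpiece d (distr m a ` I)"
  then obtain p where p: "p \<in> I" "q = distr m a p" "homog d q" by (auto simp: gpiece_def)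
  have "q = distr m a (hcomp d p)" using homog_hcomp_eq[OF p(3), of d] hcomp_distr[of d m a p] p(2) by simp
  moreover have "hcomp d p \<in> gpiece d I" using homog_ideal_hcomp[OF I p(1)] homog_hcomp by (auto simp: gpiece_def)
  ultimately show "q \<in> distr m a ` gpiece d I" by blast
qed (auto simp: gpiece_def homog_distr)

lemma hdim_distr:
  assumes a: "\<And>r. a r < m" and I: "homog_ideal (Suc m) I"
  shows "hdim d (distr m a ` I) = hdim d I"
proof -
  have iI: "is_ideal (Suc m) I" by (rule homog_ideal_ideal[OF I])
  show ?thesis unfolding hdim_def gpiece_distr[of a m, OF a I]
    by (rule vector_space_pair.dim_image_inj[OF poly_pair linear_distr subspace_gpiece[OF is_ideal_subspace[OF iI]]
        fin_dim_gpiece[OF is_ideal_subset[OF iI]]]) (rule distr_eq_0[of a m, OF a])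
qed

lemma trunc_factors:
  assumes a: "\<And>r. a r < m"
  shows "trunc m (factors m a k) = (- 1) ^ k * (\<Prod>r<k. var (a r) :: 'k::field mpoly)"
proof (induction k)
  case 0
  have "trunc m (1 :: 'k mpoly) = 1" by (rule trunc_id) (simp flip: single_one)
  then show ?case by (simp add: factors_def)
next
  case (Suc k)
  have "factors m a (Suc k) = var m * factors m a k - var (a k) * (factors m a k :: 'k mpoly)"
    by (simp add: factors_def algebra_simps)
  then show ?case using Suc a[of k] by (simp add: trunc_diff trunc_var_mult mult.left_commute mult.commute)
qed

lemma trunc_mult: "r \<in> polys m \<Longrightarrow> trunc m (r * p) = r * trunc m p"
proof -
  assume r: "r \<in> polys m"
  have "trunc m (r * p) = trunc m (\<Sum>t\<in>keys r. single t (lookup r t) * p)"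
    using poly_eq_sum[of r] by (simp add: sum_distrib_right[symmetric])
  also have "\<dots> = (\<Sum>t\<in>keys r. single t (lookup r t) * trunc m p)"
    unfolding trunc_sum by (rule sum.cong) (use r in \<open>auto simp: polys_iff trunc_single_mult\<close>)
  also have "\<dots> = r * trunc m p" using poly_eq_sum[of r] by (simp add: sum_distrib_right[symmetric])
  finally show ?thesis .
qed

text \<open>At \<open>x_m = 0\<close> the product replacing \<open>x_m ^ k\<close> becomes, up to
  sign, the product of the variables \<open>var (a r)\<close>. Elements of higher sections are
  thereby pushed into the hyperplane section; for \<open>k = 0\<close> this says that the section
  does not shrink.\<close>

lemma zsec_trunc_distr:
  fixes I :: "'k::field mpoly set"
  assumes a: "\<And>r. a r < m" and I: "homog_ideal (Suc m) I" and zg: "zgraded m I" and q: "q \<in> zsec m k I"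
  shows "(\<Prod>r<k. var (a r)) * q \<in> trunc m ` distr m a ` I"
proof -
  have p: "var m ^ k * q \<in> I" "q \<in> polys m" using q by (auto simp: zsec_def)
  have "distr m a (var m ^ k) = (factors m a k :: 'k mpoly)"
    by (simp add: var_power distr_single)
  moreover have "distr m a (var m ^ k * q) = distr m a (q * var m ^ k)" by (simp only: mult.commute)
  ultimately have "distr m a (var m ^ k * q) = q * factors m a k"
    using distr_mult[OF p(2), of a "var m ^ k"] by simp
  then have "trunc m (distr m a (var m ^ k * q)) = q * trunc m (factors m a k)"
    using trunc_mult[OF p(2)] by simp
  also have "\<dots> = (- 1) ^ k * ((\<Prod>r<k. var (a r)) * q)"
    unfolding trunc_factors[of a m, OF a] by (simp add: ac_simps)
  finally have "trunc m (distr m a (var m ^ k * q)) = (- 1) ^ k * ((\<Prod>r<k. var (a r)) * q)" .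
  then have "(- 1) ^ k * ((\<Prod>r<k. var (a r)) * q) \<in> trunc m ` distr m a ` I" using p(1) by (metis image_eqI)
  then have "(- 1) ^ k * ((- 1) ^ k * ((\<Prod>r<k. var (a r)) * q)) \<in> trunc m ` distr m a ` I"
    by (rule sign_mult_ideal[OF homog_ideal_ideal[OF homog_ideal_trunc[OF homog_ideal_distr[of a m, OF a I zg]]]])
  then show ?thesis by (simp only: sign_sign)
qed

section \<open>Distraction as a map of Koszul complexes\<close>

abbreviation inversions :: "nat \<Rightarrow> nat set \<Rightarrow> nat" where
  "inversions s T \<equiv> card {t\<in>T. t < s}"

lemma sign_cancel: "(- 1) ^ n * ((- 1) ^ n * y) = (y :: 'r::comm_ring_1)"
  by (cases "even n") auto

lemma sign_exchange:
  "(- 1) ^ (p + 1) * (- 1) ^ (Suc c + q) = ((- 1) ^ (c + q) * (- 1) ^ p :: 'r::comm_ring_1)"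
  "(- 1) ^ p * (- 1) ^ (Suc c + (q + 1)) = ((- 1) ^ (c + q) * (- 1) ^ p :: 'r::comm_ring_1)"
  by (cases "even p"; cases "even q"; cases "even c"; simp)+

text \<open>Multiplication by a variable is null-homotopic on the Koszul complex; this is the bookkeeping
  of signs behind the homotopy formula.\<close>

lemma koszul_homotopy:
  fixes x :: "nat \<Rightarrow> 'r::comm_ring_1" and F :: "nat \<Rightarrow> nat set \<Rightarrow> 'r"
  assumes fin: "finite T" "finite D" and disj: "D \<inter> T = {}"
  shows "(\<Sum>s\<in>D. (- 1) ^ inversions s T * (x s * (\<Sum>r\<in>insert s T. (- 1) ^ (Suc (card T) + inversions r (insert s T - {r})) * F r (insert s T - {r}))))
      + (- 1) ^ card T * (\<Sum>r\<in>D \<union> T. x r * F r T)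
    = (\<Sum>r\<in>T. (- 1) ^ (card T + inversions r (T - {r})) * (\<Sum>s\<in>insert r D. (- 1) ^ inversions s (T - {r}) * (x s * F r (insert s (T - {r})))))"
    (is "?L1 + ?L2 = ?R")
proof -
  let ?c = "card T" and ?n = inversions
  have ins: "insert s T - {r} = insert s (T - {r})" if "s \<in> D" "r \<in> T" for s r
    using that disj by auto
  have c: "(- 1) ^ ?n s T * (- 1) ^ (Suc ?c + ?n r (insert s (T - {r})))
      = ((- 1) ^ (?c + ?n r (T - {r})) * (- 1) ^ ?n s (T - {r}) :: 'r)" if sr: "s \<in> D" "r \<in> T" for s r
  proof -
    have ne: "s \<noteq> r" "s \<notin> T" using sr disj by auto
    have "?n s T = ?n s (T - {r}) + (if r < s then 1 else 0)"
      using card_less_insert[of "T - {r}" r s] fin sr by (simp add: insert_absorb)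
    moreover have "?n r (insert s (T - {r})) = ?n r (T - {r}) + (if s < r then 1 else 0)"
      using card_less_insert[of "T - {r}" s r] fin ne by simp
    ultimately show ?thesis using ne sign_exchange[of "?n s (T - {r})" ?c "?n r (T - {r})", where 'r='r]
      by (cases s r rule: linorder_cases) simp_all
  qed
  \<comment> \<open>The summand \<open>r = s\<close> restores \<open>T\<close> and will cancel
    against the sum over \<open>D\<close> in \<open>?L2\<close>. The remaining summands form the
    double sum on the right, with the order of summation exchanged.\<close>
  have L1: "?L1 = (\<Sum>s\<in>D. - ((- 1) ^ ?c * (x s * F s T)))
      + (\<Sum>s\<in>D. \<Sum>r\<in>T. (- 1) ^ (?c + ?n r (T - {r})) * ((- 1) ^ ?n s (T - {r}) * (x s * F r (insert s (T - {r})))))"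
    unfolding sum.distrib[symmetric]
  proof (rule sum.cong[OF refl])
    fix s assume s: "s \<in> D"
    have sT: "s \<notin> T" "insert s T - {s} = T" using s disj by auto
    have "(- 1) ^ ?n s T * (x s * ((- 1) ^ (Suc ?c + ?n s T) * F s T)) = - ((- 1) ^ ?c * (x s * F s T))"
      by (cases "even (?n s T)"; cases "even ?c"; simp)
    moreover have "(- 1) ^ ?n s T * (x s * (\<Sum>r\<in>T. (- 1) ^ (Suc ?c + ?n r (insert s T - {r})) * F r (insert s T - {r})))
      = (\<Sum>r\<in>T. (- 1) ^ (?c + ?n r (T - {r})) * ((- 1) ^ ?n s (T - {r}) * (x s * F r (insert s (T - {r})))))"
      unfolding sum_distrib_left
    proof (rule sum.cong[OF refl])
      fix r assume r: "r \<in> T"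
      show "(- 1) ^ ?n s T * (x s * ((- 1) ^ (Suc ?c + ?n r (insert s T - {r})) * F r (insert s T - {r})))
        = (- 1) ^ (?c + ?n r (T - {r})) * ((- 1) ^ ?n s (T - {r}) * (x s * F r (insert s (T - {r}))))"
        unfolding ins[OF s r] using arg_cong[OF c[OF s r], of "\<lambda>y. y * (x s * F r (insert s (T - {r})))"]
        by (simp only: ac_simps)
    qed
    ultimately show "(- 1) ^ ?n s T * (x s * (\<Sum>r\<in>insert s T. (- 1) ^ (Suc ?c + ?n r (insert s T - {r})) * F r (insert s T - {r})))
      = - ((- 1) ^ ?c * (x s * F s T))
        + (\<Sum>r\<in>T. (- 1) ^ (?c + ?n r (T - {r})) * ((- 1) ^ ?n s (T - {r}) * (x s * F r (insert s (T - {r})))))"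
      unfolding sum.insert[OF fin(1) sT(1)] sT(2) distrib_left by (simp only:)
  qed
  have L2: "?L2 = (\<Sum>s\<in>D. (- 1) ^ ?c * (x s * F s T)) + (\<Sum>r\<in>T. (- 1) ^ ?c * (x r * F r T))"
    unfolding sum_distrib_left using sum.union_disjoint[OF fin(2,1) disj] by blast
  have "?R = (\<Sum>r\<in>T. (- 1) ^ ?c * (x r * F r T))
      + (\<Sum>r\<in>T. \<Sum>s\<in>D. (- 1) ^ (?c + ?n r (T - {r})) * ((- 1) ^ ?n s (T - {r}) * (x s * F r (insert s (T - {r})))))"
    unfolding sum.distrib[symmetric]
  proof (rule sum.cong[OF refl])
    fix r assume r: "r \<in> T"
    have rD: "r \<notin> D" "insert r (T - {r}) = T" using r disj by auto
    have "(- 1) ^ (?c + ?n r (T - {r})) * ((- 1) ^ ?n r (T - {r}) * y) = (- 1) ^ ?c * y" for y :: 'r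
      by (simp only: power_add mult.assoc sign_cancel)
    then show "(- 1) ^ (?c + ?n r (T - {r})) * (\<Sum>s\<in>insert r D. (- 1) ^ ?n s (T - {r}) * (x s * F r (insert s (T - {r}))))
      = (- 1) ^ ?c * (x r * F r T)
        + (\<Sum>s\<in>D. (- 1) ^ (?c + ?n r (T - {r})) * ((- 1) ^ ?n s (T - {r}) * (x s * F r (insert s (T - {r})))))"
      unfolding sum.insert[OF fin(2) rD(1)] rD(2) distrib_left sum_distrib_left by (simp only:)
  qed
  also have "(\<Sum>r\<in>T. \<Sum>s\<in>D. (- 1) ^ (?c + ?n r (T - {r})) * ((- 1) ^ ?n s (T - {r}) * (x s * F r (insert s (T - {r})))))
    = (\<Sum>s\<in>D. \<Sum>r\<in>T. (- 1) ^ (?c + ?n r (T - {r})) * ((- 1) ^ ?n s (T - {r}) * (x s * F r (insert s (T - {r})))))"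
    by (rule sum.swap)
  finally show ?thesis unfolding L1 L2 by (simp add: sum_negf)
qed

text \<open>Applying \<open>distr m a\<close> to coefficients is not a chain map: by
  \<open>var_distr\<close> a coefficient at a set with \<open>m\<close> leaves extra terms
  \<open>x_s\<close> times its part \<open>s\<close>. Multiplication by \<open>x_s\<close> is
  null-homotopic on the Koszul complex, the homotopy being multiplication by \<open>e_s\<close>. So
  the extra terms are removed by adding the part \<open>s\<close> of the coefficient, with
  \<open>e_s\<close> in place of \<open>e_m\<close>.\<close>

definition correction :: "nat \<Rightarrow> (nat \<Rightarrow> nat) \<Rightarrow> (nat set \<Rightarrow> 'k::field mpoly) \<Rightarrow> (nat set \<Rightarrow> 'k mpoly)" where
  "correction m a f S = (if m \<in> S then 0 else
    (\<Sum>s\<in>S \<inter> {..<m}. (- 1) ^ (card S + inversions s (S - {s})) * part m a s (f (insert m (S - {s})))))"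

definition distr_chain :: "nat \<Rightarrow> (nat \<Rightarrow> nat) \<Rightarrow> (nat set \<Rightarrow> 'k::field mpoly) \<Rightarrow> (nat set \<Rightarrow> 'k mpoly)" where
  "distr_chain m a f S = distr m a (f S + correction m a f S)"

lemma correction_add: "correction m a (f + g) S = correction m a f S + correction m a g S"
  by (simp add: correction_def part_add distrib_left sum.distrib)

lemma correction_cscale: "correction m a (cscale c f) S = pscale c (correction m a f S)"
  by (simp add: correction_def lookup_cscale part_pscale mult_pscale pv.scale_sum_right)

lemma linear_distr_chain: "Vector_Spaces.linear cscale cscale (distr_chain m a)"
  by (rule linear_cscaleI)
    (auto simp: distr_chain_def fun_eq_iff correction_add correction_cscale distr_add distr_pscale lookup_cscale pv.scale_right_distrib ac_simps)

lemma card_swap_last: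
  assumes "finite S" "s \<in> S" "m \<notin> S" shows "card (insert m (S - {s})) = card S"
  using assms card.remove[OF assms(1,2)] by simp

lemma correction_support:
  assumes f: "f \<in> kchains (Suc m) I i j" and ne: "correction m a f S \<noteq> 0"
  shows "S \<subseteq> {..<m} \<and> card S = i"
proof -
  have mS: "m \<notin> S" using ne by (auto simp: correction_def)
  then have "\<exists>s\<in>S \<inter> {..<m}. f (insert m (S - {s})) \<noteq> 0"
    using ne by (auto simp: correction_def intro!: sum.neutral)
  then obtain s where s: "s \<in> S" "s < m" "f (insert m (S - {s})) \<noteq> 0" by auto
  have sup: "insert m (S - {s}) \<subseteq> {..<Suc m}" "card (insert m (S - {s})) = i" using kchains_support[OF f s(3)] by auto
  have "S \<subseteq> {..<Suc m}" using sup(1) s(2) by auto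
  then have S: "S \<subseteq> {..<m}" using subset_less_Suc mS by blast
  then have "finite S" using finite_subset by blast
  then show ?thesis using sup(2) card_swap_last[OF _ s(1) mS] S by simp
qed

lemma correction_gpiece:
  assumes I: "is_ideal (Suc m) I" "zgraded m I" and f: "\<And>S. f S \<in> gpiece d I"
  shows "correction m a f S \<in> gpiece d I"
proof -
  have "(- 1) ^ n * part m a s (f U) \<in> gpiece d I" for n s U
  proof -
    have "f U \<in> I" "homog d (f U)" using f[of U] by (auto simp: gpiece_def)
    then show ?thesis
      unfolding gpiece_iff using sign_mult_ideal[OF I(1) part_mem[OF I]] homog_sign[OF homog_part] by blast
  qed
  then show ?thesis unfolding correction_def
    using pv.subspace_0[OF subspace_gpiece[OF is_ideal_subspace[OF I(1)]]]
    by (auto intro: pv.subspace_sum[OF subspace_gpiece[OF is_ideal_subspace[OF I(1)]]])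
qed

lemma distr_chain_kchains:
  assumes a: "\<And>r. a r < m" and I: "homog_ideal (Suc m) I" "zgraded m I" and f: "f \<in> kchains (Suc m) I i j"
  shows "distr_chain m a f \<in> kchains (Suc m) (distr m a ` I) i j"
proof (cases "i \<le> j")
  case False
  have iI: "is_ideal (Suc m) I" by (rule homog_ideal_ideal[OF I(1)])
  have "f = 0" using f kchains_trivial[OF False iI] by simp
  then have "distr_chain m a f = 0" by (auto simp: distr_chain_def correction_def fun_eq_iff)
  then show ?thesis using kchains_trivial[OF False homog_ideal_ideal[OF homog_ideal_distr[of a m, OF a I]]] by simp
next
  case True
  have iI: "is_ideal (Suc m) I" by (rule homog_ideal_ideal[OF I(1)])
  show ?thesis
  proof (rule kchainsI[OF True])
    fix S
    have "f S + correction m a f S \<in> gpiece (j - i) I"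
      by (intro pv.subspace_add[OF subspace_gpiece[OF is_ideal_subspace[OF iI]]]
          correction_gpiece[OF iI I(2)] kchains_gpiece[OF f])
    then show "distr_chain m a f S \<in> gpiece (j - i) (distr m a ` I)"
      unfolding distr_chain_def gpiece_distr[of a m, OF a I(1)] by blast
    assume "distr_chain m a f S \<noteq> 0"
    then have "f S \<noteq> 0 \<or> correction m a f S \<noteq> 0" by (auto simp: distr_chain_def)
    then show "S \<subseteq> {..<Suc m} \<and> card S = i"
      using kchains_support[OF f, of S] correction_support[OF f, of a S] by (auto simp: subset_iff less_Suc_eq)
  qed
qed

text \<open>The correction reads only coefficients at sets containing \<open>m\<close> and changes
  only the others. Adding it is thus a unitriangular operation, undone by subtracting the same
  correction.\<close>

lemma distr_chain_surj:
  assumes a: "\<And>r. a r < m" and I: "homog_ideal (Suc m) I" "zgraded m I"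
    and h: "h \<in> kchains (Suc m) (distr m a ` I) i j"
  shows "\<exists>f\<in>kchains (Suc m) I i j. distr_chain m a f = h"
proof -
  have iI: "is_ideal (Suc m) I" by (rule homog_ideal_ideal[OF I(1)])
  note sg = subspace_gpiece[OF is_ideal_subspace[OF iI]]
  have "\<forall>S. \<exists>p. p \<in> gpiece (j - i) I \<and> distr m a p = h S"
  proof
    fix S
    have "h S \<in> distr m a ` gpiece (j - i) I"
      using kchains_gpiece[OF h, of S] unfolding gpiece_distr[of a m, OF a I(1)] .
    then show "\<exists>p. p \<in> gpiece (j - i) I \<and> distr m a p = h S" by auto
  qed
  then obtain g where g: "\<And>S. g S \<in> gpiece (j - i) I" "\<And>S. distr m a (g S) = h S" by metis
  have g0: "g S \<noteq> 0 \<Longrightarrow> h S \<noteq> 0" for S using distr_eq_0[of a m "g S", OF a] g(2)[of S] by auto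
  have gk: "g \<in> kchains (Suc m) I i j"
  proof -
    have "S \<subseteq> {..<Suc m} \<and> card S = i \<and> i \<le> j" if "g S \<noteq> 0" for S
      by (rule kchains_support[OF h g0[OF that]])
    then show ?thesis using g(1) by (simp add: kchains_def)
  qed
  define f where "f = (\<lambda>S. g S - correction m a g S)"
  have fm: "f S = g S" if "m \<in> S" for S using that by (simp add: f_def correction_def)
  have "correction m a f S = correction m a g S" for S
    unfolding correction_def using fm by simp
  then have "distr_chain m a f = h" by (auto simp: distr_chain_def fun_eq_iff f_def g(2))
  moreover have "f \<in> kchains (Suc m) I i j"
  proof -
    have "f S \<in> gpiece (j - i) I" for S
      unfolding f_def by (intro pv.subspace_diff[OF sg] g(1) correction_gpiece[OF iI I(2)])
    moreover have "S \<subseteq> {..<Suc m} \<and> card S = i \<and> i \<le> j" if "f S \<noteq> 0" for S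
    proof (cases "g S = 0")
      case True
      then have ne: "correction m a g S \<noteq> 0" using that by (simp add: f_def)
      have "\<exists>U. g U \<noteq> 0"
      proof (rule ccontr)
        assume "\<not> (\<exists>U. g U \<noteq> 0)"
        then show False using ne by (simp add: correction_def split: if_splits)
      qed
      then have "i \<le> j" using kchains_support[OF gk] by blast
      then show ?thesis using correction_support[OF gk ne] by auto
    next
      case False then show ?thesis using kchains_support[OF gk] by blast
    qed
    ultimately show ?thesis by (simp add: kchains_def)
  qed
  ultimately show ?thesis by blast
qed

lemma distr_chain_eq_0:
  assumes a: "\<And>r. a r < m" and z: "distr_chain m a f = 0" shows "f = 0"
proof -
  have s: "f S + correction m a f S = 0" for S
    using distr_eq_0[of a m "f S + correction m a f S", OF a] fun_cong[OF z, of S] by (simp add: distr_chain_def)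
  have fm: "f S = 0" if "m \<in> S" for S using s[of S] that by (simp add: correction_def)
  then have "correction m a f S = 0" for S by (simp add: correction_def)
  then show ?thesis using s by (auto simp: fun_eq_iff)
qed

text \<open>At sets containing \<open>m\<close> no correction intervenes, and linearity over the
  first \<open>m\<close> variables suffices. At the others the term \<open>s = m\<close>
  contributes, by \<open>var_distr\<close>, an additional sum of \<open>var s * F s T\<close>;
  \<open>koszul_homotopy\<close> shows that this sum together with the differential of the
  correction is the correction of the differential.\<close>

lemma kdiff_distr_chain:
  fixes f :: "nat set \<Rightarrow> 'k::field mpoly"
  assumes a: "\<And>r. a r < m" and f: "f \<in> kchains (Suc m) I i j"
  shows "kdiff (Suc m) i (distr_chain m a f) = distr_chain m a (kdiff (Suc m) i f)"
proof
  fix T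
  let ?g = "kdiff (Suc m) i f"
  have dm: "var s * distr m a p = distr m a (var s * p)" if "s < m" for s p
    using distr_mult[OF polys_var[OF that], of a p] by simp
  show "kdiff (Suc m) i (distr_chain m a f) T = distr_chain m a ?g T"
  proof (cases "0 < i \<and> T \<subseteq> {..<Suc m} \<and> card T = i - 1")
    case False
    have "correction m a ?g T = 0"
    proof (cases "m \<in> T")
      case mT: False
      have "?g (insert m (T - {s})) = 0" if s: "s \<in> T \<inter> {..<m}" for s
      proof (rule ccontr)
        assume "?g (insert m (T - {s})) \<noteq> 0"
        then have h: "0 < i" "insert m (T - {s}) \<subseteq> {..<Suc m}" "card (insert m (T - {s})) = i - 1"
          using kdiff_support by blast+
        have T: "T \<subseteq> {..<Suc m}" using h(2) s by auto
        then have "card T = i - 1" using h(3) card_swap_last[OF finite_subset[OF T] _ mT] s by simp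
        then show False using False h(1) T by blast
      qed
      then show ?thesis by (simp add: correction_def)
    qed (simp add: correction_def)
    moreover have "kdiff (Suc m) i g T = 0" for g :: "nat set \<Rightarrow> 'k mpoly" using False by (simp only: kdiff_def if_False)
    ultimately show ?thesis by (simp add: distr_chain_def)
  next
    case True
    then obtain c where i: "i = Suc c" "card T = c" by (cases i) auto
    have Ts: "T \<subseteq> {..<Suc m}" using True by blast
    have fT: "finite T" by (rule finite_subset[OF Ts finite_lessThan])
    show ?thesis
    proof (cases "m \<in> T")
      case mT: True
      have "kdiff (Suc m) i (distr_chain m a f) T
        = (\<Sum>s\<in>{..<Suc m} - T. (- 1) ^ inversions s T * var s * distr_chain m a f (insert s T))"
        using True by (simp add: kdiff_def)
      also have "\<dots> = (\<Sum>s\<in>{..<Suc m} - T. distr m a ((- 1) ^ inversions s T * var s * f (insert s T)))"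
      proof (rule sum.cong[OF refl])
        fix s assume "s \<in> {..<Suc m} - T"
        then have "s < m" using mT by (auto simp: less_Suc_eq)
        then show "(- 1) ^ inversions s T * var s * distr_chain m a f (insert s T) = distr m a ((- 1) ^ inversions s T * var s * f (insert s T))"
          using mT by (simp add: distr_chain_def correction_def mult.assoc distr_sign dm)
      qed
      also have "\<dots> = distr m a (?g T)" using True by (simp add: kdiff_def distr_sum)
      finally show ?thesis using mT by (simp add: distr_chain_def correction_def)
    next
      case mT: False
      have T: "T \<subseteq> {..<m}" by (rule subset_less_Suc[OF Ts mT])
      let ?D = "{..<m} - T"
      have DT: "?D \<union> T = {..<m}" using T by auto
      define F where "F = (\<lambda>r U. part m a r (f (insert m U)))"
      have cor: "correction m a f (insert s T)
          = (\<Sum>r\<in>insert s T. (- 1) ^ (Suc (card T) + inversions r (insert s T - {r})) * F r (insert s T - {r}))" if "s \<in> ?D" for s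
      proof -
        have "insert s T \<inter> {..<m} = insert s T" "m \<notin> insert s T" "card (insert s T) = Suc (card T)"
          using that T mT fT by auto
        then show ?thesis unfolding correction_def F_def by simp
      qed
      have "kdiff m i (distr_chain m a f) T = distr m a (\<Sum>s\<in>?D. (- 1) ^ inversions s T * (var s * (f (insert s T) + correction m a f (insert s T))))"
        using T i by (auto simp: kdiff_def distr_chain_def distr_sum distr_sign dm mult.assoc intro!: sum.cong)
      moreover have "var m * distr_chain m a f (insert m T) = distr m a (var m * f (insert m T) + (\<Sum>s<m. var s * F s T))"
        unfolding distr_chain_def F_def using var_distr[of a m, OF a] by (simp add: correction_def)
      ultimately have L: "kdiff (Suc m) i (distr_chain m a f) T
        = distr m a ((\<Sum>s\<in>?D. (- 1) ^ inversions s T * (var s * (f (insert s T) + correction m a f (insert s T))))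
          + (- 1) ^ c * (var m * f (insert m T) + (\<Sum>s<m. var s * F s T)))"
        unfolding i(1) kdiff_Suc[OF T i(2)] by (simp add: distr_add distr_sign)
      have gT: "?g T = (\<Sum>s\<in>?D. (- 1) ^ inversions s T * (var s * f (insert s T))) + (- 1) ^ c * (var m * f (insert m T))"
        unfolding i(1) kdiff_Suc[OF T i(2)] using T i by (simp add: kdiff_def mult.assoc)
      have pg: "part m a r (?g (insert m (T - {r})))
        = (\<Sum>s\<in>insert r ?D. (- 1) ^ inversions s (T - {r}) * (var s * F r (insert s (T - {r}))))" if r: "r \<in> T" for r
      proof -
        let ?U = "insert m (T - {r})"
        have U: "?U \<subseteq> {..<Suc m}" "card ?U = c" using T card_swap_last[OF fT r mT] i(2) by auto
        have e: "{..<Suc m} - ?U = insert r ?D" using r T by auto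
        have "part m a r (?g ?U) = (\<Sum>s\<in>insert r ?D. part m a r ((- 1) ^ inversions s ?U * (var s * f (insert s ?U))))"
          using U i(1) by (simp add: kdiff_def e part_sum mult.assoc)
        also have "\<dots> = (\<Sum>s\<in>insert r ?D. (- 1) ^ inversions s (T - {r}) * (var s * F r (insert s (T - {r}))))"
        proof (rule sum.cong[OF refl])
          fix s assume "s \<in> insert r ?D"
          then have sm: "s < m" using r T by auto
          have "{t\<in>?U. t < s} = {t\<in>T - {r}. t < s}" using sm by auto
          then show "part m a r ((- 1) ^ inversions s ?U * (var s * f (insert s ?U)))
            = (- 1) ^ inversions s (T - {r}) * (var s * F r (insert s (T - {r})))"
            using sm by (simp add: part_sign part_var F_def insert_commute)
        qed
        finally show ?thesis .
      qed
      have "correction m a ?g T = (\<Sum>r\<in>T. (- 1) ^ (card T + inversions r (T - {r})) * part m a r (?g (insert m (T - {r}))))"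
      proof -
        have "T \<inter> {..<m} = T" using T by auto
        then show ?thesis using mT by (simp add: correction_def)
      qed
      also have "\<dots> = (\<Sum>r\<in>T. (- 1) ^ (card T + inversions r (T - {r})) * (\<Sum>s\<in>insert r ?D. (- 1) ^ inversions s (T - {r}) * (var s * F r (insert s (T - {r})))))"
        by (rule sum.cong[OF refl]) (simp only: pg)
      also have "\<dots> = (\<Sum>s\<in>?D. (- 1) ^ inversions s T * (var s * (\<Sum>r\<in>insert s T. (- 1) ^ (Suc (card T) + inversions r (insert s T - {r})) * F r (insert s T - {r}))))
          + (- 1) ^ card T * (\<Sum>r\<in>?D \<union> T. var r * F r T)"
        by (rule koszul_homotopy[symmetric]) (use fT in auto)
      also have "\<dots> = (\<Sum>s\<in>?D. (- 1) ^ inversions s T * (var s * correction m a f (insert s T))) + (- 1) ^ c * (\<Sum>r<m. var r * F r T)"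
        unfolding DT i(2) by (simp add: cor i(2))
      finally have C: "correction m a ?g T
        = (\<Sum>s\<in>?D. (- 1) ^ inversions s T * (var s * correction m a f (insert s T))) + (- 1) ^ c * (\<Sum>r<m. var r * F r T)" .
      show ?thesis unfolding L distr_chain_def gT C by (simp add: distrib_left sum.distrib algebra_simps)
    qed
  qed
qed

text \<open>\<open>distr_chain\<close> commutes with the differentials, is injective and reaches
  every chain of the distracted ideal. Cycles therefore inject and boundaries lift.\<close>

theorem betti_distr:
  assumes a: "\<And>r. a r < m" and I: "homog_ideal (Suc m) I" "zgraded m I"
  shows "betti (Suc m) I i j \<le> betti (Suc m) (distr m a ` I) i j"
proof -
  let ?n = "Suc m" and ?D = "distr m a ` I"
  have iI: "is_ideal ?n I" by (rule homog_ideal_ideal[OF I(1)])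
  have iD: "is_ideal ?n ?D" by (rule homog_ideal_ideal[OF homog_ideal_distr[of a m, OF a I]])
  have "distr_chain m a ` cycles ?n I i j \<subseteq> cycles ?n ?D i j"
  proof (rule image_subsetI)
    fix f assume "f \<in> cycles ?n I i j"
    then have f: "f \<in> kchains ?n I i j" "kdiff ?n i f = 0" by (auto simp: cycles_def zero_fun_def)
    have "kdiff ?n i (distr_chain m a f) = distr_chain m a 0"
      using kdiff_distr_chain[of a m, OF a f(1)] f(2) by simp
    also have "\<dots> = 0" by (auto simp: distr_chain_def correction_def fun_eq_iff)
    finally show "distr_chain m a f \<in> cycles ?n ?D i j"
      using distr_chain_kchains[of a m, OF a I f(1)] by (simp add: cycles_def zero_fun_def)
  qed
  then have "cv.dim (distr_chain m a ` cycles ?n I i j) \<le> cv.dim (cycles ?n ?D i j)"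
    by (rule cv.dim_le_of_subset) (rule fin_dim_cycles[OF iD])
  moreover have "cv.dim (distr_chain m a ` cycles ?n I i j) = cv.dim (cycles ?n I i j)"
    by (rule vector_space_pair.dim_image_inj[OF chain_pair linear_distr_chain subspace_cycles[OF iI] fin_dim_cycles[OF iI]])
      (rule distr_chain_eq_0[of a m, OF a])
  moreover have "boundaries ?n ?D i j \<subseteq> distr_chain m a ` boundaries ?n I i j"
  proof
    fix x assume "x \<in> boundaries ?n ?D i j"
    then obtain h where h: "h \<in> kchains ?n ?D (Suc i) j" "x = kdiff ?n (Suc i) h" by (auto simp: boundaries_def)
    obtain f where f: "f \<in> kchains ?n I (Suc i) j" "distr_chain m a f = h"
      using distr_chain_surj[of a m, OF a I h(1)] by blast
    have "x = distr_chain m a (kdiff ?n (Suc i) f)" using kdiff_distr_chain[of a m, OF a f(1)] f(2) h(2) by simp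
    then show "x \<in> distr_chain m a ` boundaries ?n I i j" using f(1) unfolding boundaries_def by blast
  qed
  then have "cv.dim (boundaries ?n ?D i j) \<le> cv.dim (distr_chain m a ` boundaries ?n I i j)"
    by (rule cv.dim_le_of_subset)
      (rule vector_space_pair.fin_dim_image[OF chain_pair linear_distr_chain fin_dim_boundaries[OF iI]])
  moreover have "cv.dim (distr_chain m a ` boundaries ?n I i j) \<le> cv.dim (boundaries ?n I i j)"
    by (rule vector_space_pair.dim_image_le[OF chain_pair linear_distr_chain subspace_boundaries[OF iI] fin_dim_boundaries[OF iI]])
  ultimately show ?thesis unfolding betti_eq by arith
qed

section \<open>The extremal ideal and the induction step\<close>

text \<open>Provides the sequence that defines the distraction belonging to \<open>w\<close>. The
  values \<open>a r\<close> with \<open>r \<ge> k\<close> do not affect the product but must be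
  indices below \<open>m\<close>, hence \<open>0 < m\<close>.\<close>

lemma monomial_eq_prod_var:
  assumes "0 < m" "w \<in> mons m" "tdeg w = k"
  shows "\<exists>a. (\<forall>r. a r < m) \<and> single w 1 = (\<Prod>r<k. var (a r) :: 'k::field mpoly)"
  using assms(2,3)
proof (induction k arbitrary: w)
  case 0 then show ?case using assms(1) by (intro exI[of _ "\<lambda>_. 0"]) simp
next
  case (Suc k)
  then have "w \<noteq> 0" by auto
  then obtain i where i: "i \<in> keys w" by (metis keys_eq_empty ex_in_conv)
  have w: "w = (w - xv i) + xv i" by (rule split_off_variable[OF i])
  have im: "i < m" using i Suc.prems(1) by (simp add: mons_def)
  have "tdeg w = tdeg (w - xv i) + 1" using arg_cong[OF w, of tdeg] by simp
  moreover have "w - xv i \<in> mons m" using Suc.prems(1) w mons_add_iff by metis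
  ultimately obtain a where a: "\<forall>r. a r < m" "single (w - xv i) 1 = (\<Prod>r<k. var (a r) :: 'k mpoly)"
    using Suc.IH[of "w - xv i"] Suc.prems(2) by auto
  have "single w (1::'k) = single (w - xv i) 1 * var i"
    using w by (simp add: var_def mult_single)
  also have "\<dots> = (\<Prod>r<Suc k. var ((a(k := i)) r))" using a(2) by simp
  finally show ?case using a(1) im by (intro exI[of _ "a(k := i)"]) auto
qed

text \<open>The prescribed powers involve only variables before \<open>x_m\<close>, as
  \<open>length es \<le> m\<close>, so exchanging a factor \<open>x_m\<close> for \<open>x_s\<close>
  does not lower the relevant exponents. In the lex ideal the exchange leads to a larger
  monomial.\<close>

lemma lex_plus_powers_stable:
  fixes L :: "'k::field mpoly set"
  assumes es: "length es \<le> m" and L: "lex_ideal (Suc m) L"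
    and U: "U = {t\<in>mons (Suc m). single t 1 \<in> L} \<union> pow_mons (Suc m) es"
  shows "last_stable m (monomial_ideal (Suc m) U :: 'k mpoly set)"
proof (rule last_stable_monomial_ideal)
  show "up_closed (Suc m) U" unfolding U by (rule lex_plus_powers_eq(2)[OF _ L]) (use es in simp)
  fix u s assume u: "u + xv m \<in> U" "u \<in> mons (Suc m)" and s: "s < m"
  have um: "u + xv s \<in> mons (Suc m)" using u(2) s by (simp add: mons_single_iff)
  show "u + xv s \<in> U"
  proof (cases "u + xv m \<in> pow_mons (Suc m) es")
    case True
    then obtain i where i: "i < length es" "es ! i \<le> lookup (u + xv m) i" by (auto simp: pow_mons_def)
    have "lookup (u + xv m) i \<le> lookup (u + xv s) i"
      using i(1) es by (simp add: lookup_add lookup_single)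
    then have "u + xv s \<in> pow_mons (Suc m) es" using um i by (auto simp: pow_mons_def intro: order_trans)
    then show ?thesis by (simp add: U)
  next
    case False
    then have "single (u + xv m) 1 \<in> L" "u + xv m \<in> mons (Suc m)" using u(1) by (auto simp: U)
    moreover have "lex_gt (u + xv s) (u + xv m)"
      unfolding lex_gt_iff using xv_strict_antimono[OF s] by (rule add_strict_left_mono)
    moreover have "tdeg (u + xv s) = tdeg (u + xv m)" by simp
    ultimately have "single (u + xv s) 1 \<in> L" using L um unfolding lex_ideal_def by blast
    then show ?thesis using um by (simp add: U)
  qed
qed

lemma lex_plus_powers_segment:
  assumes "lex_ideal m (L :: 'k::field mpoly set)"
    and U: "U = {t\<in>mons m. single t 1 \<in> L} \<union> pow_mons m es"
  shows "segment (cap_mons m es d) (U \<inter> cap_mons m es d)"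
  unfolding segment_def
proof (intro conjI ballI impI)
  fix t u assume t: "t \<in> U \<inter> cap_mons m es d" and u: "u \<in> cap_mons m es d" "t < u"
  have "t \<in> mons m" "u \<in> mons m" "tdeg u = tdeg t" "single t 1 \<in> L" using t u(1) by (auto simp: U cap_mons_def)
  then have "single u 1 \<in> L" using assms(1) u(2) unfolding lex_ideal_def lex_gt_iff by blast
  then show "u \<in> U \<inter> cap_mons m es d" using u(1) by (auto simp: U cap_mons_def)
qed simp

text \<open>Take \<open>Y\<close> with the largest possible section at \<open>x\<^sub>m = 0\<close> in degrees up to \<open>j\<close>: a distraction
  can then no longer enlarge this section.\<close>

lemma extremal_ideal:
  fixes I :: "'k::field mpoly set"
  assumes I: "homog_ideal (Suc m) I" and G: "G \<subseteq> trunc m ` I"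
  obtains Y where "homog_ideal (Suc m) Y" "zgraded m Y" "G \<subseteq> trunc m ` Y" "\<And>d. hdim d Y = hdim d I"
    "betti (Suc m) I i j \<le> betti (Suc m) Y i j"
    "\<And>d k w q. d \<le> j \<Longrightarrow> k \<le> d \<Longrightarrow> w \<in> mons m \<Longrightarrow> tdeg w = k \<Longrightarrow> q \<in> gpiece (d - k) (zsec m k Y)
      \<Longrightarrow> single w 1 * q \<in> zsec m 0 Y"
proof -
  define P where "P = (\<lambda>X. homog_ideal (Suc m) X \<and> G \<subseteq> trunc m ` X \<and> (\<forall>d. hdim d X = hdim d I)
    \<and> betti (Suc m) I i j \<le> betti (Suc m) X i j)"
  \<comment> \<open>Summing over degrees up to \<open>j\<close> keeps the quantity bounded. When one
    section contains another, equal sums force equal dimensions in every degree of this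
    range.\<close>
  define \<Phi> where "\<Phi> = (\<lambda>X :: 'k mpoly set. \<Sum>d\<le>j. hdim d (trunc m ` X))"
  have "\<Phi> X \<le> (\<Sum>d\<le>j. hdim d (polys m :: 'k mpoly set))" for X
    unfolding \<Phi>_def by (intro sum_mono hdim_mono[OF _ subset_refl]) (use trunc_polys in blast)
  moreover have "P I" using I G by (simp add: P_def)
  ultimately obtain X where X: "P X" and max: "\<And>X'. P X' \<Longrightarrow> \<Phi> X' \<le> \<Phi> X"
    using ex_has_greatest_nat[of P I \<Phi> "Suc (\<Sum>d\<le>j. hdim d (polys m :: 'k mpoly set))"]
    by (auto simp: less_Suc_eq_le)
  have hX: "homog_ideal (Suc m) X" using X by (simp add: P_def)
  \<comment> \<open>Distractions are available only for ideals graded in \<open>x_m\<close>. Passing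
    to initial components provides this and leaves the section, and with it the maximum,
    unchanged.\<close>
  define Y where "Y = init m X"
  have hY: "homog_ideal (Suc m) Y" unfolding Y_def by (rule homog_ideal_init[OF hX])
  have zg: "zgraded m Y" unfolding Y_def by (rule zgraded_init[OF is_ideal_0[OF homog_ideal_ideal[OF hX]]])
  have tY: "trunc m ` Y = trunc m ` X" unfolding Y_def by (rule trunc_init[OF hX])
  have PY: "P Y" using X tY hY hdim_init[OF hX] betti_init[OF hX, of i j] unfolding P_def Y_def by auto
  have z0: "zsec m 0 Y = trunc m ` Y" by (rule zsec_0_eq_trunc[OF zg homog_ideal_ideal[OF hY]])
  have carry: "single w 1 * q \<in> zsec m 0 Y"
    if h: "d \<le> j" "k \<le> d" "w \<in> mons m" "tdeg w = k" "q \<in> gpiece (d - k) (zsec m k Y)" for d k w q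
  proof (cases "k = 0")
    case True
    then show ?thesis using h by (simp add: gpiece_def)
  next
    case False
    then obtain v where "v \<in> keys w" using h(4) by (metis keys_eq_empty ex_in_conv tdeg_zero)
    then have "0 < m" using h(3) by (auto simp: mons_def)
    \<comment> \<open>The distraction is adapted to the given \<open>w\<close>: it sends
      \<open>x_m ^ k * q\<close> to an element whose restriction to \<open>x_m = 0\<close> is
      \<open>w\<close> times \<open>q\<close> up to sign.\<close>
    then obtain a where a: "\<forall>r. a r < m" and wa: "single w 1 = (\<Prod>r<k. var (a r) :: 'k mpoly)"
      using monomial_eq_prod_var[OF _ h(3,4)] by blast
    have a': "a r < m" for r using a by blast
    define D where "D = distr m a ` Y"
    have hD: "homog_ideal (Suc m) D" unfolding D_def by (rule homog_ideal_distr[of a m, OF a' hY zg])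
    have tD: "trunc m ` Y \<subseteq> trunc m ` D"
    proof
      fix y assume "y \<in> trunc m ` Y"
      then have "y \<in> zsec m 0 Y" using z0 by simp
      then show "y \<in> trunc m ` D" using zsec_trunc_distr[of a m, OF a' hY zg, of y 0] by (simp add: D_def)
    qed
    have "P D" unfolding P_def
    proof (intro conjI allI)
      show "homog_ideal (Suc m) D" by (rule hD)
      show "G \<subseteq> trunc m ` D" using PY tD by (auto simp: P_def)
      show "hdim d D = hdim d I" for d using PY hdim_distr[of a m, OF a' hY, of d] by (simp add: P_def D_def)
      show "betti (Suc m) I i j \<le> betti (Suc m) D i j"
        using PY betti_distr[of a m, OF a' hY zg, of i j] by (simp add: P_def D_def)
    qed
    then have le: "\<Phi> D \<le> \<Phi> Y" using max[of D] tY by (simp add: \<Phi>_def)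
    have i0: "is_ideal m (trunc m ` D)" "is_ideal m (trunc m ` Y)"
      using homog_ideal_ideal homog_ideal_trunc hD hY by blast+
    have mono: "hdim e (trunc m ` Y) \<le> hdim e (trunc m ` D)" for e
      by (rule hdim_mono[OF tD is_ideal_subset[OF i0(1)]])
    \<comment> \<open>A strict increase in one degree \<open>d \<le> j\<close>, with no decrease
      elsewhere, would contradict the choice of \<open>X\<close>. So in degree \<open>d\<close> the
      distraction adds nothing, and what it puts into the section was already there.\<close>
    have "hdim d (trunc m ` D) \<le> hdim d (trunc m ` Y)"
    proof (rule ccontr)
      assume "\<not> ?thesis"
      then have "\<Phi> Y < \<Phi> D" unfolding \<Phi>_def using mono h(1)
        by (intro sum_strict_mono_ex1) (auto intro!: bexI[of _ d])
      then show False using le by simp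
    qed
    then have e: "gpiece d (trunc m ` Y) = gpiece d (trunc m ` D)"
      unfolding hdim_def
      by (intro pv.subspace_eq_of_dim_eq gpiece_mono tD fin_dim_gpiece[OF is_ideal_subset[OF i0(1)]]
          subspace_gpiece is_ideal_subspace[OF i0(1)] is_ideal_subspace[OF i0(2)])
    have q: "q \<in> zsec m k Y" "homog (d - k) q" using h(5) by (auto simp: gpiece_def)
    have "single w 1 * q \<in> trunc m ` D"
      unfolding wa D_def by (rule zsec_trunc_distr[of a m, OF a' hY zg q(1)])
    moreover have "homog d (single w 1 * q)"
      using homog_mult[of k "single w 1" "d - k" q] q(2) h(2,4) by simp
    ultimately have "single w 1 * q \<in> gpiece d (trunc m ` Y)" unfolding e by (simp add: gpiece_def)
    then show ?thesis unfolding z0 by (simp add: gpiece_def)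
  qed
  show thesis by (rule that[OF hY zg _ _ _ carry]) (use PY in \<open>auto simp: P_def\<close>)
qed

lemma LPP_step:
  fixes gs :: "'k::field mpoly list"
  assumes es: "length es \<le> m" "sorted es" and lpp: "LPP m (map (trunc m) gs) es"
  shows "LPP (Suc m) gs es"
  unfolding LPP_def
proof (intro conjI allI impI)
  let ?gs = "map (trunc m) gs"
  have E: "EGH m ?gs es" using lpp by (simp add: LPP_def)
  show "EGH (Suc m) gs es" by (rule EGH_step[OF es E])
  fix I L :: "'k mpoly set" and i j
  assume h: "homog_ideal (Suc m) I \<and> ideal_gen (Suc m) (set gs) \<subseteq> I \<and> lex_ideal (Suc m) L
    \<and> hilb (Suc m) (ideal_gen (Suc m) (L \<union> pow_ideal (Suc m) es)) = hilb (Suc m) I"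
  then have I: "homog_ideal (Suc m) I" and gsI: "set gs \<subseteq> I" and L: "lex_ideal (Suc m) L"
    using ideal_gen_subset[of "set gs" "Suc m"] by auto
  define U where "U = {t\<in>mons (Suc m). single t 1 \<in> L} \<union> pow_mons (Suc m) es"
  have esS: "length es \<le> Suc m" using es(1) by simp
  let ?M = "monomial_ideal (Suc m) U :: 'k mpoly set"
  have M: "ideal_gen (Suc m) (L \<union> pow_ideal (Suc m) es) = ?M" and upU: "up_closed (Suc m) U"
    unfolding U_def by (rule lex_plus_powers_eq[OF esS L])+
  have hM: "homog_ideal (Suc m) ?M" by (rule homog_monomial_ideal[OF upU])
  have hdM: "hdim d ?M = hdim d I" for d
    using h hilb_eq_iff[OF is_ideal_subset[OF homog_ideal_ideal[OF hM]] is_ideal_subset[OF homog_ideal_ideal[OF I]]]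
    by (simp add: M)
  have "set ?gs \<subseteq> trunc m ` I" using gsI by auto
  then obtain Y where hY: "homog_ideal (Suc m) Y" and zg: "zgraded m Y" and gsY: "set ?gs \<subseteq> trunc m ` Y"
    and hd: "\<And>d. hdim d Y = hdim d I" and bY: "betti (Suc m) I i j \<le> betti (Suc m) Y i j"
    and carry: "\<And>d k w q. d \<le> j \<Longrightarrow> k \<le> d \<Longrightarrow> w \<in> mons m \<Longrightarrow> tdeg w = k \<Longrightarrow> q \<in> gpiece (d - k) (zsec m k Y)
      \<Longrightarrow> single w 1 * q \<in> zsec m 0 Y"
    using extremal_ideal[OF I, of "set ?gs" i j] by blast
  have iY: "is_ideal (Suc m) Y" by (rule homog_ideal_ideal[OF hY])
  have z0: "zsec m 0 Y = trunc m ` Y" by (rule zsec_0_eq_trunc[OF zg iY])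
  have h0: "homog_ideal m (trunc m ` Y)" by (rule homog_ideal_trunc[OF hY])
  have gs0: "ideal_gen m (set ?gs) \<subseteq> trunc m ` Y" by (rule ideal_gen_minimal[OF homog_ideal_ideal[OF h0] gsY])
  have gsk: "ideal_gen m (set ?gs) \<subseteq> zsec m k Y" for k
    using gs0 zsec_mono[OF iY, of 0 k] z0 by auto
  let ?h = "\<lambda>d. hdim d (trunc m ` Y)"
  have g: "lpp_growth m es ?h" by (rule EGH_lpp_growth[OF es E h0 gs0])
  let ?J = "monomial_ideal m (lpp_mons m es ?h) :: 'k mpoly set"
  have hJ: "homog_ideal m ?J" by (rule homog_monomial_ideal[OF up_closed_lpp_mons[OF g]])
  have hdJ: "hdim d ?J = hdim d (trunc m ` Y)" for d by (rule hdim_lpp[OF g])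
  \<comment> \<open>The property assumed in \<open>m\<close> variables speaks about ideals generated
    by a lex ideal and the pure powers, so \<open>?J\<close> has to be presented in this form before
    it can be applied.\<close>
  obtain L' :: "'k mpoly set" where L': "lex_ideal m L'" "ideal_gen m (L' \<union> pow_ideal m es) = ?J"
    using lpp_growth_lex[OF es(1) g] by blast
  have "hilb m ?J = hilb m (trunc m ` Y)"
    using hilb_eq_iff[OF is_ideal_subset[OF homog_ideal_ideal[OF hJ]] is_ideal_subset[OF homog_ideal_ideal[OF h0]]] hdJ by simp
  then have bJ: "betti m (trunc m ` Y) i j \<le> betti m ?J i j"
    using lpp h0 gs0 L' unfolding LPP_def by metis
  have "betti (Suc m) Y i j \<le> betti (Suc m) ?M i j"
  proof (rule betti_compare[OF hY hM _ _ hJ hdJ bJ])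
    show "last_stable m ?M" by (rule lex_plus_powers_stable[OF es(1) L U_def])
    show "hdim d Y = hdim d ?M" for d using hd hdM by simp
    fix d assume d: "d \<le> j - i"
    show "gpiece d (trunc m ` ?M) \<subseteq> gpiece d ?J"
    proof
      fix p assume "p \<in> gpiece d (trunc m ` ?M)"
      then obtain p' where p': "p' \<in> ?M" "p = trunc m p'" and hp: "homog d p" by (auto simp: gpiece_def)
      have "t \<in> lpp_mons m es ?h" if t: "t \<in> keys p" for t
      proof -
        have tU: "t \<in> U" "t \<in> mons m" "tdeg t = d"
          using t p' hp by (auto simp: monomial_ideal_def trunc_restr keys_restr homog_def)
        have "t \<in> lpp_mons m es (\<lambda>d. hdim d (zsec m 0 Y))"
        proof (rule hyperplane_section[OF es E hY zg gsk _ lex_plus_powers_segment[OF L U_def] _ _ tU])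
          show "pow_mons (Suc m) es \<subseteq> U" by (simp add: U_def)
          show "card {t\<in>U. t \<in> mons (Suc m) \<and> tdeg t = d} = hdim d Y"
            unfolding hd hdM[symmetric] hdim_monomial_ideal ..
          show "single w 1 * q \<in> zsec m 0 Y"
            if "k \<le> d" "w \<in> mons m" "tdeg w = k" "q \<in> gpiece (d - k) (zsec m k Y)" for k w q
            by (rule carry[OF _ that]) (use d in simp)
        qed
        then show ?thesis by (simp add: z0)
      qed
      then show "p \<in> gpiece d ?J" using hp p'(2) trunc_polys by (auto simp: gpiece_def monomial_ideal_def)
    qed
  qed
  then show "betti (Suc m) I i j \<le> betti (Suc m) (ideal_gen (Suc m) (L \<union> pow_ideal (Suc m) es)) i j"
    using bY unfolding M by simp
qed

theorem theorem4p1: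
  fixes fs :: "'k::field mpoly list" and es :: "nat list" and n c :: nat
  assumes "c = length fs" and "length es = c" and "c \<le> n"
    and "sorted es"
    and "\<forall>i<c. homog (es ! i) (fs ! i)"
    and "regular_seq n (fs @ map var [c..<n])"
    and "EGH c (map (trunc c) fs) es"
    and "LPP c (map (trunc c) fs) es"
  shows "EGH n fs es \<and> LPP n fs es"
proof -
  \<comment> \<open>The induction carries the sequence truncated to \<open>m\<close> variables;
    truncating first to \<open>m + 1\<close> and then to \<open>m\<close> variables is the same as
    truncating to \<open>m\<close>. It starts at \<open>m = c\<close> with the hypothesis, and at
    \<open>m = n\<close> nothing is cut off.\<close>
  have "LPP m (map (trunc m) fs) es" if "c \<le> m" for m
    using that
  proof (induction m rule: dec_induct)
    case base then show ?case by (rule assms(8))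
  next
    case (step m)
    have e: "map (trunc m) (map (trunc (Suc m)) fs) = map (trunc m) fs" by (simp add: trunc_trunc)
    have "LPP m (map (trunc m) (map (trunc (Suc m)) fs)) es" unfolding e by (rule step.IH)
    then show ?case by (rule LPP_step[rotated 2]) (use step.hyps(1) assms(2,4) in auto)
  qed
  moreover have "set fs \<subseteq> polys n" using assms(6) by (simp add: regular_seq_def)
  then have "map (trunc n) fs = fs" by (auto intro!: map_idI simp: trunc_id)
  ultimately have "LPP n fs es" using assms(3) by metis
  then show ?thesis by (simp add: LPP_def)
qed

end
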